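(* The following decision problem is $\Pi_3^P$-hard: given two (finite, ground) ELPs $\Pi_1=(\mathcal{A},\mathcal{E},\mathcal{R}_1)$ and $\Pi_2=(\mathcal{A},\mathcal{E},\mathcal{R}_2)$, decide whether $\Pi_1$ and $\Pi_2$ are uniformly WV-equivalent.
   Context: Logic programs, GL-reduct and answer sets $AS(\cdot)$ are as usual for disjunctive programs with nested default negation $\neg$. An ELP is a triple $(\mathcal{A},\mathcal{E},\mathcal{R})$: $\mathcal{A}$ atoms, $\mathcal{E}$ a set of epistemic literals $\mathbf{not}\,\ell$ ($\ell$ a literal), $\mathcal{R}$ a finite set of rules $a_1\vee\cdots\vee a_k\leftarrow\ell_1,\dots,\ell_m,\xi_1,\dots,\xi_j,\neg\xi_{j+1},\dots,\neg\xi_n$ with $\xi_i\in\mathcal{E}$. For $D\subseteq\mathcal{A}$, $\Pi\cup D$ adds the facts $a\leftarrow$ ($a\in D$). For a guess $\Phi\subseteq\mathcal{E}$, the epistemic reduct $\Pi^\Phi$ replaces each $\mathbf{not}\,\ell\in\Phi$ by $\top$ and every remaining $\mathbf{not}$ by $\neg$. $\mathcal{I}$ is $\Phi$-compatible w.r.t. $\mathcal{E}$ iff $\mathcal{I}\neq\emptyset$, each $\mathbf{not}\,\ell\in\Phi$ has some $I\in\mathcal{I}$ with $I\not\models\ell$, and each $\mathbf{not}\,\ell\in\mathcal{E}\setminus\Phi$ has $I\models\ell$ for all $I\in\mathcal{I}$. A candidate world view (CWV) of $\Pi$ is $\mathcal{M}=AS(\Pi^\Phi)$ that is $\Phi$-compatible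 for some $\Phi\subseteq\mathcal{E}$; it is a world view (WV) if its guess $\Phi$ is subset-maximal, i.e. no CWV of $\Pi$ has an associated guess $\Phi'\supsetneq\Phi$. $\Pi_1,\Pi_2$ are uniformly WV-equivalent iff for every $D\subseteq\mathcal{A}$, $\Pi_1\cup D$ and $\Pi_2\cup D$ have the same set of WVs. *)

theory Defs
  imports Main "HOL-Computational_Algebra.Polynomial"
begin

section \<open>Logic programs with nested default negation\<close>

datatype 'a lit = PosLit 'a | NegLit 'a

fun lit_atom :: "'a lit \<Rightarrow> 'a" where
  "lit_atom (PosLit a) = a"
| "lit_atom (NegLit a) = a"

datatype 'a nlit = Top | Atom 'a | Naf "'a nlit"

fun nlit_of_lit :: "'a lit \<Rightarrow> 'a nlit" where
  "nlit_of_lit (PosLit a) = Atom a"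
| "nlit_of_lit (NegLit a) = Naf (Atom a)"

fun nlit_true :: "'a set \<Rightarrow> 'a nlit \<Rightarrow> bool" where
  "nlit_true I Top \<longleftrightarrow> True"
| "nlit_true I (Atom a) \<longleftrightarrow> a \<in> I"
| "nlit_true I (Naf f) \<longleftrightarrow> \<not> nlit_true I f"

definition lit_true :: "'a set \<Rightarrow> 'a lit \<Rightarrow> bool" where
  "lit_true I l \<longleftrightarrow> nlit_true I (nlit_of_lit l)"

fun is_Naf :: "'a nlit \<Rightarrow> bool" where
  "is_Naf (Naf f) \<longleftrightarrow> True"
| "is_Naf _ \<longleftrightarrow> False"

text \<open>An empty head is allowed and gives a constraint.\<close>

datatype 'a rule = Rule (rule_head: "'a list") (rule_body: "'a nlit list")

record 'a lp =
  lp_atoms :: "'a set"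
  lp_rules :: "'a rule set"

definition sat_rule :: "'a set \<Rightarrow> 'a rule \<Rightarrow> bool" where
  "sat_rule I r \<longleftrightarrow>
    ((\<forall>f \<in> set (rule_body r). nlit_true I f) \<longrightarrow> (\<exists>a \<in> set (rule_head r). a \<in> I))"

definition GL_reduct :: "'a rule set \<Rightarrow> 'a set \<Rightarrow> 'a rule set" where
  "GL_reduct R I =
    {Rule (rule_head r) (filter (\<lambda>f. \<not> is_Naf f) (rule_body r)) | r.
      r \<in> R \<and> (\<forall>f \<in> set (rule_body r). is_Naf f \<longrightarrow> nlit_true I f)}"

definition answer_sets :: "'a lp \<Rightarrow> 'a set set" where
  "answer_sets P =
    {I. I \<subseteq> lp_atoms P \<and> (\<forall>r \<in> lp_rules P. sat_rule I r) \<and>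
        \<not> (\<exists>J. J \<subset> I \<and> (\<forall>r \<in> GL_reduct (lp_rules P) I. sat_rule J r))}"

section \<open>Epistemic logic programs\<close>

datatype 'a elit = ENot "'a lit"

fun elit_lit :: "'a elit \<Rightarrow> 'a lit" where
  "elit_lit (ENot l) = l"

text \<open>
  The four components are the head, the literals, the epistemic literals
  occurring positively and those occurring under \<open>\<not>\<close>.
\<close>

datatype 'a erule =
  ERule (erule_head: "'a list") (erule_lits: "'a lit list")
    (erule_epos: "'a elit list") (erule_eneg: "'a elit list")

record 'a elp =
  elp_atoms :: "'a set"
  elp_elits :: "'a elit set"
  elp_rules :: "'a erule set"

definition erule_over :: "'a set \<Rightarrow> 'a elit set \<Rightarrow> 'a erule \<Rightarrow> bool" where
  "erule_over A E r \<longleftrightarrow>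
    set (erule_head r) \<subseteq> A \<and> lit_atom ` set (erule_lits r) \<subseteq> A \<and>
    set (erule_epos r) \<subseteq> E \<and> set (erule_eneg r) \<subseteq> E"

definition is_elp :: "'a elp \<Rightarrow> bool" where
  "is_elp P \<longleftrightarrow>
    finite (elp_atoms P) \<and> finite (elp_elits P) \<and> finite (elp_rules P) \<and>
    (\<forall>\<xi> \<in> elp_elits P. lit_atom (elit_lit \<xi>) \<in> elp_atoms P) \<and>
    (\<forall>r \<in> elp_rules P. erule_over (elp_atoms P) (elp_elits P) r)"

definition add_facts :: "'a elp \<Rightarrow> 'a set \<Rightarrow> 'a elp" where
  "add_facts P D = P\<lparr>elp_rules := elp_rules P \<union> (\<lambda>a. ERule [a] [] [] []) ` D\<rparr>"

definition reduct_elit :: "'a elit set \<Rightarrow> 'a elit \<Rightarrow> 'a nlit" where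
  "reduct_elit \<Phi> \<xi> = (if \<xi> \<in> \<Phi> then Top else Naf (nlit_of_lit (elit_lit \<xi>)))"

definition reduct_erule :: "'a elit set \<Rightarrow> 'a erule \<Rightarrow> 'a rule" where
  "reduct_erule \<Phi> r = Rule (erule_head r)
    (map nlit_of_lit (erule_lits r) @
     map (reduct_elit \<Phi>) (erule_epos r) @
     map (\<lambda>\<xi>. Naf (reduct_elit \<Phi> \<xi>)) (erule_eneg r))"

definition epistemic_reduct :: "'a elp \<Rightarrow> 'a elit set \<Rightarrow> 'a lp" where
  "epistemic_reduct P \<Phi> =
    \<lparr>lp_atoms = elp_atoms P, lp_rules = reduct_erule \<Phi> ` elp_rules P\<rparr>"

definition compatible :: "'a elit set \<Rightarrow> 'a elit set \<Rightarrow> 'a set set \<Rightarrow> bool" where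
  "compatible E \<Phi> \<I> \<longleftrightarrow>
    \<I> \<noteq> {} \<and>
    (\<forall>\<xi> \<in> \<Phi>. \<exists>I \<in> \<I>. \<not> lit_true I (elit_lit \<xi>)) \<and>
    (\<forall>\<xi> \<in> E - \<Phi>. \<forall>I \<in> \<I>. lit_true I (elit_lit \<xi>))"

text \<open>\<open>cwv P \<Phi> M\<close>: \<open>M\<close> is a candidate world view of \<open>P\<close> with associated guess \<open>\<Phi>\<close>.\<close>

definition cwv :: "'a elp \<Rightarrow> 'a elit set \<Rightarrow> 'a set set \<Rightarrow> bool" where
  "cwv P \<Phi> M \<longleftrightarrow>
    \<Phi> \<subseteq> elp_elits P \<and> M = answer_sets (epistemic_reduct P \<Phi>) \<and>
    compatible (elp_elits P) \<Phi> M"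

definition world_views :: "'a elp \<Rightarrow> 'a set set set" where
  "world_views P = {M. \<exists>\<Phi>. cwv P \<Phi> M \<and> \<not> (\<exists>\<Phi>' M'. \<Phi> \<subset> \<Phi>' \<and> cwv P \<Phi>' M')}"

text \<open>Only used for programs with the same set of atoms.\<close>

definition uniformly_WV_equivalent :: "'a elp \<Rightarrow> 'a elp \<Rightarrow> bool" where
  "uniformly_WV_equivalent P Q \<longleftrightarrow>
    (\<forall>D \<subseteq> elp_atoms P. world_views (add_facts P D) = world_views (add_facts Q D))"

section \<open>Polynomial time and the polynomial hierarchy\<close>

type_synonym bits = "bool list"

text \<open>
  Deterministic multi-tape Turing machines with two-way infinite tapes. States are
  \<open>{..<num_states M}\<close>, with start state \<open>0\<close> and halting state \<open>1\<close>; tape symbols are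
  \<open>{..<num_syms M}\<close>, where \<open>0\<close> is the blank and \<open>1\<close>, \<open>2\<close> stand for the bits
  \<open>False\<close>, \<open>True\<close>. Tape \<open>0\<close> is the input tape and tape \<open>1\<close> the output tape.
\<close>

datatype move = MoveLeft | Stay | MoveRight

record tm =
  num_tapes :: nat
  num_syms :: nat
  num_states :: nat
  trans :: "nat \<Rightarrow> nat list \<Rightarrow> nat \<times> (nat \<times> move) list"

definition is_tm :: "tm \<Rightarrow> bool" where
  "is_tm M \<longleftrightarrow>
    num_tapes M \<ge> 2 \<and> num_syms M \<ge> 3 \<and> num_states M \<ge> 2 \<and>
    (\<forall>q < num_states M. \<forall>gs. length gs = num_tapes M \<and> set gs \<subseteq> {..<num_syms M} \<longrightarrow>
      fst (trans M q gs) < num_states M \<and>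
      length (snd (trans M q gs)) = num_tapes M \<and>
      fst ` set (snd (trans M q gs)) \<subseteq> {..<num_syms M})"

type_synonym tape = "(int \<Rightarrow> nat) \<times> int"
type_synonym config = "nat \<times> tape list"

fun move_head :: "move \<Rightarrow> int \<Rightarrow> int" where
  "move_head MoveLeft i = i - 1"
| "move_head Stay i = i"
| "move_head MoveRight i = i + 1"

fun tape_read :: "tape \<Rightarrow> nat" where
  "tape_read (c, i) = c i"

fun tape_act :: "nat \<times> move \<Rightarrow> tape \<Rightarrow> tape" where
  "tape_act (g, m) (c, i) = (c(i := g), move_head m i)"

fun tm_step :: "tm \<Rightarrow> config \<Rightarrow> config" where
  "tm_step M (q, ts) =
    (if q = 1 then (q, ts)
     else let (q', as) = trans M q (map tape_read ts) in (q', map2 tape_act as ts))"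

definition bits_tape :: "bits \<Rightarrow> int \<Rightarrow> nat" where
  "bits_tape w i =
    (if 0 \<le> i \<and> i < int (length w) then (if w ! nat i then 2 else 1) else 0)"

definition tm_init :: "tm \<Rightarrow> bits \<Rightarrow> config" where
  "tm_init M w = (0, (bits_tape w, 0) # replicate (num_tapes M - 1) (bits_tape [], 0))"

definition tm_computes_in_time :: "tm \<Rightarrow> (bits \<Rightarrow> bits) \<Rightarrow> (nat \<Rightarrow> nat) \<Rightarrow> bool" where
  "tm_computes_in_time M f T \<longleftrightarrow>
    (\<forall>w. \<exists>n \<le> T (length w). \<exists>ts.
      (tm_step M ^^ n) (tm_init M w) = (1, ts) \<and> fst (ts ! 1) = bits_tape (f w))"

definition polytime_computable :: "(bits \<Rightarrow> bits) \<Rightarrow> bool" where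
  "polytime_computable f \<longleftrightarrow>
    (\<exists>M (p :: nat poly). is_tm M \<and> tm_computes_in_time M f (poly p))"

definition PTIME :: "bits set set" where
  "PTIME = {L. polytime_computable (\<lambda>w. [w \<in> L])}"

text \<open>Lists are encoded self-delimitingly: every element is preceded by \<open>True\<close>, the end is \<open>False\<close>.\<close>

definition enc_list :: "('a \<Rightarrow> bits) \<Rightarrow> 'a list \<Rightarrow> bits" where
  "enc_list e xs = concat (map (\<lambda>x. True # e x) xs) @ [False]"

definition enc_bits :: "bits \<Rightarrow> bits" where
  "enc_bits = enc_list (\<lambda>b. [b])"

definition pair_bits :: "bits \<Rightarrow> bits \<Rightarrow> bits" where
  "pair_bits x y = enc_bits x @ y"

text \<open>
  The levels of the polynomial hierarchy, by alternating polynomially bounded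
  quantifiers over a polynomial-time predicate.
\<close>

fun Sigma_P :: "nat \<Rightarrow> bits set set" and Pi_P :: "nat \<Rightarrow> bits set set" where
  "Sigma_P 0 = PTIME"
| "Sigma_P (Suc k) =
    {L. \<exists>L' \<in> Pi_P k. \<exists>p :: nat poly. \<forall>x.
      x \<in> L \<longleftrightarrow> (\<exists>y. length y \<le> poly p (length x) \<and> pair_bits x y \<in> L')}"
| "Pi_P 0 = PTIME"
| "Pi_P (Suc k) =
    {L. \<exists>L' \<in> Sigma_P k. \<exists>p :: nat poly. \<forall>x.
      x \<in> L \<longleftrightarrow> (\<forall>y. length y \<le> poly p (length x) \<longrightarrow> pair_bits x y \<in> L')}"

definition polytime_reducible :: "bits set \<Rightarrow> bits set \<Rightarrow> bool" where
  "polytime_reducible L K \<longleftrightarrow> (\<exists>f. polytime_computable f \<and> (\<forall>x. x \<in> L \<longleftrightarrow> f x \<in> K))"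

definition hard_for :: "bits set set \<Rightarrow> bits set \<Rightarrow> bool" where
  "hard_for C K \<longleftrightarrow> (\<forall>L \<in> C. polytime_reducible L K)"

section \<open>The decision problem\<close>

text \<open>Atoms of input programs are named by bit strings.\<close>

fun enc_lit :: "bits lit \<Rightarrow> bits" where
  "enc_lit (PosLit a) = False # enc_bits a"
| "enc_lit (NegLit a) = True # enc_bits a"

fun enc_elit :: "bits elit \<Rightarrow> bits" where
  "enc_elit (ENot l) = enc_lit l"

fun enc_erule :: "bits erule \<Rightarrow> bits" where
  "enc_erule (ERule hs ls ps ns) =
    enc_list enc_bits hs @ enc_list enc_lit ls @ enc_list enc_elit ps @ enc_list enc_elit ns"

definition enc_instance ::
  "bits list \<Rightarrow> bits elit list \<Rightarrow> bits erule list \<Rightarrow> bits erule list \<Rightarrow> bits" where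
  "enc_instance as es rs1 rs2 =
    enc_list enc_bits as @ enc_list enc_elit es @
    enc_list enc_erule rs1 @ enc_list enc_erule rs2"

definition elp_of :: "'a list \<Rightarrow> 'a elit list \<Rightarrow> 'a erule list \<Rightarrow> 'a elp" where
  "elp_of as es rs = \<lparr>elp_atoms = set as, elp_elits = set es, elp_rules = set rs\<rparr>"

definition UNIFORM_WV_EQUIVALENCE :: "bits set" where
  "UNIFORM_WV_EQUIVALENCE =
    {enc_instance as es rs1 rs2 | as es rs1 rs2.
      is_elp (elp_of as es rs1) \<and> is_elp (elp_of as es rs2) \<and>
      uniformly_WV_equivalent (elp_of as es rs1) (elp_of as es rs2)}"

definition prefix_free :: "('a \<Rightarrow> bits) \<Rightarrow> bool" where
  "prefix_free e \<longleftrightarrow> (\<forall>x y u v. e x @ u = e y @ v \<longrightarrow> x = y \<and> u = v)"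

lemma prefix_freeD: "prefix_free e \<Longrightarrow> e x @ u = e y @ v \<Longrightarrow> x = y \<and> u = v"
  unfolding prefix_free_def by blast

lemma prefix_free_enc_list:
  assumes "prefix_free e"
  shows "prefix_free (enc_list e)"
proof -
  have "xs = ys \<and> u = v" if "enc_list e xs @ u = enc_list e ys @ v" for xs ys u v
    using that
  proof (induction xs arbitrary: ys)
    case Nil
    then show ?case by (cases ys) (auto simp: enc_list_def)
  next
    case (Cons x xs)
    then obtain y ys' where ys: "ys = y # ys'"
      by (cases ys) (auto simp: enc_list_def)
    have "e x @ (enc_list e xs @ u) = e y @ (enc_list e ys' @ v)"
      using Cons.prems by (simp add: ys enc_list_def)
    from prefix_freeD[OF assms this] Cons.IH show ?case by (auto simp: ys)
  qed
  then show ?thesis unfolding prefix_free_def by blast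
qed

lemma prefix_free_enc_bits: "prefix_free enc_bits"
  unfolding enc_bits_def by (rule prefix_free_enc_list) (simp add: prefix_free_def)

lemma prefix_free_enc_lit: "prefix_free enc_lit"
  unfolding prefix_free_def
proof (intro allI impI)
  fix x y :: "bits lit" and u v
  assume "enc_lit x @ u = enc_lit y @ v"
  then show "x = y \<and> u = v"
    by (cases x; cases y) (auto dest: prefix_freeD[OF prefix_free_enc_bits])
qed

lemma prefix_free_enc_elit: "prefix_free enc_elit"
  unfolding prefix_free_def
proof (intro allI impI)
  fix x y :: "bits elit" and u v
  assume "enc_elit x @ u = enc_elit y @ v"
  then show "x = y \<and> u = v"
    by (cases x; cases y) (auto dest: prefix_freeD[OF prefix_free_enc_lit])
qed

lemma prefix_free_enc_erule: "prefix_free enc_erule"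
  unfolding prefix_free_def
proof (intro allI impI)
  fix x y :: "bits erule" and u v
  assume "enc_erule x @ u = enc_erule y @ v"
  then show "x = y \<and> u = v"
    by (cases x; cases y)
      (auto dest!: prefix_freeD[OF prefix_free_enc_list[OF prefix_free_enc_bits]]
        prefix_freeD[OF prefix_free_enc_list[OF prefix_free_enc_lit]]
        prefix_freeD[OF prefix_free_enc_list[OF prefix_free_enc_elit]])
qed

lemma enc_instance_inject:
  "enc_instance as es rs1 rs2 = enc_instance as' es' rs1' rs2' \<longleftrightarrow>
    as = as' \<and> es = es' \<and> rs1 = rs1' \<and> rs2 = rs2'"
proof
  assume "enc_instance as es rs1 rs2 = enc_instance as' es' rs1' rs2'"
  then have *: "enc_list enc_bits as @ enc_list enc_elit es @ enc_list enc_erule rs1 @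
      enc_list enc_erule rs2 @ [] =
    enc_list enc_bits as' @ enc_list enc_elit es' @ enc_list enc_erule rs1' @
      enc_list enc_erule rs2' @ []"
    by (simp add: enc_instance_def)
  note as = prefix_freeD[OF prefix_free_enc_list[OF prefix_free_enc_bits] *]
  note es = prefix_freeD[OF prefix_free_enc_list[OF prefix_free_enc_elit] as[THEN conjunct2]]
  note rs1 = prefix_freeD[OF prefix_free_enc_list[OF prefix_free_enc_erule] es[THEN conjunct2]]
  note rs2 = prefix_freeD[OF prefix_free_enc_list[OF prefix_free_enc_erule] rs1[THEN conjunct2]]
  show "as = as' \<and> es = es' \<and> rs1 = rs1' \<and> rs2 = rs2'"
    using as es rs1 rs2 by blast
qed simp

end

theory Submission
  imports Defs
begin

text \<open>
  Let \<open>x \<in> K\<close> iff \<open>\<forall>y1. \<exists>y2. \<forall>y3. \<langle>\<langle>\<langle>x, y1\<rangle>, y2\<rangle>, y3\<rangle> \<in> L\<close>, where the strings are polynomially bounded and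
  \<open>L\<close> is decided by a polynomial-time machine. The machine is simulated by Horn rules over its
  tableau, which derive an atom \<open>w\<close> iff it accepts. The string \<open>y1\<close> is encoded in the added facts
  \<open>D\<close>, \<open>y2\<close> is guessed by disjunctive rules, and \<open>y3\<close> is guessed and saturated: \<open>w\<close> implies all
  atoms depending on \<open>y3\<close>, so an answer set containing \<open>w\<close> exists iff some \<open>y2\<close> makes all \<open>y3\<close>
  accepting.

  The constraint \<open>\<leftarrow> \<not> not \<ell>\<close> is void if \<open>not \<ell>\<close> is guessed and makes the guess incompatible
  otherwise. With this constraint for every atom that does not encode \<open>y1\<close>, facts for such atoms destroy
  all world views. The second program has the additional constraint for \<open>not \<not>w\<close>: if some answer set
  contains \<open>w\<close>, then both programs have the same world view; if none does, then only the first one has a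
  world view.

  The reduction is a fixed list of rule schemas with nested loops over polynomial ranges. A
  Turing machine prints their ground instances using the head positions on auxiliary tapes as counters.
\<close>

section \<open>Structured programs for Turing machines\<close>

text \<open>The three quantifiers have three sources: the facts, the existence of a stable model
  containing \<open>w\<close>, and the minimality test inside that model. Compatibility speaks about
  all stable models at once: forcing \<open>ENot (PosLit a)\<close> demands, for every set of input
  facts, a stable model without \<open>a\<close>. So the program must be able to decline the
  simulation, whatever the facts are. Default negation is applied to input atoms only, and their
  truth values in a stable model are those of the facts. Hence all stable models for the same facts
  have the same reduct, and the minimality test compares simulations with the same
  \<open>y1\<close>. The form of the tableau is dictated by the printer, whose index terms are sums
  of a constant and variables, without subtraction or comparison. Cells are therefore addressed
  relative to the head: a move shifts both halves of a tape by one cell, and no atom mentions a head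
  position. Polynomial time is proved once for the generic printer, so the reduction itself only has
  to be well-formed.\<close>

datatype cmd =
    Act nat "nat option" move
  | Seq cmd cmd
  | While nat "nat set" cmd
  | If nat "nat set" cmd cmd

definition keep :: "nat list \<Rightarrow> (nat \<times> move) list" where
  "keep gs = map (\<lambda>g. (g, Stay)) gs"

text \<open>The step depends on the scanned symbols alone, so a command can serve as a machine
  state; \<open>None\<close> means that it is finished. The tests of \<open>While\<close> and
  \<open>If\<close> cost a step of their own, in which \<open>keep\<close> rewrites every scanned
  symbol in place.\<close>

fun cstep :: "cmd \<Rightarrow> nat list \<Rightarrow> cmd option \<times> (nat \<times> move) list" where
  "cstep (Act \<tau> s m) gs =
    (None, (keep gs)[\<tau> := ((case s of None \<Rightarrow> gs ! \<tau> | Some g \<Rightarrow> g), m)])"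
| "cstep (Seq c d) gs =
    ((case fst (cstep c gs) of None \<Rightarrow> Some d | Some c' \<Rightarrow> Some (Seq c' d)), snd (cstep c gs))"
| "cstep (While \<tau> S c) gs =
    ((if gs ! \<tau> \<in> S then Some (Seq c (While \<tau> S c)) else None), keep gs)"
| "cstep (If \<tau> S c d) gs = (Some (if gs ! \<tau> \<in> S then c else d), keep gs)"

text \<open>Overapproximates the commands reachable by \<open>cstep\<close>. A loop body in progress
  is kept as \<open>Seq r (While ...)\<close>, so unfolding a loop creates nothing new and the set
  stays finite; it yields the states of the machine.\<close>

fun residuals :: "cmd \<Rightarrow> cmd set" where
  "residuals (Act \<tau> s m) = {Act \<tau> s m}"
| "residuals (Seq c d) = (\<lambda>r. Seq r d) ` residuals c \<union> residuals d"
| "residuals (While \<tau> S c) = insert (While \<tau> S c) ((\<lambda>r. Seq r (While \<tau> S c)) ` residuals c)"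
| "residuals (If \<tau> S c d) = insert (If \<tau> S c d) (residuals c \<union> residuals d)"

lemma finite_residuals: "finite (residuals c)"
  by (induction c) auto

lemma self_in_residuals: "c \<in> residuals c"
  by (induction c) auto

lemma cstep_residuals:
  "r \<in> residuals c \<Longrightarrow> fst (cstep r gs) = Some r' \<Longrightarrow> r' \<in> residuals c"
proof (induction c arbitrary: r r')
  case (Seq c d)
  from Seq.prems(1) consider r1 where "r1 \<in> residuals c" "r = Seq r1 d" | "r \<in> residuals d"
    by auto
  then show ?case
  proof cases
    case 1
    then show ?thesis using Seq.prems(2) Seq.IH(1)[of r1] self_in_residuals[of d]
      by (cases "fst (cstep r1 gs)") auto
  next
    case 2
    then show ?thesis using Seq.IH(2)[OF 2 Seq.prems(2)] by simp
  qed
next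
  case (While \<tau> S c)
  from While.prems(1) consider r1 where "r1 \<in> residuals c" "r = Seq r1 (While \<tau> S c)"
    | "r = While \<tau> S c" by auto
  then show ?case
  proof cases
    case 1
    then show ?thesis using While.prems(2) While.IH[of r1]
      by (cases "fst (cstep r1 gs)") auto
  next
    case 2
    then show ?thesis using While.prems(2) self_in_residuals[of c] by (auto split: if_splits)
  qed
next
  case (If \<tau> S c d)
  from If.prems(1) consider "r = If \<tau> S c d" | "r \<in> residuals c" | "r \<in> residuals d" by auto
  then show ?case
  proof cases
    case 1
    then show ?thesis using If.prems(2) self_in_residuals[of c] self_in_residuals[of d]
      by (simp split: if_splits)
  next
    case 2
    then show ?thesis using If.IH(1)[OF 2 If.prems(2)] by simp
  next
    case 3
    then show ?thesis using If.IH(2)[OF 3 If.prems(2)] by simp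
  qed
qed simp

fun cmd_ok :: "nat \<Rightarrow> cmd \<Rightarrow> bool" where
  "cmd_ok K (Act \<tau> s m) \<longleftrightarrow> \<tau> < K \<and> (case s of None \<Rightarrow> True | Some g \<Rightarrow> g < 3)"
| "cmd_ok K (Seq c d) \<longleftrightarrow> cmd_ok K c \<and> cmd_ok K d"
| "cmd_ok K (While \<tau> S c) \<longleftrightarrow> cmd_ok K c"
| "cmd_ok K (If \<tau> S c d) \<longleftrightarrow> cmd_ok K c \<and> cmd_ok K d"

lemma cmd_ok_residuals: "cmd_ok K c \<Longrightarrow> \<forall>r \<in> residuals c. cmd_ok K r"
proof (induction c)
  case (Seq c d)
  then have "\<forall>r \<in> residuals c. cmd_ok K r" "\<forall>r \<in> residuals d. cmd_ok K r" "cmd_ok K d"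
    unfolding cmd_ok.simps by blast+
  then show ?case by auto
next
  case (While \<tau> S c)
  then have "\<forall>r \<in> residuals c. cmd_ok K r" "cmd_ok K c"
    unfolding cmd_ok.simps by blast+
  then show ?case by auto
next
  case (If \<tau> S c d)
  then have "\<forall>r \<in> residuals c. cmd_ok K r" "\<forall>r \<in> residuals d. cmd_ok K r" "cmd_ok K (If \<tau> S c d)"
    unfolding cmd_ok.simps by blast+
  then show ?case by auto
qed simp

lemma length_cstep: "length (snd (cstep c gs)) = length gs"
  by (induction c) (auto simp: keep_def)

lemma symbols_cstep:
  "cmd_ok (length gs) c \<Longrightarrow> set gs \<subseteq> {..<3} \<Longrightarrow> fst ` set (snd (cstep c gs)) \<subseteq> {..<3}"
proof (induction c)
  case (Act \<tau> s m)
  have "gs ! \<tau> < 3" using Act by (auto simp: subset_iff)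
  then have "(case s of None \<Rightarrow> gs ! \<tau> | Some g \<Rightarrow> g) < 3"
    using Act by (auto split: option.splits)
  moreover have "fst ` set (keep gs) \<subseteq> {..<3}"
    using Act by (auto simp: keep_def)
  ultimately show ?case
    using set_update_subset_insert[of "keep gs" \<tau>] by fastforce
qed (auto simp: keep_def)

inductive run :: "cmd \<Rightarrow> tape list \<Rightarrow> nat \<Rightarrow> tape list \<Rightarrow> bool" where
  run_done: "cstep c (map tape_read ts) = (None, as) \<Longrightarrow> run c ts 1 (map2 tape_act as ts)"
| run_more: "cstep c (map tape_read ts) = (Some c', as) \<Longrightarrow>
    run c' (map2 tape_act as ts) n ts' \<Longrightarrow> run c ts (Suc n) ts'"

lemma tape_act_read_Stay [simp]: "tape_act (tape_read t, Stay) t = t"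
  by (cases t) simp

lemma map2_tape_act_keep [simp]: "map2 tape_act (keep (map tape_read ts)) ts = ts"
  by (induction ts) (auto simp: keep_def)

lemma run_Act:
  assumes "\<tau> < length ts"
  shows "run (Act \<tau> s m) ts 1
    (ts[\<tau> := tape_act (case s of None \<Rightarrow> tape_read (ts ! \<tau>) | Some g \<Rightarrow> g, m) (ts ! \<tau>)])"
proof -
  let ?a = "(case s of None \<Rightarrow> tape_read (ts ! \<tau>) | Some g \<Rightarrow> g, m)"
  have eq: "map2 tape_act ((keep (map tape_read ts))[\<tau> := ?a]) ts = ts[\<tau> := tape_act ?a (ts ! \<tau>)]"
    using assms by (intro nth_equalityI) (auto simp: keep_def nth_list_update)
  have "cstep (Act \<tau> s m) (map tape_read ts) = (None, (keep (map tape_read ts))[\<tau> := ?a])"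
    using assms by (simp split: option.split)
  from run_done[of "Act \<tau> s m", OF this] show ?thesis unfolding eq .
qed

lemma run_Seq: "run c ts n ts' \<Longrightarrow> run d ts' m ts'' \<Longrightarrow> run (Seq c d) ts (n + m) ts''"
proof (induction rule: run.induct)
  case (run_done c ts as)
  then show ?case using run_more[of "Seq c d" ts d as m ts''] by simp
next
  case (run_more c ts c' as n ts')
  then show ?case using run.run_more[of "Seq c d" ts "Seq c' d" as "n + m" ts''] by simp
qed

lemma run_While_False:
  "\<tau> < length ts \<Longrightarrow> tape_read (ts ! \<tau>) \<notin> S \<Longrightarrow> run (While \<tau> S c) ts 1 ts"
  using run_done[of "While \<tau> S c" ts "keep (map tape_read ts)"] by simp

lemma run_While_True:
  "\<tau> < length ts \<Longrightarrow> tape_read (ts ! \<tau>) \<in> S \<Longrightarrow> run c ts n ts' \<Longrightarrow>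
    run (While \<tau> S c) ts' m ts'' \<Longrightarrow> run (While \<tau> S c) ts (Suc (n + m)) ts''"
  using run_more[of "While \<tau> S c" ts "Seq c (While \<tau> S c)" "keep (map tape_read ts)" "n + m" ts'']
  by (simp add: run_Seq)

lemma run_If:
  "\<tau> < length ts \<Longrightarrow> run (if tape_read (ts ! \<tau>) \<in> S then c else d) ts n ts' \<Longrightarrow>
    run (If \<tau> S c d) ts (Suc n) ts'"
  using run_more[of "If \<tau> S c d" ts "if tape_read (ts ! \<tau>) \<in> S then c else d"
      "keep (map tape_read ts)" n ts'] by simp

section \<open>States of the machine belonging to a command\<close>

definition numbering :: "cmd \<Rightarrow> cmd \<Rightarrow> nat" where
  "numbering c0 = (SOME h. inj_on h (residuals c0) \<and> h ` residuals c0 \<subseteq> {..<card (residuals c0)})"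

text \<open>The machine model fixes \<open>0\<close> as start and \<open>1\<close> as halting state,
  so the other residual commands are numbered from \<open>2\<close> on. The number
  \<open>2 + numbering c0 c0\<close> belongs to no command; there \<open>cmd_tm\<close> halts by
  default.\<close>

definition state_of :: "cmd \<Rightarrow> cmd option \<Rightarrow> nat" where
  "state_of c0 r = (case r of None \<Rightarrow> 1 | Some c \<Rightarrow> if c = c0 then 0 else 2 + numbering c0 c)"

definition cmd_of_state :: "cmd \<Rightarrow> nat \<Rightarrow> cmd" where
  "cmd_of_state c0 q = (SOME c. c \<in> residuals c0 \<and> state_of c0 (Some c) = q)"

definition cmd_tm :: "nat \<Rightarrow> cmd \<Rightarrow> tm" where
  "cmd_tm K c0 = \<lparr>num_tapes = K, num_syms = 3, num_states = 2 + card (residuals c0),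
    trans = (\<lambda>q gs.
      if q \<in> state_of c0 ` Some ` residuals c0
      then (state_of c0 (fst (cstep (cmd_of_state c0 q) gs)), snd (cstep (cmd_of_state c0 q) gs))
      else (1, keep gs))\<rparr>"

lemma numbering: "inj_on (numbering c0) (residuals c0)"
    "numbering c0 ` residuals c0 \<subseteq> {..<card (residuals c0)}"
proof -
  obtain h where "bij_betw h (residuals c0) {0..<card (residuals c0)}"
    using ex_bij_betw_finite_nat[OF finite_residuals] by blast
  then have "inj_on h (residuals c0) \<and> h ` residuals c0 \<subseteq> {..<card (residuals c0)}"
    by (auto simp: bij_betw_def)
  from someI[of "\<lambda>h. inj_on h (residuals c0) \<and> h ` residuals c0 \<subseteq> {..<card (residuals c0)}", OF this]
  show "inj_on (numbering c0) (residuals c0)"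
    "numbering c0 ` residuals c0 \<subseteq> {..<card (residuals c0)}"
    unfolding numbering_def by blast+
qed

lemma cmd_of_state_state_of:
  assumes "c \<in> residuals c0"
  shows "cmd_of_state c0 (state_of c0 (Some c)) = c"
proof -
  let ?P = "\<lambda>d. d \<in> residuals c0 \<and> state_of c0 (Some d) = state_of c0 (Some c)"
  have "?P (cmd_of_state c0 (state_of c0 (Some c)))"
    unfolding cmd_of_state_def by (rule someI[of ?P]) (use assms in simp)
  then show ?thesis
    using assms numbering(1)[of c0] by (auto simp: state_of_def inj_on_def split: if_splits)
qed

lemma state_of_less:
  assumes "\<And>c. r = Some c \<Longrightarrow> c \<in> residuals c0"
  shows "state_of c0 r < 2 + card (residuals c0)"
  using assms numbering(2)[of c0] by (auto simp: state_of_def split: option.splits)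

lemma is_tm_cmd_tm:
  assumes "cmd_ok K c0" "K \<ge> 2"
  shows "is_tm (cmd_tm K c0)"
  unfolding is_tm_def
proof (intro conjI allI impI)
  fix q gs
  assume gs: "length gs = num_tapes (cmd_tm K c0) \<and> set gs \<subseteq> {..<num_syms (cmd_tm K c0)}"
  let ?r = "trans (cmd_tm K c0) q gs"
  have "fst ?r < num_states (cmd_tm K c0) \<and> length (snd ?r) = num_tapes (cmd_tm K c0) \<and>
      fst ` set (snd ?r) \<subseteq> {..<num_syms (cmd_tm K c0)}"
  proof (cases "q \<in> state_of c0 ` Some ` residuals c0")
    case True
    then obtain c where c: "c \<in> residuals c0" "q = state_of c0 (Some c)" by blast
    then have "?r = (state_of c0 (fst (cstep c gs)), snd (cstep c gs))"
      using True by (simp add: cmd_tm_def cmd_of_state_state_of)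
    moreover have "state_of c0 (fst (cstep c gs)) < 2 + card (residuals c0)"
      by (rule state_of_less) (use c cstep_residuals in blast)
    moreover have "fst ` set (snd (cstep c gs)) \<subseteq> {..<3}"
      using symbols_cstep[of gs c] cmd_ok_residuals[OF assms(1)] c(1) gs by (simp add: cmd_tm_def)
    ultimately show ?thesis using gs by (simp add: cmd_tm_def length_cstep)
  next
    case False
    then show ?thesis using gs by (auto simp: cmd_tm_def keep_def)
  qed
  then show "fst ?r < num_states (cmd_tm K c0)" "length (snd ?r) = num_tapes (cmd_tm K c0)"
    "fst ` set (snd ?r) \<subseteq> {..<num_syms (cmd_tm K c0)}" by blast+
qed (use assms in \<open>auto simp: cmd_tm_def\<close>)

lemma run_cmd_tm:
  assumes "run c ts n ts'" "c \<in> residuals c0"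
  shows "(tm_step (cmd_tm K c0) ^^ n) (state_of c0 (Some c), ts) = (1, ts')"
  using assms
proof (induction rule: run.induct)
  case (run_done c ts as)
  then show ?case by (simp add: cmd_tm_def cmd_of_state_state_of) (simp add: state_of_def)
next
  case (run_more c ts c' as n ts')
  have "c' \<in> residuals c0"
    using run_more.hyps(1) run_more.prems cstep_residuals by (metis fst_conv)
  moreover have "tm_step (cmd_tm K c0) (state_of c0 (Some c), ts) =
      (state_of c0 (Some c'), map2 tape_act as ts)"
    using run_more.hyps(1) run_more.prems
    by (simp add: cmd_tm_def cmd_of_state_state_of) (simp add: state_of_def)
  ultimately show ?case using run_more.IH by (simp add: funpow_Suc_right del: funpow.simps)
qed

lemma polytime_computable_cmd:
  fixes p :: "nat poly"
  assumes "cmd_ok K c" "K \<ge> 2"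
    and "\<And>w. \<exists>n \<le> poly p (length w). \<exists>ts.
      run c ((bits_tape w, 0) # replicate (K - 1) (bits_tape [], 0)) n ts \<and>
      fst (ts ! 1) = bits_tape (f w)"
  shows "polytime_computable f"
  unfolding polytime_computable_def
proof (intro exI conjI)
  show "is_tm (cmd_tm K c)" using assms by (intro is_tm_cmd_tm)
  have init: "tm_init (cmd_tm K c) w =
      (state_of c (Some c), (bits_tape w, 0) # replicate (K - 1) (bits_tape [], 0))" for w
    by (simp add: tm_init_def cmd_tm_def state_of_def)
  show "tm_computes_in_time (cmd_tm K c) f (poly p)"
    unfolding tm_computes_in_time_def
  proof (intro allI)
    fix w
    obtain n ts where n: "n \<le> poly p (length w)" "fst (ts ! 1) = bits_tape (f w)"
      and r: "run c ((bits_tape w, 0) # replicate (K - 1) (bits_tape [], 0)) n ts"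
      using assms(3) by blast
    from run_cmd_tm[OF r self_in_residuals, of K] n
    show "\<exists>n\<le>poly p (length w). \<exists>ts. (tm_step (cmd_tm K c) ^^ n) (tm_init (cmd_tm K c) w) =
        (1, ts) \<and> fst (ts ! 1) = bits_tape (f w)"
      using init by auto
  qed
qed

section \<open>Polynomially bounded functions\<close>

lemma poly_mono_nat:
  fixes p :: "nat poly"
  assumes "a \<le> b"
  shows "poly p a \<le> poly p b"
  by (induction p) (use assms in \<open>auto intro: mult_mono\<close>)

text \<open>Loop costs are built from earlier bounds by sums, products and composition with
  polynomials. Only a majorant is needed, and the closure properties provide it without computing a
  polynomial.\<close>

definition pbound :: "(nat \<Rightarrow> nat) \<Rightarrow> bool" where
  "pbound f \<longleftrightarrow> (\<exists>p :: nat poly. \<forall>m. f m \<le> poly p m)"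

lemma pbound_const: "pbound (\<lambda>_. c)"
  unfolding pbound_def by (rule exI[of _ "[:c:]"]) simp

lemma pbound_id: "pbound (\<lambda>m. m)"
  unfolding pbound_def by (rule exI[of _ "[:0, 1:]"]) simp

lemma pbound_add: "pbound f \<Longrightarrow> pbound g \<Longrightarrow> pbound (\<lambda>m. f m + g m)"
  unfolding pbound_def by (metis add_mono poly_add)

lemma pbound_mult: "pbound f \<Longrightarrow> pbound g \<Longrightarrow> pbound (\<lambda>m. f m * g m)"
  unfolding pbound_def by (metis mult_le_mono poly_mult)

lemma pbound_poly: "pbound f \<Longrightarrow> pbound (\<lambda>m. poly p (f m))"
  unfolding pbound_def by (metis poly_mono_nat poly_pcompose)

lemmas pbound_intros = pbound_const pbound_id pbound_add pbound_mult pbound_poly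

section \<open>Counter programs\<close>

definition runs :: "cmd \<Rightarrow> tape list \<Rightarrow> nat \<Rightarrow> tape list \<Rightarrow> bool" where
  "runs c ts B ts' \<longleftrightarrow> (\<exists>n \<le> B. run c ts n ts')"

lemma runs_weaken: "runs c ts B ts' \<Longrightarrow> B \<le> B' \<Longrightarrow> ts' = ts'' \<Longrightarrow> runs c ts B' ts''"
  unfolding runs_def using order_trans by blast

lemma runs_Seq: "runs c ts B ts' \<Longrightarrow> runs d ts' B' ts'' \<Longrightarrow> runs (Seq c d) ts (B + B') ts''"
  unfolding runs_def using run_Seq add_mono by blast

lemma runs_While_False:
  "\<tau> < length ts \<Longrightarrow> tape_read (ts ! \<tau>) \<notin> S \<Longrightarrow> runs (While \<tau> S c) ts 1 ts"
  unfolding runs_def using run_While_False by blast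

lemma runs_While_True:
  assumes "\<tau> < length ts" "tape_read (ts ! \<tau>) \<in> S" "runs c ts B ts'" "runs (While \<tau> S c) ts' B' ts''"
  shows "runs (While \<tau> S c) ts (B + B' + 1) ts''"
proof -
  obtain n m where "n \<le> B" "m \<le> B'" "run c ts n ts'" "run (While \<tau> S c) ts' m ts''"
    using assms unfolding runs_def by blast
  then show ?thesis
    unfolding runs_def using run_While_True[OF assms(1,2)]
    by (intro exI[of _ "Suc (n + m)"]) auto
qed

lemma runs_If:
  "\<tau> < length ts \<Longrightarrow> runs (if tape_read (ts ! \<tau>) \<in> S then c else d) ts B ts' \<Longrightarrow>
    runs (If \<tau> S c d) ts (B + 1) ts'"
  unfolding runs_def by (metis Suc_eq_plus1 Suc_le_mono run_If)

definition counter_tape :: "nat \<Rightarrow> tape" where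
  "counter_tape m = ((\<lambda>i. if i = 0 then 1 else 0), int m)"

text \<open>
  Counter \<open>i\<close> is tape \<open>i + 2\<close>: its only nonblank cell is cell \<open>0\<close>, and its value is the position
  of the head.
\<close>

definition ctapes :: "nat \<Rightarrow> bits \<Rightarrow> int \<Rightarrow> bits \<Rightarrow> (nat \<Rightarrow> nat) \<Rightarrow> tape list" where
  "ctapes K x ip out env =
    (bits_tape x, ip) # (bits_tape out, int (length out)) # map (\<lambda>i. counter_tape (env i)) [0..<K]"

lemma length_ctapes [simp]: "length (ctapes K x ip out env) = K + 2"
  by (simp add: ctapes_def)

lemma nth_ctapes [simp]:
  "ctapes K x ip out env ! 0 = (bits_tape x, ip)"
  "ctapes K x ip out env ! Suc 0 = (bits_tape out, int (length out))"
  "i < K \<Longrightarrow> ctapes K x ip out env ! Suc (Suc i) = counter_tape (env i)"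
  by (simp_all add: ctapes_def)

lemma tape_read_counter_tape [simp]: "tape_read (counter_tape m) = (if m = 0 then 1 else 0)"
  by (simp add: counter_tape_def)

lemma ctapes_update:
  assumes "i < K"
  shows "(ctapes K x ip out env)[Suc (Suc i) := counter_tape m] =
    ctapes K x ip out (env(i := m))"
  using assms by (auto simp: ctapes_def intro!: nth_equalityI simp: nth_list_update)

definition Skip :: cmd where "Skip = Act 0 None Stay"
definition Inc :: "nat \<Rightarrow> cmd" where "Inc i = Act (Suc (Suc i)) None MoveRight"
definition Dec :: "nat \<Rightarrow> cmd" where "Dec i = Act (Suc (Suc i)) None MoveLeft"
definition Emit :: "bool \<Rightarrow> cmd" where "Emit b = Act (Suc 0) (Some (if b then 2 else 1)) MoveRight"
definition Read :: "move \<Rightarrow> cmd" where "Read m = Act 0 None m"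

lemma runs_Act:
  assumes "\<tau> < length ts"
    and "ts' = ts[\<tau> := tape_act (case s of None \<Rightarrow> tape_read (ts ! \<tau>) | Some g \<Rightarrow> g, m) (ts ! \<tau>)]"
  shows "runs (Act \<tau> s m) ts 1 ts'"
  unfolding runs_def assms(2) using run_Act[OF assms(1)] by blast

lemma runs_Skip: "runs Skip (ctapes K x ip out env) 1 (ctapes K x ip out env)"
  unfolding Skip_def by (rule runs_Act) (auto simp: ctapes_def)

lemma runs_Read:
  "runs (Read m) (ctapes K x ip out env) 1 (ctapes K x (move_head m ip) out env)"
  unfolding Read_def by (rule runs_Act) (auto simp: ctapes_def)

lemma runs_Inc:
  assumes "i < K"
  shows "runs (Inc i) (ctapes K x ip out env) 1
    (ctapes K x ip out (env(i := Suc (env i))))"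
  unfolding Inc_def
proof (rule runs_Act)
  have "tape_act (tape_read (counter_tape (env i)), MoveRight) (counter_tape (env i)) =
      counter_tape (Suc (env i))"
    by (auto simp: counter_tape_def)
  then show "ctapes K x ip out (env(i := Suc (env i))) =
      (ctapes K x ip out env)[Suc (Suc i) :=
        tape_act (case None of None \<Rightarrow> tape_read (ctapes K x ip out env ! Suc (Suc i))
          | Some g \<Rightarrow> g, MoveRight) (ctapes K x ip out env ! Suc (Suc i))]"
    using assms by (simp add: ctapes_update del: tape_read_counter_tape)
qed (use assms in simp)

lemma runs_Dec:
  assumes "i < K" "env i = Suc k"
  shows "runs (Dec i) (ctapes K x ip out env) 1 (ctapes K x ip out (env(i := k)))"
  unfolding Dec_def
proof (rule runs_Act)
  have "tape_act (tape_read (counter_tape (env i)), MoveLeft) (counter_tape (env i)) = counter_tape k"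
    using assms(2) by (auto simp: counter_tape_def)
  then show "ctapes K x ip out (env(i := k)) =
      (ctapes K x ip out env)[Suc (Suc i) :=
        tape_act (case None of None \<Rightarrow> tape_read (ctapes K x ip out env ! Suc (Suc i))
          | Some g \<Rightarrow> g, MoveLeft) (ctapes K x ip out env ! Suc (Suc i))]"
    using assms(1) by (simp add: ctapes_update del: tape_read_counter_tape)
qed (use assms in simp)

lemma bits_tape_snoc:
  "(bits_tape out)(int (length out) := (if b then 2 else 1)) = bits_tape (out @ [b])"
  by (rule ext) (auto simp: bits_tape_def nth_append)

lemma runs_Emit:
  "runs (Emit b) (ctapes K x ip out env) 1 (ctapes K x ip (out @ [b]) env)"
  unfolding Emit_def
  by (rule runs_Act) (auto simp: ctapes_def bits_tape_snoc[of out b, symmetric])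

section \<open>Output and arithmetic on counters\<close>

fun Emits :: "bits \<Rightarrow> cmd" where
  "Emits [] = Skip"
| "Emits (b # w) = Seq (Emit b) (Emits w)"

lemma runs_Emits:
  "runs (Emits w) (ctapes K x ip out env) (length w + 1) (ctapes K x ip (out @ w) env)"
proof (induction w arbitrary: out)
  case Nil
  then show ?case using runs_Skip by simp
next
  case (Cons b w)
  from runs_Seq[OF runs_Emit Cons[of "out @ [b]"]] show ?case by simp
qed

fun Incs :: "nat list \<Rightarrow> cmd" where
  "Incs [] = Skip"
| "Incs (d # ds) = Seq (Inc d) (Incs ds)"

lemma runs_Incs:
  assumes "set ds \<subseteq> {..<K}"
  shows "runs (Incs ds) (ctapes K x ip out env) (length ds + 1)
    (ctapes K x ip out (\<lambda>i. env i + count_list ds i))"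
  using assms
proof (induction ds arbitrary: env)
  case Nil
  then show ?case using runs_Skip by simp
next
  case (Cons d ds)
  have "runs (Inc d) (ctapes K x ip out env) 1 (ctapes K x ip out (env(d := Suc (env d))))"
    using Cons.prems by (intro runs_Inc) simp
  from runs_Seq[OF this Cons.IH]
  have "runs (Incs (d # ds)) (ctapes K x ip out env) (length (d # ds) + 1)
     (ctapes K x ip out (\<lambda>i. (env(d := Suc (env d))) i + count_list ds i))"
    using Cons.prems by simp
  moreover have "(\<lambda>i. (env(d := Suc (env d))) i + count_list ds i) = (\<lambda>i. env i + count_list (d # ds) i)"
    by auto
  ultimately show ?case by simp
qed

text \<open>The marker in cell \<open>0\<close> makes the blank mean "counter not zero", hence the
  test set \<open>{0}\<close>. Environment and output are indexed by the value still to be counted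
  down, so the body leads from \<open>Suc k\<close> to \<open>k\<close>.\<close>

lemma runs_While_counter:
  assumes "i < K" "\<And>k. k \<le> m \<Longrightarrow> E k i = k"
    and "\<And>k. k < m \<Longrightarrow>
      runs c (ctapes K x ip (Ou (Suc k)) (E (Suc k))) B (ctapes K x ip (Ou k) (E k))"
  shows "runs (While (Suc (Suc i)) {0} c) (ctapes K x ip (Ou m) (E m)) (m * (B + 1) + 1)
    (ctapes K x ip (Ou 0) (E 0))"
  using assms(2,3)
proof (induction m)
  case 0
  then show ?case using runs_While_False[of "Suc (Suc i)"] assms(1) by simp
next
  case (Suc m)
  have "runs (While (Suc (Suc i)) {0} c) (ctapes K x ip (Ou m) (E m)) (m * (B + 1) + 1)
      (ctapes K x ip (Ou 0) (E 0))"
    using Suc by simp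
  from runs_While_True[OF _ _ Suc.prems(2)[of m] this]
  have "runs (While (Suc (Suc i)) {0} c) (ctapes K x ip (Ou (Suc m)) (E (Suc m)))
      (B + (m * (B + 1) + 1) + 1) (ctapes K x ip (Ou 0) (E 0))"
    using assms(1) Suc.prems(1)[of "Suc m"] by simp
  then show ?case by (rule runs_weaken) auto
qed

text \<open>Reading a counter destroys it. This one loop serves for transfer to other counters, for
  output of \<open>w\<close> once per unit, and, with empty lists, for resetting.\<close>

definition Drain :: "nat \<Rightarrow> nat list \<Rightarrow> bits \<Rightarrow> cmd" where
  "Drain s ds w = While (Suc (Suc s)) {0} (Seq (Dec s) (Seq (Incs ds) (Emits w)))"

lemma runs_Drain:
  assumes "s < K" "set ds \<subseteq> {..<K}" "s \<notin> set ds"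
  shows "runs (Drain s ds w) (ctapes K x ip out env)
    (env s * (length ds + length w + 4) + 1)
    (ctapes K x ip (out @ concat (replicate (env s) w))
      (\<lambda>i. if i = s then 0 else env i + env s * count_list ds i))"
proof -
  let ?E = "\<lambda>k i. if i = s then k else env i + (env s - k) * count_list ds i"
  let ?Ou = "\<lambda>k. out @ concat (replicate (env s - k) w)"
  have step: "runs (Seq (Dec s) (Seq (Incs ds) (Emits w)))
      (ctapes K x ip (?Ou (Suc k)) (?E (Suc k))) (length ds + length w + 3)
      (ctapes K x ip (?Ou k) (?E k))" if "k < env s" for k
  proof -
    have diff: "env s - k = Suc (env s - Suc k)" using that by simp
    have E: "(\<lambda>i. ((?E (Suc k))(s := k)) i + count_list ds i) = ?E k"
      using assms(3) by (auto simp: fun_eq_iff count_notin diff)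
    have "replicate (env s - k) w = replicate (env s - Suc k) w @ [w]"
      unfolding diff by (metis replicate_Suc replicate_append_same)
    then have Ou: "?Ou k = ?Ou (Suc k) @ w" by simp
    have "runs (Dec s) (ctapes K x ip (?Ou (Suc k)) (?E (Suc k))) 1
        (ctapes K x ip (?Ou (Suc k)) ((?E (Suc k))(s := k)))"
      using assms(1) by (intro runs_Dec) auto
    moreover have "runs (Incs ds) (ctapes K x ip (?Ou (Suc k)) ((?E (Suc k))(s := k)))
        (length ds + 1) (ctapes K x ip (?Ou (Suc k)) (?E k))"
      using runs_Incs[OF assms(2), of x ip "?Ou (Suc k)" "(?E (Suc k))(s := k)"] unfolding E .
    moreover have "runs (Emits w) (ctapes K x ip (?Ou (Suc k)) (?E k)) (length w + 1)
        (ctapes K x ip (?Ou k) (?E k))"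
      using runs_Emits[of w K x ip "?Ou (Suc k)" "?E k"] unfolding Ou .
    ultimately have "runs (Seq (Dec s) (Seq (Incs ds) (Emits w)))
      (ctapes K x ip (?Ou (Suc k)) (?E (Suc k))) (1 + ((length ds + 1) + (length w + 1)))
      (ctapes K x ip (?Ou k) (?E k))"
      by (intro runs_Seq)
    then show ?thesis by (rule runs_weaken) auto
  qed
  have E: "?E (env s) = env" by (auto simp: fun_eq_iff)
  have "runs (Drain s ds w) (ctapes K x ip (?Ou (env s)) (?E (env s)))
      (env s * (length ds + length w + 3 + 1) + 1) (ctapes K x ip (?Ou 0) (?E 0))"
    unfolding Drain_def
    by (rule runs_While_counter[where Ou = ?Ou and E = ?E, OF assms(1) _ step]) auto
  then show ?thesis unfolding E by (simp add: add.commute cong: if_cong)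
qed

lemma runs_Clear:
  assumes "s < K" "env s = 0"
  shows "runs (Drain s [] []) (ctapes K x ip out (env(s := k))) (k * 4 + 1)
    (ctapes K x ip out env)"
proof -
  have "(\<lambda>i. if i = s then 0 else (env(s := k)) i + (env(s := k)) s * count_list [] i) = env"
    using assms(2) by (auto simp: fun_eq_iff)
  with runs_Drain[of s K "[]" "[]" x ip out "env(s := k)"] assms(1) show ?thesis by simp
qed

text \<open>Scratch counter \<open>0\<close> is filled along with \<open>c\<close> and then drained
  back, which restores \<open>u\<close>.\<close>

definition Copy :: "nat \<Rightarrow> nat \<Rightarrow> cmd" where
  "Copy u c = Seq (Drain u [0, c] []) (Drain 0 [u] [])"

lemma runs_Copy:
  assumes "u < K" "c < K" "u \<noteq> 0" "c \<noteq> 0" "u \<noteq> c" "env 0 = 0"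
  shows "runs (Copy u c) (ctapes K x ip out env) (env u * 11 + 2)
    (ctapes K x ip out (env(c := env c + env u)))"
proof -
  let ?env1 = "\<lambda>i. if i = u then 0 else env i + env u * count_list [0, c] i"
  have "runs (Drain u [0, c] []) (ctapes K x ip out env) (env u * (2 + 0 + 4) + 1)
      (ctapes K x ip out ?env1)"
    using runs_Drain[of u K "[0, c]" "[]" x ip out env] assms by simp
  moreover have "runs (Drain 0 [u] []) (ctapes K x ip out ?env1) (?env1 0 * (1 + 0 + 4) + 1)
      (ctapes K x ip out (\<lambda>i. if i = 0 then 0 else ?env1 i + ?env1 0 * count_list [u] i))"
    using runs_Drain[of 0 K "[u]" "[]" x ip out ?env1] assms by simp
  ultimately have "runs (Copy u c) (ctapes K x ip out env)
      ((env u * (2 + 0 + 4) + 1) + (?env1 0 * (1 + 0 + 4) + 1))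
      (ctapes K x ip out (\<lambda>i. if i = 0 then 0 else ?env1 i + ?env1 0 * count_list [u] i))"
    unfolding Copy_def by (rule runs_Seq)
  then show ?thesis
    by (rule runs_weaken) (use assms in \<open>auto intro!: arg_cong[where f = "ctapes K x ip out"]\<close>)
qed

text \<open>The sum is collected in counter \<open>1\<close>, because counter \<open>0\<close> is
  used by \<open>Copy\<close>; it is moved to \<open>v\<close> once \<open>v\<close> has been
  counted down to zero.\<close>

definition Mult :: "nat \<Rightarrow> nat \<Rightarrow> cmd" where
  "Mult v u = Seq (While (Suc (Suc v)) {0} (Seq (Dec v) (Copy u 1))) (Drain 1 [v] [])"

lemma runs_Mult:
  assumes "u < K" "v < K" "u > 1" "v > 1" "u \<noteq> v" "env 0 = 0" "env 1 = 0"
  shows "runs (Mult v u) (ctapes K x ip out env)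
    ((env v * (env u * 11 + 4) + 1) + (env v * env u * 5 + 1))
    (ctapes K x ip out (env(v := env v * env u)))"
proof -
  let ?E = "\<lambda>k. env(v := k, 1 := (env v - k) * env u)"
  have step: "runs (Seq (Dec v) (Copy u 1)) (ctapes K x ip out (?E (Suc k))) (env u * 11 + 3)
      (ctapes K x ip out (?E k))" if "k < env v" for k
  proof -
    let ?e = "(?E (Suc k))(v := k)"
    have diff: "env v - k = Suc (env v - Suc k)" using that by simp
    have "runs (Dec v) (ctapes K x ip out (?E (Suc k))) 1 (ctapes K x ip out ?e)"
      using assms by (intro runs_Dec) auto
    moreover have "runs (Copy u 1) (ctapes K x ip out ?e) (?e u * 11 + 2)
        (ctapes K x ip out (?e(1 := ?e 1 + ?e u)))"
      using assms by (intro runs_Copy) auto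
    ultimately have "runs (Seq (Dec v) (Copy u 1)) (ctapes K x ip out (?E (Suc k)))
        (1 + (?e u * 11 + 2)) (ctapes K x ip out (?e(1 := ?e 1 + ?e u)))"
      by (rule runs_Seq)
    then show ?thesis
      by (rule runs_weaken)
        (use assms diff in \<open>auto intro!: arg_cong[where f = "ctapes K x ip out"]\<close>)
  qed
  have E: "?E (env v) = env" using assms by (auto simp: fun_eq_iff)
  have "runs (While (Suc (Suc v)) {0} (Seq (Dec v) (Copy u 1))) (ctapes K x ip out (?E (env v)))
      (env v * (env u * 11 + 3 + 1) + 1) (ctapes K x ip out (?E 0))"
    by (rule runs_While_counter[where Ou = "\<lambda>_. out" and E = ?E, OF assms(2) _ step])
      (use assms in auto)
  moreover have "runs (Drain 1 [v] []) (ctapes K x ip out (?E 0)) (?E 0 1 * (1 + 0 + 4) + 1)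
      (ctapes K x ip out (\<lambda>i. if i = 1 then 0 else ?E 0 i + ?E 0 1 * count_list [v] i))"
    using runs_Drain[of 1 K "[v]" "[]" x ip out "?E 0"] assms by simp
  ultimately have "runs (Mult v u) (ctapes K x ip out env)
      ((env v * (env u * 11 + 3 + 1) + 1) + (?E 0 1 * (1 + 0 + 4) + 1))
      (ctapes K x ip out (\<lambda>i. if i = 1 then 0 else ?E 0 i + ?E 0 1 * count_list [v] i))"
    unfolding Mult_def E by (rule runs_Seq)
  then show ?thesis
    by (rule runs_weaken) (use assms in \<open>auto intro!: arg_cong[where f = "ctapes K x ip out"]\<close>)
qed

fun horner :: "nat list \<Rightarrow> nat \<Rightarrow> nat" where
  "horner [] z = 0"
| "horner (a # as) z = a + z * horner as z"

lemma horner_coeffs: "horner (coeffs p) z = poly p z"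
proof (induction p)
  case (pCons a p)
  then show ?case by (cases "a = 0 \<and> p = 0") (auto simp: cCons_def)
qed simp

lemma horner_mono: "a \<le> b \<Longrightarrow> horner as a \<le> horner as b"
  by (induction as) (auto intro: mult_mono)

lemma pbound_horner: "pbound f \<Longrightarrow> pbound (\<lambda>m. horner as (f m))"
  by (induction as) (auto intro: pbound_intros)

fun Horner :: "nat list \<Rightarrow> nat \<Rightarrow> nat \<Rightarrow> cmd" where
  "Horner [] v u = Skip"
| "Horner (a # as) v u = Seq (Horner as v u) (Seq (Mult v u) (Incs (replicate a v)))"

lemma count_list_replicate: "count_list (replicate n a) b = (if a = b then n else 0)"
  by (induction n) auto

text \<open>The time bound is uniform in the tapes and refers to an upper bound \<open>m\<close> of
  the argument, so that it can be used inside loops, where variables are only known to be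
  bounded.\<close>

lemma runs_Horner:
  assumes "u < K" "v < K" "u > 1" "v > 1" "u \<noteq> v"
  shows "\<exists>T :: nat poly. \<forall>x ip out env m. env 0 = 0 \<longrightarrow> env 1 = 0 \<longrightarrow> env v = 0 \<longrightarrow> env u \<le> m \<longrightarrow>
    runs (Horner as v u) (ctapes K x ip out env) (poly T m)
      (ctapes K x ip out (env(v := horner as (env u))))"
proof (induction as)
  case Nil
  have "runs Skip (ctapes K x ip out env) (poly [:1:] m)
      (ctapes K x ip out (env(v := 0)))" if "env v = 0" for x ip out env and m :: nat
  proof -
    have "env(v := 0) = env" using that by auto
    then show ?thesis using runs_Skip by simp
  qed
  then show ?case unfolding Horner.simps horner.simps by blast
next
  case (Cons a as)
  then obtain T :: "nat poly" where T: "\<And>x ip out env m. env 0 = 0 \<Longrightarrow> env 1 = 0 \<Longrightarrow> env v = 0 \<Longrightarrow>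
      env u \<le> m \<Longrightarrow> runs (Horner as v u) (ctapes K x ip out env) (poly T m)
        (ctapes K x ip out (env(v := horner as (env u))))"
    by blast
  let ?B = "\<lambda>m. poly T m + ((horner as m * (m * 11 + 4) + 1) + (horner as m * m * 5 + 1) + (a + 1))"
  have "pbound ?B" by (intro pbound_intros pbound_horner)
  then obtain T' :: "nat poly" where T': "\<And>m. ?B m \<le> poly T' m" unfolding pbound_def by blast
  have "runs (Horner (a # as) v u) (ctapes K x ip out env) (poly T' m)
      (ctapes K x ip out (env(v := horner (a # as) (env u))))"
    if env: "env 0 = 0" "env 1 = 0" "env v = 0" "env u \<le> m" for x ip out env m
  proof -
    let ?e1 = "env(v := horner as (env u))"
    let ?e2 = "?e1(v := ?e1 v * ?e1 u)"
    have 1: "runs (Horner as v u) (ctapes K x ip out env) (poly T m) (ctapes K x ip out ?e1)"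
      using T env by simp
    have 2: "runs (Mult v u) (ctapes K x ip out ?e1)
        ((?e1 v * (?e1 u * 11 + 4) + 1) + (?e1 v * ?e1 u * 5 + 1)) (ctapes K x ip out ?e2)"
      using assms env by (intro runs_Mult) auto
    have 3: "runs (Incs (replicate a v)) (ctapes K x ip out ?e2) (a + 1)
        (ctapes K x ip out (\<lambda>i. ?e2 i + count_list (replicate a v) i))"
      using runs_Incs[of "replicate a v" K x ip out ?e2] assms by (auto simp: set_replicate_conv_if)
    have h: "horner as (env u) \<le> horner as m" using env by (intro horner_mono)
    have "?e1 v * (?e1 u * 11 + 4) \<le> horner as m * (m * 11 + 4)"
      using h env assms by (intro mult_le_mono) auto
    moreover have "?e1 v * ?e1 u * 5 \<le> horner as m * m * 5"
      using h env assms by (intro mult_le_mono) auto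
    ultimately have le: "poly T m + (((?e1 v * (?e1 u * 11 + 4) + 1) + (?e1 v * ?e1 u * 5 + 1)) + (a + 1))
        \<le> poly T' m"
      using T'[of m] by linarith
    show ?thesis unfolding Horner.simps
      by (rule runs_weaken[OF runs_Seq[OF 1 runs_Seq[OF 2 3]] le],
          rule arg_cong[where f = "ctapes K x ip out"])
        (use assms in \<open>auto simp: fun_eq_iff count_list_replicate\<close>)
  qed
  then show ?case by blast
qed

section \<open>Output by nested loops\<close>

datatype tok = TB bits | TU nat

text \<open>Atom names contain indices in unary, and \<open>enc_bits\<close> puts
  \<open>True\<close> before each bit. One pair \<open>[True, True]\<close> per unit therefore
  prints an index directly from a counter.\<close>

fun tok_out :: "nat list \<Rightarrow> tok \<Rightarrow> bits" where
  "tok_out e (TB w) = w"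
| "tok_out e (TU v) = concat (replicate (e ! v) [True, True])"

text \<open>
  Variables are de Bruijn levels: a binder below \<open>d\<close> others binds variable \<open>d\<close>. The binder
  \<open>BFor u\<close> lets it range below the value of variable \<open>u\<close>.
\<close>

datatype loop_binder = BFor nat | BLet "nat poly" nat

fun envs :: "loop_binder list \<Rightarrow> nat list \<Rightarrow> nat list list" where
  "envs [] e = [e]"
| "envs (BFor u # bs) e = concat (map (\<lambda>i. envs bs (e @ [i])) [0..<e ! u])"
| "envs (BLet p u # bs) e = envs bs (e @ [poly p (e ! u)])"

fun toks_ok :: "nat \<Rightarrow> loop_binder list \<Rightarrow> tok list \<Rightarrow> bool" where
  "toks_ok d [] ts \<longleftrightarrow> (\<forall>v. TU v \<in> set ts \<longrightarrow> v < d)"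
| "toks_ok d (BFor u # bs) ts \<longleftrightarrow> u < d \<and> toks_ok (Suc d) bs ts"
| "toks_ok d (BLet p u # bs) ts \<longleftrightarrow> u < d \<and> toks_ok (Suc d) bs ts"

definition toks_out :: "tok list \<Rightarrow> nat list \<Rightarrow> bits" where
  "toks_out ts e = concat (map (tok_out e) ts)"

definition loop_out :: "loop_binder list \<Rightarrow> tok list \<Rightarrow> nat list \<Rightarrow> bits" where
  "loop_out bs ts e = concat (map (toks_out ts) (envs bs e))"

fun Toks :: "tok list \<Rightarrow> cmd" where
  "Toks [] = Skip"
| "Toks (TB w # ts) = Seq (Emits w) (Toks ts)"
| "Toks (TU v # ts) =
    Seq (Seq (Drain (2 * v + 2) [0] [True, True]) (Drain 0 [2 * v + 2] [])) (Toks ts)"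

text \<open>
  Counters \<open>0\<close> and \<open>1\<close> are scratch, variable \<open>v\<close> is counter \<open>2 * v + 2\<close>, and counter
  \<open>2 * v + 3\<close> holds the number of remaining iterations of the loop over \<open>v\<close>.
\<close>

fun Loop :: "nat \<Rightarrow> loop_binder list \<Rightarrow> tok list \<Rightarrow> cmd" where
  "Loop d [] ts = Toks ts"
| "Loop d (BFor u # bs) ts =
    Seq (Copy (2 * u + 2) (2 * d + 3))
     (Seq (While (Suc (Suc (2 * d + 3))) {0}
            (Seq (Loop (Suc d) bs ts) (Seq (Dec (2 * d + 3)) (Inc (2 * d + 2)))))
       (Drain (2 * d + 2) [] []))"
| "Loop d (BLet p u # bs) ts =
    Seq (Horner (coeffs p) (2 * d + 2) (2 * u + 2))
     (Seq (Loop (Suc d) bs ts) (Drain (2 * d + 2) [] []))"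

text \<open>The counters \<open>2 * v + 3\<close> of the enclosing loops are left unconstrained: an
  inner loop works whatever they hold. All counters of variables not yet bound are zero, as the
  binders expect.\<close>

definition represents :: "nat list \<Rightarrow> (nat \<Rightarrow> nat) \<Rightarrow> bool" where
  "represents e env \<longleftrightarrow> (\<forall>v < length e. env (2 * v + 2) = e ! v) \<and> env 0 = 0 \<and> env 1 = 0 \<and>
    (\<forall>j \<ge> 2 * length e + 2. env j = 0)"

lemma represents_snoc:
  assumes "represents e env"
  shows "represents (e @ [i]) (env(2 * length e + 3 := k, 2 * length e + 2 := i))"
    "represents (e @ [i]) (env(2 * length e + 2 := i))"
  using assms by (auto simp: represents_def nth_append less_Suc_eq)

lemma runs_Toks:
  assumes "\<forall>v. TU v \<in> set ts \<longrightarrow> v < d" "K \<ge> 2 * d + 2"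
  shows "\<exists>T :: nat poly. \<forall>x ip out e env m. length e = d \<longrightarrow> represents e env \<longrightarrow> (\<forall>a \<in> set e. a \<le> m) \<longrightarrow>
    runs (Toks ts) (ctapes K x ip out env) (poly T m)
      (ctapes K x ip (out @ toks_out ts e) env)"
  using assms(1)
proof (induction ts)
  case Nil
  then show ?case using runs_Skip by (intro exI[of _ "[:1:]"]) (simp add: toks_out_def)
next
  case (Cons t ts)
  then have "\<forall>v. TU v \<in> set ts \<longrightarrow> v < d" by simp
  from Cons.IH[OF this] obtain T :: "nat poly" where T: "\<And>x ip out e env m. length e = d \<Longrightarrow>
      represents e env \<Longrightarrow> \<forall>a \<in> set e. a \<le> m \<Longrightarrow> runs (Toks ts) (ctapes K x ip out env) (poly T m)
      (ctapes K x ip (out @ toks_out ts e) env)"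
    by blast
  show ?case
  proof (cases t)
    case (TB w)
    have "runs (Toks (t # ts)) (ctapes K x ip out env) (poly (T + [:length w + 1:]) m)
        (ctapes K x ip (out @ toks_out (t # ts) e) env)"
      if "length e = d" "represents e env" "\<forall>a \<in> set e. a \<le> m" for x ip out e env m
      using runs_Seq[OF runs_Emits[of w K x ip out env] T[OF that, of x ip "out @ w"]]
      by (simp add: TB toks_out_def add.commute)
    then show ?thesis by blast
  next
    case (TU v)
    have v: "v < d" using Cons.prems TU by simp
    let ?B = "\<lambda>m. ((m * 7 + 1) + (m * 5 + 1)) + poly T m"
    have "pbound ?B" by (intro pbound_intros)
    then obtain T' :: "nat poly" where T': "\<And>m. ?B m \<le> poly T' m" unfolding pbound_def by blast
    have "runs (Toks (t # ts)) (ctapes K x ip out env) (poly T' m)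
        (ctapes K x ip (out @ toks_out (t # ts) e) env)"
      if e: "length e = d" "represents e env" "\<forall>a \<in> set e. a \<le> m" for x ip out e env m
    proof -
      let ?s = "2 * v + 2"
      have s: "env ?s = e ! v" "env 0 = 0" using e(1,2) v by (auto simp: represents_def)
      have sm: "e ! v \<le> m" using e v by simp
      let ?e1 = "\<lambda>i. if i = ?s then 0 else env i + env ?s * count_list [0] i"
      let ?o1 = "out @ concat (replicate (env ?s) [True, True])"
      have 1: "runs (Drain ?s [0] [True, True]) (ctapes K x ip out env) (env ?s * (1 + 2 + 4) + 1)
          (ctapes K x ip ?o1 ?e1)"
        using runs_Drain[of ?s K "[0]" "[True, True]" x ip out env] v assms(2) by simp
      have 2: "runs (Drain 0 [?s] []) (ctapes K x ip ?o1 ?e1) (?e1 0 * (1 + 0 + 4) + 1)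
          (ctapes K x ip ?o1 (\<lambda>i. if i = 0 then 0 else ?e1 i + ?e1 0 * count_list [?s] i))"
        using runs_Drain[of 0 K "[?s]" "[]" x ip ?o1 ?e1] v assms(2) by simp
      have env: "(\<lambda>i. if i = 0 then 0 else ?e1 i + ?e1 0 * count_list [?s] i) = env"
        using s by (auto simp: fun_eq_iff)
      have le: "((env ?s * (1 + 2 + 4) + 1) + (?e1 0 * (1 + 0 + 4) + 1)) + poly T m \<le> poly T' m"
        using T'[of m] s sm by simp
      show ?thesis unfolding TU Toks.simps
        by (rule runs_weaken[OF runs_Seq[OF runs_Seq[OF 1 2[unfolded env]] T[OF e]] le])
          (simp add: toks_out_def s[simplified])
    qed
    then show ?thesis by blast
  qed
qed

lemma concat_concat_map: "concat (concat (map f xs)) = concat (map (\<lambda>x. concat (f x)) xs)"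
  by (induction xs) auto

lemma runs_Loop:
  assumes "toks_ok d bs ts" "K \<ge> 2 * (d + length bs) + 2"
  shows "\<exists>T :: nat poly. \<forall>x ip out e env m. length e = d \<longrightarrow> represents e env \<longrightarrow> (\<forall>a \<in> set e. a \<le> m) \<longrightarrow>
    runs (Loop d bs ts) (ctapes K x ip out env) (poly T m)
      (ctapes K x ip (out @ loop_out bs ts e) env)"
  using assms
proof (induction bs arbitrary: d)
  case Nil
  then show ?case using runs_Toks[of ts d K] by (simp add: loop_out_def)
next
  case (Cons b bs)
  have "\<exists>T :: nat poly. \<forall>x ip out e env m. length e = Suc d \<longrightarrow> represents e env \<longrightarrow> (\<forall>a \<in> set e. a \<le> m) \<longrightarrow>
    runs (Loop (Suc d) bs ts) (ctapes K x ip out env) (poly T m)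
      (ctapes K x ip (out @ loop_out bs ts e) env)"
    using Cons.prems by (intro Cons.IH) (cases b; simp)+
  then obtain T :: "nat poly" where T: "\<And>x ip out e env m. length e = Suc d \<Longrightarrow> represents e env \<Longrightarrow>
      \<forall>a \<in> set e. a \<le> m \<Longrightarrow> runs (Loop (Suc d) bs ts) (ctapes K x ip out env) (poly T m)
      (ctapes K x ip (out @ loop_out bs ts e) env)"
    by blast
  have K: "2 * d + 3 < K" using Cons.prems(2) by simp
  show ?case
  proof (cases b)
    case (BFor u)
    have u: "u < d" using Cons.prems BFor by simp
    let ?B = "\<lambda>m. (m * 11 + 2) + ((m * (poly T m + 2 + 1) + 1) + (m * 4 + 1))"
    have "pbound ?B" by (intro pbound_intros)
    then obtain T' :: "nat poly" where T': "\<And>m. ?B m \<le> poly T' m" unfolding pbound_def by blast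
    have "runs (Loop d (b # bs) ts) (ctapes K x ip out env) (poly T' m)
        (ctapes K x ip (out @ loop_out (b # bs) ts e) env)"
      if e: "length e = d" "represents e env" "\<forall>a \<in> set e. a \<le> m" for x ip out e env m
    proof -
      let ?N = "e ! u"
      have N: "env (2 * u + 2) = ?N" "?N \<le> m" using e u by (auto simp: represents_def)
      have z: "env 0 = 0" "env (2 * d + 3) = 0" "env (2 * d + 2) = 0"
        using e by (auto simp: represents_def)
      \<comment> \<open>With \<open>k\<close> iterations remaining, the loop variable is
        \<open>?N - k\<close>, and exactly the instances for smaller values have been
        printed.\<close>
      let ?E = "\<lambda>k. env(2 * d + 3 := k, 2 * d + 2 := ?N - k)"
      let ?Ou = "\<lambda>k. out @ concat (map (\<lambda>i. loop_out bs ts (e @ [i])) [0..<?N - k])"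
      have 1: "runs (Copy (2 * u + 2) (2 * d + 3)) (ctapes K x ip out env)
          (?N * 11 + 2) (ctapes K x ip (?Ou ?N) (?E ?N))"
      proof (rule runs_weaken[OF runs_Copy])
        show "ctapes K x ip out (env(2 * d + 3 := env (2 * d + 3) + env (2 * u + 2))) =
            ctapes K x ip (?Ou ?N) (?E ?N)"
          using N z by (auto intro!: arg_cong[where f = "ctapes K x ip out"])
      qed (use N z u K in auto)
      have step: "runs (Seq (Loop (Suc d) bs ts) (Seq (Dec (2 * d + 3)) (Inc (2 * d + 2))))
          (ctapes K x ip (?Ou (Suc k)) (?E (Suc k))) (poly T m + 2)
          (ctapes K x ip (?Ou k) (?E k))" if k: "k < ?N" for k
      proof -
        let ?i = "?N - Suc k"
        have diff: "?N - k = Suc ?i" using k by simp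
        have "[0..<?N - k] = [0..<?i] @ [?i]" unfolding diff by simp
        then have Ou: "?Ou k = ?Ou (Suc k) @ loop_out bs ts (e @ [?i])" by simp
        have s1: "runs (Loop (Suc d) bs ts) (ctapes K x ip (?Ou (Suc k)) (?E (Suc k))) (poly T m)
            (ctapes K x ip (?Ou k) (?E (Suc k)))"
          unfolding Ou
        proof (rule T)
          show "represents (e @ [?i]) (?E (Suc k))"
            using represents_snoc(1)[OF e(2)] e(1) by simp
        qed (use e N in auto)
        have s2: "runs (Dec (2 * d + 3)) (ctapes K x ip (?Ou k) (?E (Suc k))) 1
            (ctapes K x ip (?Ou k) ((?E (Suc k))(2 * d + 3 := k)))"
          using K by (intro runs_Dec) auto
        have s3: "runs (Inc (2 * d + 2)) (ctapes K x ip (?Ou k) ((?E (Suc k))(2 * d + 3 := k))) 1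
            (ctapes K x ip (?Ou k) (?E k))"
          by (rule runs_weaken[OF runs_Inc])
            (use K diff in \<open>auto intro!: arg_cong[where f = "ctapes K x ip (?Ou k)"]\<close>)
        show ?thesis
          by (rule runs_weaken[OF runs_Seq[OF s1 runs_Seq[OF s2 s3]]]) auto
      qed
      have 2: "runs (While (Suc (Suc (2 * d + 3))) {0}
            (Seq (Loop (Suc d) bs ts) (Seq (Dec (2 * d + 3)) (Inc (2 * d + 2)))))
          (ctapes K x ip (?Ou ?N) (?E ?N)) (?N * (poly T m + 2 + 1) + 1)
          (ctapes K x ip (?Ou 0) (?E 0))"
        by (rule runs_While_counter[where Ou = ?Ou and E = ?E, OF K _ step]) auto
      have 3: "runs (Drain (2 * d + 2) [] []) (ctapes K x ip (?Ou 0) (?E 0)) (?N * 4 + 1)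
          (ctapes K x ip (?Ou 0) env)"
      proof -
        have "env(2 * d + 3 := 0) = env" using z by auto
        then show ?thesis using runs_Clear[of "2 * d + 2" K env x ip "?Ou 0" ?N] K z by simp
      qed
      have "?N * (poly T m + 2 + 1) \<le> m * (poly T m + 2 + 1)" using N(2) by (intro mult_le_mono1)
      then have le: "(?N * 11 + 2) + ((?N * (poly T m + 2 + 1) + 1) + (?N * 4 + 1)) \<le> poly T' m"
        using T'[of m] N(2) by linarith
      show ?thesis unfolding BFor Loop.simps
        by (rule runs_weaken[OF runs_Seq[OF 1 runs_Seq[OF 2 3]] le])
          (simp add: loop_out_def map_concat comp_def concat_concat_map)
    qed
    then show ?thesis by blast
  next
    case (BLet p u)
    have u: "u < d" using Cons.prems BLet by simp
    have "2 * u + 2 < K" "2 * d + 2 < K" "2 * u + 2 > 1" "2 * d + 2 > 1" "2 * u + 2 \<noteq> 2 * d + 2"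
      using K u by auto
    from runs_Horner[OF this, of "coeffs p"]
    obtain H :: "nat poly" where H: "\<And>x ip out env m. env 0 = 0 \<Longrightarrow> env 1 = 0 \<Longrightarrow> env (2 * d + 2) = 0 \<Longrightarrow>
        env (2 * u + 2) \<le> m \<Longrightarrow>
        runs (Horner (coeffs p) (2 * d + 2) (2 * u + 2)) (ctapes K x ip out env) (poly H m)
        (ctapes K x ip out (env(2 * d + 2 := horner (coeffs p) (env (2 * u + 2)))))"
      by blast
    \<comment> \<open>The value bound by \<open>BLet\<close> may exceed \<open>m\<close>, so the
      time of the inner loops is taken at \<open>m + poly p m\<close>.\<close>
    let ?B = "\<lambda>m. poly H m + (poly T (m + poly p m) + (poly p m * 4 + 1))"
    have "pbound ?B" by (intro pbound_intros)
    then obtain T' :: "nat poly" where T': "\<And>m. ?B m \<le> poly T' m" unfolding pbound_def by blast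
    have "runs (Loop d (b # bs) ts) (ctapes K x ip out env) (poly T' m)
        (ctapes K x ip (out @ loop_out (b # bs) ts e) env)"
      if e: "length e = d" "represents e env" "\<forall>a \<in> set e. a \<le> m" for x ip out e env m
    proof -
      let ?N = "poly p (e ! u)"
      have N: "env (2 * u + 2) = e ! u" "e ! u \<le> m" using e u by (auto simp: represents_def)
      have Nm: "?N \<le> poly p m" using N(2) by (rule poly_mono_nat)
      have z: "env 0 = 0" "env 1 = 0" "env (2 * d + 2) = 0" using e by (auto simp: represents_def)
      let ?E = "env(2 * d + 2 := ?N)"
      let ?o = "out @ loop_out bs ts (e @ [?N])"
      have 1: "runs (Horner (coeffs p) (2 * d + 2) (2 * u + 2)) (ctapes K x ip out env) (poly H m)
          (ctapes K x ip out ?E)"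
        using H[OF z, of m x ip out] N by (simp add: horner_coeffs)
      have 2: "runs (Loop (Suc d) bs ts) (ctapes K x ip out ?E) (poly T (m + poly p m))
          (ctapes K x ip ?o ?E)"
      proof (rule T)
        show "represents (e @ [?N]) ?E" using represents_snoc(2)[OF e(2)] e(1) by simp
      qed (use e Nm in \<open>auto intro: trans_le_add1\<close>)
      have 3: "runs (Drain (2 * d + 2) [] []) (ctapes K x ip ?o ?E) (?N * 4 + 1)
          (ctapes K x ip ?o env)"
        using K z by (intro runs_Clear) auto
      have le: "poly H m + (poly T (m + poly p m) + (?N * 4 + 1)) \<le> poly T' m"
        using T'[of m] Nm by linarith
      show ?thesis unfolding BLet Loop.simps
        by (rule runs_weaken[OF runs_Seq[OF 1 runs_Seq[OF 2 3]] le]) (simp add: loop_out_def)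
    qed
    then show ?thesis by blast
  qed
qed

section \<open>Passes over the input tape\<close>

lemma runs_While_input:
  assumes "\<And>i. i < length x \<Longrightarrow>
      runs c (ctapes K x (int i) (Ou i) (E i)) B
        (ctapes K x (int (Suc i)) (Ou (Suc i)) (E (Suc i)))"
  shows "runs (While 0 {1, 2} c) (ctapes K x 0 (Ou 0) (E 0)) (length x * (B + 1) + 1)
    (ctapes K x (int (length x)) (Ou (length x)) (E (length x)))"
proof -
  have "runs (While 0 {1, 2} c) (ctapes K x (int i) (Ou i) (E i)) (k * (B + 1) + 1)
    (ctapes K x (int (length x)) (Ou (length x)) (E (length x)))" if "i + k = length x" for i k
    using that
  proof (induction k arbitrary: i)
    case 0
    then show ?case
      using runs_While_False[of 0 "ctapes K x (int i) (Ou i) (E i)" "{1, 2}" c]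
      by (simp add: bits_tape_def)
  next
    case (Suc k)
    have "runs (While 0 {1, 2} c) (ctapes K x (int i) (Ou i) (E i)) (B + (k * (B + 1) + 1) + 1)
      (ctapes K x (int (length x)) (Ou (length x)) (E (length x)))"
    proof (rule runs_While_True)
      show "runs (While 0 {1, 2} c) (ctapes K x (int (Suc i)) (Ou (Suc i)) (E (Suc i)))
        (k * (B + 1) + 1) (ctapes K x (int (length x)) (Ou (length x)) (E (length x)))"
        by (intro Suc.IH) (use Suc.prems in simp)
    qed (use Suc.prems assms[of i] in \<open>auto simp: bits_tape_def\<close>)
    then show ?case by (rule runs_weaken) auto
  qed
  from this[of 0 "length x"] show ?thesis by simp
qed

text \<open>After a pass the head is on the blank behind the input, so one step to the left precedes
  the loop, which stops on the blank at \<open>- 1\<close>. This also works for the empty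
  input.\<close>

definition Rewind :: cmd where
  "Rewind = Seq (Read MoveLeft) (Seq (While 0 {1, 2} (Read MoveLeft)) (Read MoveRight))"

lemma runs_Rewind:
  "runs Rewind (ctapes K x (int (length x)) out env) (length x * 2 + 3)
    (ctapes K x 0 out env)"
proof -
  have loop: "runs (While 0 {1, 2} (Read MoveLeft)) (ctapes K x (int k - 1) out env) (k * 2 + 1)
      (ctapes K x (- 1) out env)" if "k \<le> length x" for k
    using that
  proof (induction k)
    case 0
    then show ?case
      using runs_While_False[of 0 "ctapes K x (- 1) out env" "{1, 2}" "Read MoveLeft"]
      by (simp add: bits_tape_def)
  next
    case (Suc k)
    have "runs (While 0 {1, 2} (Read MoveLeft)) (ctapes K x (int (Suc k) - 1) out env)
      (1 + (k * 2 + 1) + 1) (ctapes K x (- 1) out env)"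
    proof (rule runs_While_True)
      show "runs (Read MoveLeft) (ctapes K x (int (Suc k) - 1) out env) 1
          (ctapes K x (int k - 1) out env)"
        using runs_Read[of MoveLeft K x "int k" out env] by simp
    qed (use Suc in \<open>auto simp: bits_tape_def\<close>)
    then show ?case by (rule runs_weaken) auto
  qed
  have 1: "runs (Read MoveLeft) (ctapes K x (int (length x)) out env) 1
      (ctapes K x (int (length x) - 1) out env)"
    using runs_Read[of MoveLeft] by simp
  have 3: "runs (Read MoveRight) (ctapes K x (- 1) out env) 1 (ctapes K x 0 out env)"
    using runs_Read[of MoveRight K x "- 1"] by simp
  show ?thesis unfolding Rewind_def
    by (rule runs_weaken[OF runs_Seq[OF 1 runs_Seq[OF loop[OF order_refl] 3]]]) auto
qed

text \<open>
  A block \<open>(inp, bs, ts)\<close> with \<open>inp\<close> true is repeated for every bit of the input; variable \<open>1\<close>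
  is then the position of the bit and variable \<open>2\<close> its tape symbol. Variable \<open>0\<close> is always the
  length of the input.
\<close>

type_synonym block = "bool \<times> loop_binder list \<times> tok list"

definition bit_symbol :: "bool \<Rightarrow> nat" where
  "bit_symbol b = (if b then 2 else 1)"

definition start_envs :: "bool \<Rightarrow> bits \<Rightarrow> nat list list" where
  "start_envs inp x =
    (if inp then map (\<lambda>i. [length x, i, bit_symbol (x ! i)]) [0..<length x] else [[length x]])"

definition start_depth :: "bool \<Rightarrow> nat" where
  "start_depth inp = (if inp then 3 else 1)"

fun block_ok :: "block \<Rightarrow> bool" where
  "block_ok (inp, bs, ts) \<longleftrightarrow> toks_ok (start_depth inp) bs ts"

fun block_out :: "bits \<Rightarrow> block \<Rightarrow> bits" where
  "block_out x (inp, bs, ts) = concat (map (loop_out bs ts) (start_envs inp x))"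

text \<open>Counters \<open>4\<close> and \<open>6\<close> are variables \<open>1\<close> and
  \<open>2\<close>. The symbol is obtained by counting: once for each bit, and once more if the tape
  shows \<open>2\<close>.\<close>

fun Block :: "block \<Rightarrow> cmd" where
  "Block (inp, bs, ts) =
    (if inp
     then Seq (While 0 {1, 2} (Seq (Inc 6) (Seq (If 0 {2} (Inc 6) Skip)
             (Seq (Loop 3 bs ts) (Seq (Drain 6 [] []) (Seq (Inc 4) (Read MoveRight)))))))
           (Seq (Drain 4 [] []) Rewind)
     else Loop 1 bs ts)"

lemma runs_Block:
  assumes "block_ok (inp, bs, ts)" "K \<ge> 2 * (3 + length bs) + 2"
  shows "\<exists>T :: nat poly. \<forall>x out env. represents [length x] env \<longrightarrow>
    runs (Block (inp, bs, ts)) (ctapes K x 0 out env) (poly T (length x))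
      (ctapes K x 0 (out @ block_out x (inp, bs, ts)) env)"
proof (cases inp)
  case False
  then have "toks_ok 1 bs ts" "K \<ge> 2 * (1 + length bs) + 2"
    using assms by (auto simp: start_depth_def)
  from runs_Loop[OF this]
  obtain T :: "nat poly" where T: "\<And>x ip out e env m. length e = 1 \<Longrightarrow> represents e env \<Longrightarrow>
      \<forall>a \<in> set e. a \<le> m \<Longrightarrow> runs (Loop 1 bs ts) (ctapes K x ip out env) (poly T m)
      (ctapes K x ip (out @ loop_out bs ts e) env)"
    by blast
  then show ?thesis using False by (intro exI[of _ T]) (simp add: start_envs_def)
next
  case True
  then have "toks_ok 3 bs ts" "K \<ge> 2 * (3 + length bs) + 2"
    using assms by (auto simp: start_depth_def)
  from runs_Loop[OF this]
  obtain T :: "nat poly" where T: "\<And>x ip out e env m. length e = 3 \<Longrightarrow> represents e env \<Longrightarrow>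
      \<forall>a \<in> set e. a \<le> m \<Longrightarrow> runs (Loop 3 bs ts) (ctapes K x ip out env) (poly T m)
      (ctapes K x ip (out @ loop_out bs ts e) env)"
    by blast
  let ?B = "\<lambda>m. (m * ((1 + (2 + (poly T (m + 2) + (9 + (1 + 1))))) + 1) + 1) + ((m * 4 + 1) + (m * 2 + 3))"
  have "pbound ?B" by (intro pbound_intros)
  then obtain T' :: "nat poly" where T': "\<And>m. ?B m \<le> poly T' m" unfolding pbound_def by blast
  have "runs (Block (inp, bs, ts)) (ctapes K x 0 out env) (poly T' (length x))
      (ctapes K x 0 (out @ block_out x (inp, bs, ts)) env)"
    if env: "represents [length x] env" for x out env
  proof -
    let ?n = "length x"
    let ?E = "\<lambda>i. env(4 := i)"
    let ?e = "\<lambda>i. [?n, i, bit_symbol (x ! i)]"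
    let ?Ou = "\<lambda>i. out @ concat (map (\<lambda>i. loop_out bs ts (?e i)) [0..<i])"
    have z: "env 4 = 0" "env 6 = 0" using env by (auto simp: represents_def)
    have E0: "?E 0 = env" using z by auto
    have step: "runs (Seq (Inc 6) (Seq (If 0 {2} (Inc 6) Skip)
             (Seq (Loop 3 bs ts) (Seq (Drain 6 [] []) (Seq (Inc 4) (Read MoveRight))))))
        (ctapes K x (int i) (?Ou i) (?E i)) (1 + (2 + (poly T (?n + 2) + (9 + (1 + 1)))))
        (ctapes K x (int (Suc i)) (?Ou (Suc i)) (?E (Suc i)))" if i: "i < ?n" for i
    proof -
      let ?S = "(?E i)(6 := bit_symbol (x ! i))"
      have s1: "runs (Inc 6) (ctapes K x (int i) (?Ou i) (?E i)) 1
          (ctapes K x (int i) (?Ou i) ((?E i)(6 := 1)))"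
        using runs_Inc[of 6 K x "int i" "?Ou i" "?E i"] assms(2) z by simp
      have s2: "runs (If 0 {2} (Inc 6) Skip) (ctapes K x (int i) (?Ou i) ((?E i)(6 := 1))) (1 + 1)
          (ctapes K x (int i) (?Ou i) ?S)"
      proof (rule runs_If)
        show "runs (if tape_read (ctapes K x (int i) (?Ou i) ((?E i)(6 := 1)) ! 0) \<in> {2}
            then Inc 6 else Skip) (ctapes K x (int i) (?Ou i) ((?E i)(6 := 1))) 1
            (ctapes K x (int i) (?Ou i) ?S)"
        proof (cases "x ! i")
          case True
          have "runs (Inc 6) (ctapes K x (int i) (?Ou i) ((?E i)(6 := 1))) 1
              (ctapes K x (int i) (?Ou i) ((?E i)(6 := Suc 1)))"
            using runs_Inc[of 6 K x "int i" "?Ou i" "(?E i)(6 := 1)"] assms(2) by simp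
          moreover have "bit_symbol (x ! i) = Suc 1" using True by (simp add: bit_symbol_def)
          ultimately show ?thesis using True i by (simp add: bits_tape_def)
        next
          case False
          then show ?thesis using runs_Skip[of K x "int i" "?Ou i" ?S] i
            by (simp add: bits_tape_def bit_symbol_def)
        qed
      qed simp
      have rep: "represents (?e i) ?S" 
        using env by (auto simp: represents_def less_Suc_eq numeral_3_eq_3 nth_Cons')
      have s3: "runs (Loop 3 bs ts) (ctapes K x (int i) (?Ou i) ?S) (poly T (?n + 2))
          (ctapes K x (int i) (?Ou (Suc i)) ?S)"
        using T[OF _ rep, of "?n + 2" x "int i" "?Ou i"] i by (simp add: bit_symbol_def)
      have s4: "runs (Drain 6 [] []) (ctapes K x (int i) (?Ou (Suc i)) ?S) 9
          (ctapes K x (int i) (?Ou (Suc i)) (?E i))"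
        by (rule runs_weaken[OF runs_Clear]) (use assms(2) z in \<open>auto simp: bit_symbol_def\<close>)
      have s5: "runs (Inc 4) (ctapes K x (int i) (?Ou (Suc i)) (?E i)) 1
          (ctapes K x (int i) (?Ou (Suc i)) (?E (Suc i)))"
        using runs_Inc[of 4 K x "int i" "?Ou (Suc i)" "?E i"] assms(2) by simp
      have s6: "runs (Read MoveRight) (ctapes K x (int i) (?Ou (Suc i)) (?E (Suc i))) 1
          (ctapes K x (int (Suc i)) (?Ou (Suc i)) (?E (Suc i)))"
        using runs_Read[of MoveRight K x "int i" "?Ou (Suc i)" "?E (Suc i)"] by (simp add: add.commute)
      show ?thesis
        using runs_Seq[OF s1 runs_Seq[OF s2 runs_Seq[OF s3 runs_Seq[OF s4 runs_Seq[OF s5 s6]]]]]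
        by simp
    qed
    have O0: "?Ou 0 = out" by simp
    note 1 = runs_While_input[where E = ?E and Ou = ?Ou, OF step, unfolded E0 O0]
    have 2: "runs (Drain 4 [] []) (ctapes K x (int ?n) (?Ou ?n) (?E ?n)) (?n * 4 + 1)
        (ctapes K x (int ?n) (?Ou ?n) env)"
      using assms(2) z by (intro runs_Clear) auto
    have B: "Block (inp, bs, ts) = Seq (While 0 {1, 2} (Seq (Inc 6) (Seq (If 0 {2} (Inc 6) Skip)
             (Seq (Loop 3 bs ts) (Seq (Drain 6 [] []) (Seq (Inc 4) (Read MoveRight)))))))
           (Seq (Drain 4 [] []) Rewind)"
      using True by simp
    have "?Ou ?n = out @ block_out x (inp, bs, ts)"
      using True by (simp add: start_envs_def comp_def)
    then show ?thesis unfolding B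
      by (intro runs_weaken[OF runs_Seq[OF 1 runs_Seq[OF 2 runs_Rewind]] T']) simp_all
  qed
  then show ?thesis by blast
qed

fun Blocks :: "block list \<Rightarrow> cmd" where
  "Blocks [] = Skip"
| "Blocks (b # bks) = Seq (Block b) (Blocks bks)"

lemma runs_Blocks:
  assumes "\<forall>b \<in> set bks. block_ok b \<and> K \<ge> 2 * (3 + length (fst (snd b))) + 2"
  shows "\<exists>T :: nat poly. \<forall>x out env. represents [length x] env \<longrightarrow>
    runs (Blocks bks) (ctapes K x 0 out env) (poly T (length x))
      (ctapes K x 0 (out @ concat (map (block_out x) bks)) env)"
  using assms
proof (induction bks)
  case Nil
  then show ?case using runs_Skip by (intro exI[of _ "[:1:]"]) simp
next
  case (Cons b bks)
  obtain inp bs ts where b: "b = (inp, bs, ts)" by (cases b)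
  obtain T1 :: "nat poly" where T1: "\<And>x out env. represents [length x] env \<Longrightarrow>
    runs (Block b) (ctapes K x 0 out env) (poly T1 (length x))
      (ctapes K x 0 (out @ block_out x b) env)"
    using runs_Block[of inp bs ts K] Cons.prems b by auto
  obtain T2 :: "nat poly" where T2: "\<And>x out env. represents [length x] env \<Longrightarrow>
    runs (Blocks bks) (ctapes K x 0 out env) (poly T2 (length x))
      (ctapes K x 0 (out @ concat (map (block_out x) bks)) env)"
    using Cons by (metis list.set_intros(2))
  have "runs (Blocks (b # bks)) (ctapes K x 0 out env) (poly (T1 + T2) (length x))
      (ctapes K x 0 (out @ concat (map (block_out x) (b # bks))) env)"
    if "represents [length x] env" for x out env
    using runs_Seq[OF T1[OF that, of out] T2[OF that]] by simp
  then show ?case by blast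
qed

text \<open>Auxiliary tapes start blank; each counter needs the symbol \<open>1\<close> in cell
  \<open>0\<close> as its marker for zero.\<close>

fun Init :: "nat \<Rightarrow> cmd" where
  "Init 0 = Skip"
| "Init (Suc k) = Seq (Init k) (Act (Suc (Suc k)) (Some 1) Stay)"

lemma runs_Init:
  assumes "k \<le> K"
  shows "runs (Init k) ((bits_tape w, 0) # replicate (Suc K) (bits_tape [], 0)) (k + 1)
    ((bits_tape w, 0) # (bits_tape [], 0) #
      map (\<lambda>i. if i < k then counter_tape 0 else (bits_tape [], 0)) [0..<K])"
  using assms
proof (induction k)
  case 0
  have "runs Skip ((bits_tape w, 0) # replicate (Suc K) (bits_tape [], 0)) 1
    ((bits_tape w, 0) # replicate (Suc K) (bits_tape [], 0))"
    unfolding Skip_def by (rule runs_Act) auto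
  then show ?case by (simp add: map_replicate_const)
next
  case (Suc k)
  let ?m = "\<lambda>k. (bits_tape w, 0) # (bits_tape [], 0) #
      map (\<lambda>i. if i < k then counter_tape 0 else (bits_tape [], 0)) [0..<K]"
  have "(bits_tape [])(0 := 1) = (\<lambda>i. if i = 0 then 1 else 0)"
    by (auto simp: bits_tape_def)
  then have "runs (Act (Suc (Suc k)) (Some 1) Stay) (?m k) 1 (?m (Suc k))"
    using Suc.prems
    by (intro runs_Act) (auto simp: counter_tape_def nth_list_update intro!: nth_equalityI)
  from runs_Seq[OF Suc.IH this] Suc.prems show ?case by simp
qed

section \<open>Well-formedness of the commands\<close>

lemma cmd_ok_macros:
  "2 \<le> K \<Longrightarrow> cmd_ok K Skip" "Suc (Suc i) < K \<Longrightarrow> cmd_ok K (Inc i)" "Suc (Suc i) < K \<Longrightarrow> cmd_ok K (Dec i)"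
  "2 \<le> K \<Longrightarrow> cmd_ok K (Emit b)" "2 \<le> K \<Longrightarrow> cmd_ok K (Read m)" "2 \<le> K \<Longrightarrow> cmd_ok K Rewind"
  by (auto simp: Skip_def Inc_def Dec_def Emit_def Read_def Rewind_def)

lemma cmd_ok_Emits: "2 \<le> K \<Longrightarrow> cmd_ok K (Emits w)"
  by (induction w) (auto simp: cmd_ok_macros)

lemma cmd_ok_Incs: "2 \<le> K \<Longrightarrow> \<forall>d \<in> set ds. Suc (Suc d) < K \<Longrightarrow> cmd_ok K (Incs ds)"
  by (induction ds) (auto simp: cmd_ok_macros)

lemma cmd_ok_Drain:
  "2 \<le> K \<Longrightarrow> Suc (Suc s) < K \<Longrightarrow> \<forall>d \<in> set ds. Suc (Suc d) < K \<Longrightarrow> cmd_ok K (Drain s ds w)"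
  by (auto simp: Drain_def cmd_ok_macros cmd_ok_Emits cmd_ok_Incs)

lemma cmd_ok_Copy: "Suc (Suc u) < K \<Longrightarrow> Suc (Suc c) < K \<Longrightarrow> cmd_ok K (Copy u c)"
  by (auto simp: Copy_def intro!: cmd_ok_Drain)

lemma cmd_ok_Horner:
  "Suc (Suc u) < K \<Longrightarrow> Suc (Suc v) < K \<Longrightarrow> 4 \<le> K \<Longrightarrow> cmd_ok K (Horner as v u)"
  by (induction as)
    (auto simp: Mult_def cmd_ok_macros intro!: cmd_ok_Drain cmd_ok_Copy cmd_ok_Incs)

lemma cmd_ok_Toks:
  "\<forall>v. TU v \<in> set ts \<longrightarrow> v < d \<Longrightarrow> 2 * d + 6 \<le> K \<Longrightarrow> cmd_ok K (Toks ts)"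
proof (induction ts)
  case (Cons t ts)
  then have v: "v < d" if "t = TU v" for v using that by simp
  have "cmd_ok K (Toks ts)" using Cons by simp
  then show ?case
    using v Cons.prems(2) by (cases t) (force simp: cmd_ok_Emits intro!: cmd_ok_Drain)+
qed (auto simp: cmd_ok_macros)

lemma cmd_ok_Loop:
  "toks_ok d bs ts \<Longrightarrow> 2 * (d + length bs) + 6 \<le> K \<Longrightarrow> cmd_ok K (Loop d bs ts)"
proof (induction d bs ts rule: Loop.induct)
  case (1 d ts)
  then show ?case using cmd_ok_Toks[of ts d K] by simp
next
  case (2 d u bs ts)
  then show ?case by (auto intro!: cmd_ok_Copy cmd_ok_macros cmd_ok_Drain)
next
  case (3 d p u bs ts)
  then show ?case by (auto intro!: cmd_ok_Horner cmd_ok_Drain)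
qed

lemma cmd_ok_Block:
  assumes "block_ok b" "2 * (3 + length (fst (snd b))) + 6 \<le> K"
  shows "cmd_ok K (Block b)"
proof -
  obtain inp bs ts where b: "b = (inp, bs, ts)" by (cases b)
  show ?thesis
    using assms cmd_ok_Loop[of 3 bs ts K] cmd_ok_Loop[of 1 bs ts K]
    by (auto simp: b start_depth_def cmd_ok_macros cmd_ok_Drain)
qed

lemma cmd_ok_Blocks:
  "\<forall>b \<in> set bks. block_ok b \<and> 2 * (3 + length (fst (snd b))) + 6 \<le> K \<Longrightarrow> 2 \<le> K \<Longrightarrow> cmd_ok K (Blocks bks)"
  by (induction bks) (auto simp: cmd_ok_macros cmd_ok_Block)

lemma cmd_ok_Init: "k + 2 \<le> K \<Longrightarrow> cmd_ok K (Init k)"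
  by (induction k) (auto simp: cmd_ok_macros)

theorem polytime_computable_blocks:
  assumes "\<forall>b \<in> set bks. block_ok b"
  shows "polytime_computable (\<lambda>x. concat (map (block_out x) bks))"
proof -
  \<comment> \<open>Two counters for each variable, of which up to three exist before the binders; a
    sum is large enough for every block.\<close>
  define K where "K = sum_list (map (\<lambda>b. 2 * (3 + length (fst (snd b))) + 6) bks) + 6"
  have K: "K \<ge> 6" by (simp add: K_def)
  have KB: "\<forall>b \<in> set bks. block_ok b \<and> 2 * (3 + length (fst (snd b))) + 6 \<le> K"
  proof
    fix b assume "b \<in> set bks"
    then have "2 * (3 + length (fst (snd b))) + 6 \<le>
        sum_list (map (\<lambda>b. 2 * (3 + length (fst (snd b))) + 6) bks)"
      by (intro member_le_sum_list) auto
    then show "block_ok b \<and> 2 * (3 + length (fst (snd b))) + 6 \<le> K"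
      using assms \<open>b \<in> set bks\<close> by (simp add: K_def)
  qed
  obtain T :: "nat poly" where T: "\<And>x out env. represents [length x] env \<Longrightarrow>
    runs (Blocks bks) (ctapes K x 0 out env) (poly T (length x))
      (ctapes K x 0 (out @ concat (map (block_out x) bks)) env)"
    using runs_Blocks[of bks K] KB by fastforce
  \<comment> \<open>Counts the input into counter \<open>2\<close>, which is variable
    \<open>0\<close>.\<close>
  let ?scan = "While 0 {1, 2} (Seq (Inc 2) (Read MoveRight))"
  let ?c = "Seq (Init K) (Seq ?scan (Seq Rewind (Blocks bks)))"
  let ?B = "\<lambda>m. (K + 1) + ((m * ((1 + 1) + 1) + 1) + ((m * 2 + 3) + poly T m))"
  have "pbound ?B" by (intro pbound_intros)
  then obtain T' :: "nat poly" where T': "\<And>m. ?B m \<le> poly T' m" unfolding pbound_def by blast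
  show ?thesis
  proof (rule polytime_computable_cmd[where c = ?c and K = "K + 2" and p = T'])
    show "cmd_ok (K + 2) ?c"
      using KB K by (auto intro!: cmd_ok_Init cmd_ok_macros cmd_ok_Blocks)
    fix x :: bits
    let ?E = "\<lambda>i. (\<lambda>_. 0)(2 := i)" and ?n = "length x"
    have 1: "runs (Init K) ((bits_tape x, 0) # replicate (Suc K) (bits_tape [], 0)) (K + 1)
        (ctapes K x 0 [] (?E 0))"
      by (rule runs_weaken[OF runs_Init]) (auto simp: ctapes_def)
    have 2: "runs ?scan (ctapes K x 0 [] (?E 0)) (?n * ((1 + 1) + 1) + 1)
        (ctapes K x (int ?n) [] (?E ?n))"
    proof (rule runs_While_input[where E = ?E and Ou = "\<lambda>_. []"])
      fix i
      show "runs (Seq (Inc 2) (Read MoveRight)) (ctapes K x (int i) [] (?E i)) (1 + 1)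
          (ctapes K x (int (Suc i)) [] (?E (Suc i)))"
        using runs_Seq[OF runs_Inc[of 2 K x "int i" "[]" "?E i"] runs_Read[of MoveRight]] K
        by (simp add: add.commute)
    qed
    have 3: "runs (Blocks bks) (ctapes K x 0 [] (?E ?n)) (poly T ?n)
        (ctapes K x 0 ([] @ concat (map (block_out x) bks)) (?E ?n))"
      by (rule T) (simp add: represents_def)
    have "runs ?c ((bits_tape x, 0) # replicate (Suc K) (bits_tape [], 0)) (?B ?n)
        (ctapes K x 0 ([] @ concat (map (block_out x) bks)) (?E ?n))"
      by (rule runs_Seq[OF 1 runs_Seq[OF 2 runs_Seq[OF runs_Rewind 3]]])
    then obtain n where n: "n \<le> ?B ?n"
      "run ?c ((bits_tape x, 0) # replicate (Suc K) (bits_tape [], 0)) n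
        (ctapes K x 0 ([] @ concat (map (block_out x) bks)) (?E ?n))"
      unfolding runs_def by blast
    have "n \<le> poly T' ?n" using n(1) T'[of ?n] by linarith
    then show "\<exists>n\<le>poly T' ?n. \<exists>ts.
        run ?c ((bits_tape x, 0) # replicate (K + 2 - 1) (bits_tape [], 0)) n ts \<and>
        fst (ts ! 1) = bits_tape (concat (map (block_out x) bks))"
      using n(2) by (intro exI[of _ n]) (auto intro!: exI simp: replicate_Suc[symmetric] simp del: replicate_Suc)
  qed simp
qed

section \<open>Encoding ground programs given by schemas\<close>

text \<open>A constant and a list of variables, standing for their sum. A variable listed twice
  counts twice, so \<open>(1, [2, 2])\<close> is one more than twice variable
  \<open>2\<close>.\<close>

type_synonym ix = "nat \<times> nat list"

definition ix_val :: "nat list \<Rightarrow> ix \<Rightarrow> nat" where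
  "ix_val e i = fst i + sum_list (map ((!) e) (snd i))"

definition atom_val :: "nat list \<Rightarrow> ix list \<Rightarrow> nat list" where
  "atom_val e a = map (ix_val e) a"

text \<open>Unary blocks closed by \<open>False\<close> determine the list of numbers and can be
  printed with counters alone.\<close>

definition atom_name :: "nat list \<Rightarrow> bits" where
  "atom_name ns = concat (map (\<lambda>n. replicate n True @ [False]) ns)"

lemma replicate_True_False_eq:
  "replicate m True @ False # u = replicate n True @ False # v \<Longrightarrow> m = n \<and> u = v"
proof (induction m arbitrary: n)
  case 0
  then show ?case by (cases n) auto
next
  case (Suc m)
  then show ?case by (cases n) auto
qed

lemma inj_atom_name: "inj atom_name"
proof
  fix as bs :: "nat list"
  assume "atom_name as = atom_name bs"
  then show "as = bs"
  proof (induction as arbitrary: bs)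
    case Nil
    then show ?case by (cases bs) (auto simp: atom_name_def)
  next
    case (Cons a as)
    then obtain b bs' where bs: "bs = b # bs'" by (cases bs) (auto simp: atom_name_def)
    have "a = b \<and> atom_name as = atom_name bs'"
      using Cons.prems by (intro replicate_True_False_eq) (simp add: bs atom_name_def)
    then show ?case using Cons.IH bs by blast
  qed
qed

definition ix_toks :: "ix \<Rightarrow> tok list" where
  "ix_toks i = TB (concat (replicate (fst i) [True, True])) # map TU (snd i) @ [TB [True, False]]"

definition atom_toks :: "ix list \<Rightarrow> tok list" where
  "atom_toks a = concat (map ix_toks a) @ [TB [False]]"

definition list_toks :: "('a \<Rightarrow> tok list) \<Rightarrow> 'a list \<Rightarrow> tok list" where
  "list_toks t xs = concat (map (\<lambda>x. TB [True] # t x) xs) @ [TB [False]]"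

fun lit_toks :: "ix list lit \<Rightarrow> tok list" where
  "lit_toks (PosLit a) = TB [False] # atom_toks a"
| "lit_toks (NegLit a) = TB [True] # atom_toks a"

fun elit_toks :: "ix list elit \<Rightarrow> tok list" where
  "elit_toks (ENot l) = lit_toks l"

fun erule_toks :: "ix list erule \<Rightarrow> tok list" where
  "erule_toks (ERule hs ls ps ns) =
    list_toks atom_toks hs @ list_toks lit_toks ls @ list_toks elit_toks ps @ list_toks elit_toks ns"

lemma toks_out_append: "toks_out (ts @ us) e = toks_out ts e @ toks_out us e"
  by (simp add: toks_out_def)

lemma toks_out_Cons: "toks_out (t # us) e = tok_out e t @ toks_out us e"
  by (simp add: toks_out_def)

lemma toks_out_Nil: "toks_out [] e = []"
  by (simp add: toks_out_def)

lemmas toks_out_simps = toks_out_append toks_out_Cons toks_out_Nil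

text \<open>\<open>enc_bits\<close> without its terminator. It commutes with concatenation, so the
  output of each token can be computed separately.\<close>

definition double :: "bits \<Rightarrow> bits" where
  "double w = concat (map (\<lambda>b. [True, b]) w)"

lemma double_append: "double (u @ v) = double u @ double v"
  by (simp add: double_def)

lemma enc_bits_double: "enc_bits w = double w @ [False]"
  by (simp add: enc_bits_def enc_list_def double_def)

lemma double_replicate: "double (replicate n True) = concat (replicate n [True, True])"
  by (simp add: double_def)

lemma toks_out_TU:
  "toks_out (map TU vs) e = double (replicate (sum_list (map ((!) e) vs)) True)"
  by (induction vs) (auto simp: toks_out_simps replicate_add double_append double_replicate double_def)

lemma toks_out_ix: "toks_out (ix_toks i) e = double (replicate (ix_val e i) True @ [False])"
  by (simp add: ix_toks_def toks_out_simps toks_out_TU ix_val_def replicate_add double_append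
      double_replicate[symmetric]) (simp add: double_def)

lemma toks_out_atom: "toks_out (atom_toks a) e = enc_bits (atom_name (atom_val e a))"
proof -
  have "toks_out (concat (map ix_toks a)) e = double (atom_name (atom_val e a))"
    by (induction a)
      (auto simp: atom_name_def atom_val_def toks_out_simps toks_out_ix double_append double_def)
  then show ?thesis by (simp add: atom_toks_def toks_out_simps enc_bits_double)
qed

lemma toks_out_list:
  assumes "\<And>x. toks_out (t x) e = enc (g x)"
  shows "toks_out (list_toks t xs) e = enc_list enc (map g xs)"
proof -
  have "toks_out (concat (map (\<lambda>x. TB [True] # t x) xs)) e =
      concat (map (\<lambda>x. True # enc x) (map g xs))"
    by (induction xs) (auto simp: toks_out_simps assms)
  then show ?thesis by (simp add: list_toks_def toks_out_simps enc_list_def)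
qed

lemma toks_out_lit: "toks_out (lit_toks l) e = enc_lit (map_lit (atom_name \<circ> atom_val e) l)"
  by (cases l) (auto simp: toks_out_simps toks_out_atom)

lemma toks_out_elit: "toks_out (elit_toks l) e = enc_elit (map_elit (atom_name \<circ> atom_val e) l)"
  by (cases l) (auto simp: toks_out_lit)

lemma toks_out_erule: "toks_out (erule_toks r) e = enc_erule (map_erule (atom_name \<circ> atom_val e) r)"
  by (cases r) (simp add: toks_out_simps
      toks_out_list[where enc = enc_bits and g = "\<lambda>a. atom_name (atom_val e a)", OF toks_out_atom]
      toks_out_list[where enc = enc_lit and g = "map_lit (atom_name \<circ> atom_val e)", OF toks_out_lit]
      toks_out_list[where enc = enc_elit and g = "map_elit (atom_name \<circ> atom_val e)", OF toks_out_elit] comp_def)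

section \<open>Printing lists of ground instances\<close>

type_synonym 'b schema = "bool \<times> loop_binder list \<times> 'b"

definition schema_envs :: "bits \<Rightarrow> bool \<Rightarrow> loop_binder list \<Rightarrow> nat list list" where
  "schema_envs x inp bs = concat (map (envs bs) (start_envs inp x))"

definition ground :: "(nat list \<Rightarrow> 'b \<Rightarrow> 'c) \<Rightarrow> bits \<Rightarrow> 'b schema list \<Rightarrow> 'c list" where
  "ground f x S = concat (map (\<lambda>(inp, bs, r). map (\<lambda>e. f e r) (schema_envs x inp bs)) S)"

text \<open>In \<open>enc_list\<close> each element carries its own \<open>True\<close>, so a list
  can be printed by independent loops, one per schema, followed by a block for the
  terminator.\<close>

definition list_blocks :: "('b \<Rightarrow> tok list) \<Rightarrow> 'b schema list \<Rightarrow> block list" where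
  "list_blocks t S = map (\<lambda>(inp, bs, r). (inp, bs, TB [True] # t r)) S @ [(False, [], [TB [False]])]"

lemma block_out_list_blocks:
  assumes "\<And>e r. toks_out (t r) e = enc (f e r)"
  shows "concat (map (block_out x) (list_blocks t S)) = enc_list enc (ground f x S)"
proof -
  have "toks_out (TB [True] # t r) = (\<lambda>e. True # enc (f e r))" for r
    by (rule ext) (simp add: toks_out_Cons assms)
  then have "block_out x (inp, bs, TB [True] # t r) =
      concat (map (\<lambda>y. True # enc y) (map (\<lambda>e. f e r) (schema_envs x inp bs)))" for inp bs r
    by (simp add: loop_out_def[abs_def] toks_out_Cons assms schema_envs_def map_concat concat_concat_map comp_def)
  then have "concat (map (\<lambda>s. block_out x (case s of (inp, bs, r) \<Rightarrow> (inp, bs, TB [True] # t r))) S) =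
      concat (map (\<lambda>y. True # enc y) (ground f x S))"
    unfolding ground_def by (induction S) auto
  then show ?thesis
    by (simp add: list_blocks_def enc_list_def loop_out_def toks_out_def start_envs_def comp_def)
qed

fun binders_ok :: "nat \<Rightarrow> loop_binder list \<Rightarrow> bool" where
  "binders_ok d [] \<longleftrightarrow> True"
| "binders_ok d (BFor u # bs) \<longleftrightarrow> u < d \<and> binders_ok (Suc d) bs"
| "binders_ok d (BLet p u # bs) \<longleftrightarrow> u < d \<and> binders_ok (Suc d) bs"

lemma toks_ok_iff:
  "toks_ok d bs ts \<longleftrightarrow> binders_ok d bs \<and> (\<forall>v. TU v \<in> set ts \<longrightarrow> v < d + length bs)"
  by (induction d bs ts rule: toks_ok.induct) auto

definition atom_vars :: "ix list \<Rightarrow> nat set" where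
  "atom_vars a = \<Union> (set ` snd ` set a)"

lemma TU_in_ix_toks: "TU v \<in> set (ix_toks i) \<longleftrightarrow> v \<in> set (snd i)"
  by (auto simp: ix_toks_def)

lemma TU_in_atom_toks: "TU v \<in> set (atom_toks a) \<longleftrightarrow> v \<in> atom_vars a"
  by (force simp: atom_toks_def atom_vars_def TU_in_ix_toks)

lemma TU_in_list_toks: "TU v \<in> set (list_toks t xs) \<longleftrightarrow> (\<exists>x \<in> set xs. TU v \<in> set (t x))"
  by (auto simp: list_toks_def)

lemma TU_in_lit_toks: "TU v \<in> set (lit_toks l) \<longleftrightarrow> v \<in> atom_vars (lit_atom l)"
  by (cases l) (auto simp: TU_in_atom_toks)

lemma TU_in_elit_toks: "TU v \<in> set (elit_toks l) \<longleftrightarrow> v \<in> atom_vars (lit_atom (elit_lit l))"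
  by (cases l) (auto simp: TU_in_lit_toks)

definition erule_atoms :: "'a erule \<Rightarrow> 'a list" where
  "erule_atoms r = erule_head r @ map lit_atom (erule_lits r) @
    map (lit_atom \<circ> elit_lit) (erule_epos r) @ map (lit_atom \<circ> elit_lit) (erule_eneg r)"

lemma TU_in_erule_toks: "TU v \<in> set (erule_toks r) \<longleftrightarrow> (\<exists>a \<in> set (erule_atoms r). v \<in> atom_vars a)"
  by (cases r) (auto simp: erule_atoms_def TU_in_list_toks TU_in_atom_toks TU_in_lit_toks
      TU_in_elit_toks)

fun schema_ok :: "('b \<Rightarrow> ix list list) \<Rightarrow> 'b schema \<Rightarrow> bool" where
  "schema_ok ats (inp, bs, r) \<longleftrightarrow> binders_ok (start_depth inp) bs \<and>
    (\<forall>a \<in> set (ats r). atom_vars a \<subseteq> {..<start_depth inp + length bs})"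

lemma block_ok_list_blocks:
  assumes "\<And>v r. TU v \<in> set (t r) \<longleftrightarrow> (\<exists>a \<in> set (ats r). v \<in> atom_vars a)"
    and "\<forall>s \<in> set S. schema_ok ats s"
  shows "\<forall>b \<in> set (list_blocks t S). block_ok b"
  using assms by (fastforce simp: list_blocks_def toks_ok_iff)

text \<open>Turing machines are left behind here: from now on polynomial time only requires that the
  variables of every schema are bound.\<close>

theorem polytime_computable_enc_instance:
  assumes "\<forall>s \<in> set AS. schema_ok (\<lambda>a. [a]) s"
    and "\<forall>s \<in> set ES. schema_ok (\<lambda>l. [lit_atom (elit_lit l)]) s"
    and "\<forall>s \<in> set R1. schema_ok erule_atoms s"
    and "\<forall>s \<in> set R2. schema_ok erule_atoms s"
  shows "polytime_computable (\<lambda>x. enc_instance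
    (map atom_name (ground atom_val x AS))
    (map (map_elit atom_name) (ground (\<lambda>e. map_elit (atom_val e)) x ES))
    (map (map_erule atom_name) (ground (\<lambda>e. map_erule (atom_val e)) x R1))
    (map (map_erule atom_name) (ground (\<lambda>e. map_erule (atom_val e)) x R2)))"
proof -
  let ?bks = "list_blocks atom_toks AS @ list_blocks elit_toks ES @
    list_blocks erule_toks R1 @ list_blocks erule_toks R2"
  have map_ground: "map g (ground f x S) = ground (\<lambda>e r. g (f e r)) x S"
    for g :: "'c \<Rightarrow> 'd" and f :: "nat list \<Rightarrow> 'b \<Rightarrow> 'c" and x S
    unfolding ground_def by (induction S) auto
  have "concat (map (block_out x) ?bks) = enc_instance
    (map atom_name (ground atom_val x AS))
    (map (map_elit atom_name) (ground (\<lambda>e. map_elit (atom_val e)) x ES))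
    (map (map_erule atom_name) (ground (\<lambda>e. map_erule (atom_val e)) x R1))
    (map (map_erule atom_name) (ground (\<lambda>e. map_erule (atom_val e)) x R2))" for x
    unfolding enc_instance_def map_ground map_append concat_append
    by (simp add: elit.map_comp erule.map_comp
        block_out_list_blocks[where enc = enc_bits and f = "\<lambda>e a. atom_name (atom_val e a)", OF toks_out_atom]
        block_out_list_blocks[where enc = enc_elit and f = "\<lambda>e. map_elit (atom_name \<circ> atom_val e)", OF toks_out_elit]
        block_out_list_blocks[where enc = enc_erule and f = "\<lambda>e. map_erule (atom_name \<circ> atom_val e)", OF toks_out_erule])
  moreover have "\<forall>b \<in> set ?bks. block_ok b"
    using block_ok_list_blocks[OF _ assms(1), of atom_toks]
      block_ok_list_blocks[OF _ assms(2), of elit_toks]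
      block_ok_list_blocks[OF _ assms(3), of erule_toks]
      block_ok_list_blocks[OF _ assms(4), of erule_toks]
    by (simp add: TU_in_atom_toks TU_in_elit_toks TU_in_erule_toks ball_Un)
  ultimately show ?thesis using polytime_computable_blocks[of ?bks] by simp
qed

section \<open>Uniform equivalence and stable models\<close>

text \<open>Truth in \<open>J\<close> after forming the reduct with respect to \<open>I\<close>:
  negative literals have been decided by \<open>I\<close>.\<close>

fun lit_sat :: "'a set \<Rightarrow> 'a set \<Rightarrow> 'a lit \<Rightarrow> bool" where
  "lit_sat I J (PosLit a) \<longleftrightarrow> a \<in> J"
| "lit_sat I J (NegLit a) \<longleftrightarrow> a \<notin> I"

definition rule_sat :: "'a set \<Rightarrow> 'a set \<Rightarrow> 'a erule \<Rightarrow> bool" where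
  "rule_sat I J r \<longleftrightarrow>
    ((\<forall>l \<in> set (erule_lits r). lit_sat I J l) \<longrightarrow> (\<exists>h \<in> set (erule_head r). h \<in> J))"

definition stable_model :: "'a set \<Rightarrow> 'a erule set \<Rightarrow> 'a set \<Rightarrow> 'a set \<Rightarrow> bool" where
  "stable_model A R D I \<longleftrightarrow> I \<subseteq> A \<and> D \<subseteq> I \<and> (\<forall>r \<in> R. rule_sat I I r) \<and>
    \<not> (\<exists>J. J \<subset> I \<and> D \<subseteq> J \<and> (\<forall>r \<in> R. rule_sat I J r))"

lemma rule_sat_map_erule:
  assumes "inj f"
  shows "rule_sat (f ` I) (f ` J) (map_erule f r) \<longleftrightarrow> rule_sat I J r"
proof -
  have "lit_sat (f ` I) (f ` J) (map_lit f l) \<longleftrightarrow> lit_sat I J l" for l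
    using assms by (cases l) (auto simp: inj_image_mem_iff)
  then show ?thesis
    using assms by (cases r) (auto simp: rule_sat_def inj_image_mem_iff)
qed

lemma stable_model_map_erule:
  assumes "inj f"
  shows "stable_model (f ` A) (map_erule f ` R) (f ` D) (f ` I) \<longleftrightarrow> stable_model A R D I"
proof -
  have "(\<exists>J'. J' \<subset> f ` I \<and> f ` D \<subseteq> J' \<and> (\<forall>r \<in> R. rule_sat (f ` I) J' (map_erule f r))) \<longleftrightarrow>
      (\<exists>J. J \<subset> I \<and> D \<subseteq> J \<and> (\<forall>r \<in> R. rule_sat I J r))" (is "?l \<longleftrightarrow> ?r")
  proof
    assume ?l
    then obtain J' where J': "J' \<subset> f ` I \<and> f ` D \<subseteq> J' \<and>
      (\<forall>r \<in> R. rule_sat (f ` I) J' (map_erule f r))" by (elim exE)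
    then have "J' \<subseteq> f ` I" by (auto simp: psubset_eq)
    then obtain J where "J' = f ` J" by (rule subset_imageE)
    with J' have "J \<subset> I \<and> D \<subseteq> J \<and> (\<forall>r \<in> R. rule_sat I J r)"
      using assms
      by (simp add: rule_sat_map_erule inj_image_subset_iff psubset_eq inj_image_eq_iff)
    then show ?r by (rule exI)
  next
    assume ?r
    then obtain J where "J \<subset> I \<and> D \<subseteq> J \<and> (\<forall>r \<in> R. rule_sat I J r)" by (elim exE)
    then have "f ` J \<subset> f ` I \<and> f ` D \<subseteq> f ` J \<and> (\<forall>r \<in> R. rule_sat (f ` I) (f ` J) (map_erule f r))"
      using assms
      by (simp add: rule_sat_map_erule inj_image_subset_iff psubset_eq inj_image_eq_iff)
    then show ?l by (rule exI)
  qed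
  then show ?thesis
    using assms by (simp add: stable_model_def rule_sat_map_erule inj_image_subset_iff)
qed

text \<open>Satisfaction by \<open>J\<close> of the reduct with respect to \<open>I\<close> of the
  epistemic reduct. A guessed literal has become \<open>Top\<close>; an unguessed one is under
  default negation and hence evaluated in \<open>I\<close>, and so is its double negation.\<close>

definition erule_sat :: "'a elit set \<Rightarrow> 'a set \<Rightarrow> 'a set \<Rightarrow> 'a erule \<Rightarrow> bool" where
  "erule_sat \<Phi> I J r \<longleftrightarrow>
    (\<forall>l \<in> set (erule_lits r). lit_sat I J l) \<and>
    (\<forall>\<xi> \<in> set (erule_epos r). \<xi> \<in> \<Phi> \<or> \<not> lit_true I (elit_lit \<xi>)) \<and>
    (\<forall>\<xi> \<in> set (erule_eneg r). \<xi> \<notin> \<Phi> \<and> lit_true I (elit_lit \<xi>)) \<longrightarrow>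
    (\<exists>h \<in> set (erule_head r). h \<in> J)"

lemma GL_reduct_sat:
  "(\<forall>r \<in> GL_reduct (reduct_erule \<Phi> ` R) I. sat_rule J r) \<longleftrightarrow> (\<forall>r \<in> R. erule_sat \<Phi> I J r)"
proof -
  \<comment> \<open>The value of a body formula in the reduct: a false \<open>Naf\<close> formula
    deletes the rule and a true one is dropped, both according to \<open>I\<close>.\<close>
  let ?v = "\<lambda>f. if is_Naf f then nlit_true I f else nlit_true J f"
  have lit: "?v (nlit_of_lit l) \<longleftrightarrow> lit_sat I J l" for l
    by (cases l) auto
  have pos: "?v (reduct_elit \<Phi> \<xi>) \<longleftrightarrow> \<xi> \<in> \<Phi> \<or> \<not> lit_true I (elit_lit \<xi>)" for \<xi>
    by (auto simp: reduct_elit_def lit_true_def)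
  have neg: "?v (Naf (reduct_elit \<Phi> \<xi>)) \<longleftrightarrow> \<xi> \<notin> \<Phi> \<and> lit_true I (elit_lit \<xi>)" for \<xi>
    by (auto simp: reduct_elit_def lit_true_def)
  have body: "(\<forall>f \<in> set (rule_body (reduct_erule \<Phi> r)). ?v f) \<longleftrightarrow>
      (\<forall>l \<in> set (erule_lits r). lit_sat I J l) \<and>
      (\<forall>\<xi> \<in> set (erule_epos r). \<xi> \<in> \<Phi> \<or> \<not> lit_true I (elit_lit \<xi>)) \<and>
      (\<forall>\<xi> \<in> set (erule_eneg r). \<xi> \<notin> \<Phi> \<and> lit_true I (elit_lit \<xi>))" for r
    unfolding reduct_erule_def rule.sel set_append ball_Un set_map ball_simps lit pos neg by blast
  have head: "rule_head (reduct_erule \<Phi> r) = erule_head r" for r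
    by (simp add: reduct_erule_def)
  have "(\<forall>r \<in> GL_reduct R' I. sat_rule J r) \<longleftrightarrow>
      (\<forall>r \<in> R'. (\<forall>f \<in> set (rule_body r). ?v f) \<longrightarrow> (\<exists>h \<in> set (rule_head r). h \<in> J))" for R'
    by (fastforce simp: GL_reduct_def sat_rule_def)
  then show ?thesis unfolding erule_sat_def by (simp only: ball_simps body head)
qed

lemma sat_rule_reduct_erule: "sat_rule I (reduct_erule \<Phi> r) \<longleftrightarrow> erule_sat \<Phi> I I r"
proof -
  have "nlit_true I (nlit_of_lit l) \<longleftrightarrow> lit_sat I I l" for l
    by (cases l) auto
  then show ?thesis
    by (auto simp: sat_rule_def reduct_erule_def erule_sat_def reduct_elit_def lit_true_def ball_Un)
qed

lemma answer_sets_epistemic_reduct: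
  "answer_sets (epistemic_reduct P \<Phi>) =
    {I. I \<subseteq> elp_atoms P \<and> (\<forall>r \<in> elp_rules P. erule_sat \<Phi> I I r) \<and>
      \<not> (\<exists>J. J \<subset> I \<and> (\<forall>r \<in> elp_rules P. erule_sat \<Phi> I J r))}"
  by (simp add: answer_sets_def epistemic_reduct_def GL_reduct_sat sat_rule_reduct_erule)

section \<open>Two programs that differ in one constraint\<close>

definition forced :: "'a lit \<Rightarrow> 'a erule" where
  "forced l = ERule [] [] [] [ENot l]"

lemma erule_sat_forced: "erule_sat \<Phi> I J (forced l) \<longleftrightarrow> ENot l \<in> \<Phi> \<or> \<not> lit_true I l"
  by (auto simp: erule_sat_def forced_def)

text \<open>If \<open>ENot l\<close> is not guessed, compatibility makes \<open>l\<close> true in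
  every answer set, while the reduct turns the rule into a constraint against \<open>l\<close>. Both
  cannot hold, because there is an answer set.\<close>

lemma cwv_forced:
  assumes "cwv P \<Phi> M" "forced l \<in> elp_rules P" "ENot l \<in> elp_elits P"
  shows "ENot l \<in> \<Phi>"
proof (rule ccontr)
  assume "ENot l \<notin> \<Phi>"
  moreover obtain I where I: "I \<in> M" using assms(1) by (auto simp: cwv_def compatible_def)
  ultimately have "lit_true I l"
    using assms(1,3) unfolding cwv_def compatible_def by (metis DiffI elit_lit.simps)
  moreover have "erule_sat \<Phi> I I (forced l)"
    using assms(1,2) I by (auto simp: cwv_def answer_sets_epistemic_reduct)
  ultimately show False using \<open>ENot l \<notin> \<Phi>\<close> by (simp add: erule_sat_forced)
qed

text \<open>By \<open>avoidable\<close>, stable models exist and the guess of all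
  \<open>ENot (PosLit a)\<close> with \<open>a\<close> outside \<open>In\<close> is realised for
  each set of input facts. Only \<open>ENot (NegLit w)\<close> is left to distinguish
  guesses.\<close>

locale uniform_gadget =
  fixes A In :: "'a set" and R :: "'a erule set" and w :: 'a
  assumes no_epistemic: "\<forall>r \<in> R. erule_epos r = [] \<and> erule_eneg r = []"
    and In: "In \<subseteq> A"
    and w: "w \<in> A - In"
    and avoidable: "\<And>D a. D \<subseteq> In \<Longrightarrow> a \<in> A - In \<Longrightarrow> \<exists>I. stable_model A R D I \<and> a \<notin> I"
begin

definition elits :: "'a elit set" where
  "elits = insert (ENot (NegLit w)) ((\<lambda>a. ENot (PosLit a)) ` (A - In))"

definition prog1 :: "'a elp" where
  "prog1 = \<lparr>elp_atoms = A, elp_elits = elits, elp_rules = R \<union> (\<lambda>a. forced (PosLit a)) ` (A - In)\<rparr>"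

definition prog2 :: "'a elp" where
  "prog2 = \<lparr>elp_atoms = A, elp_elits = elits,
    elp_rules = insert (forced (NegLit w)) (R \<union> (\<lambda>a. forced (PosLit a)) ` (A - In))\<rparr>"

text \<open>A guess containing the forced literals removes the constraints. No rule of
  \<open>prog1\<close> mentions \<open>ENot (NegLit w)\<close>, so guessing it or not gives the same
  answer sets.\<close>

lemma answer_sets_prog:
  assumes "(\<lambda>a. ENot (PosLit a)) ` (A - In) \<subseteq> \<Phi>"
  shows "answer_sets (epistemic_reduct (add_facts prog1 D) \<Phi>) = {I. stable_model A R D I}"
    and "ENot (NegLit w) \<in> \<Phi> \<Longrightarrow>
      answer_sets (epistemic_reduct (add_facts prog2 D) \<Phi>) = {I. stable_model A R D I}"
proof -
  have fact: "erule_sat \<Phi> I J (ERule [a] [] [] []) \<longleftrightarrow> a \<in> J" for I J a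
    by (simp add: erule_sat_def)
  have rules: "(\<forall>r \<in> R. erule_sat \<Phi> I J r) \<longleftrightarrow> (\<forall>r \<in> R. rule_sat I J r)" for I J
    using no_epistemic by (auto simp: erule_sat_def rule_sat_def)
  have forced: "\<forall>r \<in> (\<lambda>a. forced (PosLit a)) ` (A - In). erule_sat \<Phi> I J r" for I J
    using assms by (auto simp: erule_sat_forced)
  have facts: "(\<forall>r \<in> (\<lambda>a. ERule [a] [] [] []) ` D. erule_sat \<Phi> I J r) \<longleftrightarrow> D \<subseteq> J" for I J
    by (auto simp: fact)
  have sat1: "(\<forall>r \<in> elp_rules (add_facts prog1 D). erule_sat \<Phi> I J r) \<longleftrightarrow>
      D \<subseteq> J \<and> (\<forall>r \<in> R. rule_sat I J r)" for I J
    using forced[of I J]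
    by (simp only: add_facts_def prog1_def elp.simps elp.update_convs ball_Un rules facts) blast
  have sat2: "(\<forall>r \<in> elp_rules (add_facts prog2 D). erule_sat \<Phi> I J r) \<longleftrightarrow>
      D \<subseteq> J \<and> (\<forall>r \<in> R. rule_sat I J r)" if "ENot (NegLit w) \<in> \<Phi>" for I J
  proof -
    have "elp_rules (add_facts prog2 D) = insert (forced (NegLit w)) (elp_rules (add_facts prog1 D))"
      by (simp add: add_facts_def prog1_def prog2_def)
    then show ?thesis using that by (simp only: ball_simps sat1) (simp add: erule_sat_forced)
  qed
  have atoms: "elp_atoms (add_facts prog1 D) = A" "elp_atoms (add_facts prog2 D) = A"
    by (simp_all add: add_facts_def prog1_def prog2_def)
  show "answer_sets (epistemic_reduct (add_facts prog1 D) \<Phi>) = {I. stable_model A R D I}"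
    unfolding answer_sets_epistemic_reduct stable_model_def sat1 atoms conj_assoc ..
  show "answer_sets (epistemic_reduct (add_facts prog2 D) \<Phi>) = {I. stable_model A R D I}"
    if "ENot (NegLit w) \<in> \<Phi>"
    unfolding answer_sets_epistemic_reduct stable_model_def sat2[OF that] atoms conj_assoc ..
qed

lemma cwv_prog:
  assumes "cwv P \<Phi> M" "P = add_facts prog1 D \<or> P = add_facts prog2 D"
  shows "(\<lambda>a. ENot (PosLit a)) ` (A - In) \<subseteq> \<Phi>" "P = add_facts prog2 D \<Longrightarrow> \<Phi> = elits"
    "\<Phi> \<subseteq> elits" "M = {I. stable_model A R D I}" "D \<inter> (A - In) = {}"
proof -
  have elits: "elp_elits P = elits" using assms(2) by (auto simp: add_facts_def prog1_def prog2_def)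
  show sub: "(\<lambda>a. ENot (PosLit a)) ` (A - In) \<subseteq> \<Phi>"
  proof clarify
    fix a assume "a \<in> A" "a \<notin> In"
    then show "ENot (PosLit a) \<in> \<Phi>"
      using assms(2) by (intro cwv_forced[OF assms(1)])
        (auto simp: add_facts_def prog1_def prog2_def elits_def)
  qed
  show \<Phi>: "\<Phi> \<subseteq> elits" using assms(1) elits by (simp add: cwv_def)
  show 2: "\<Phi> = elits" if "P = add_facts prog2 D"
  proof -
    have "ENot (NegLit w) \<in> \<Phi>"
      using that by (intro cwv_forced[OF assms(1)]) (auto simp: add_facts_def prog2_def elits_def)
    then show ?thesis using sub \<Phi> unfolding elits_def by blast
  qed
  show M: "M = {I. stable_model A R D I}"
    using assms answer_sets_prog[OF sub] 2 by (auto simp: cwv_def elits_def)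
  show "D \<inter> (A - In) = {}"
  proof (rule ccontr)
    assume "D \<inter> (A - In) \<noteq> {}"
    then obtain a where a: "a \<in> D" "a \<in> A - In" by blast
    \<comment> \<open>The fact \<open>a\<close> holds in every answer set, but the guess asks for
      one without it.\<close>
    then have "ENot (PosLit a) \<in> \<Phi>" using sub by blast
    then obtain I where "I \<in> M" "\<not> lit_true I (PosLit a)"
      using assms(1) unfolding cwv_def compatible_def by fastforce
    then show False using a M by (auto simp: stable_model_def lit_true_def)
  qed
qed

lemma cwv_elits_iff:
  assumes "D \<subseteq> In" "P = add_facts prog1 D \<or> P = add_facts prog2 D"
  shows "cwv P elits M \<longleftrightarrow> M = {I. stable_model A R D I} \<and> (\<exists>I. stable_model A R D I \<and> w \<in> I)"
proof -
  have sub: "(\<lambda>a. ENot (PosLit a)) ` (A - In) \<subseteq> elits" by (auto simp: elits_def)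
  have "answer_sets (epistemic_reduct P elits) = {I. stable_model A R D I}"
    using assms(2) answer_sets_prog[OF sub] by (auto simp: elits_def)
  moreover have "elp_elits P = elits"
    using assms(2) by (auto simp: add_facts_def prog1_def prog2_def)
  moreover have "compatible elits elits {I. stable_model A R D I} \<longleftrightarrow> (\<exists>I. stable_model A R D I \<and> w \<in> I)"
    using avoidable[OF assms(1)] by (auto simp: compatible_def elits_def lit_true_def)
  ultimately show ?thesis by (auto simp: cwv_def)
qed

theorem uniformly_equivalent_iff:
  "uniformly_WV_equivalent prog1 prog2 \<longleftrightarrow> (\<forall>D \<subseteq> In. \<exists>I. stable_model A R D I \<and> w \<in> I)"
proof
  assume eq: "uniformly_WV_equivalent prog1 prog2"
  show "\<forall>D \<subseteq> In. \<exists>I. stable_model A R D I \<and> w \<in> I"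
  proof (intro allI impI, rule ccontr)
    fix D assume D: "D \<subseteq> In" and none: "\<nexists>I. stable_model A R D I \<and> w \<in> I"
    \<comment> \<open>As every stable model satisfies the negation of \<open>w\<close>, leaving out
      \<open>ENot (NegLit w)\<close> is compatible. The only larger guess is \<open>elits\<close>,
      which is not compatible, so \<open>prog1\<close> has a world view. For \<open>prog2\<close>
      the guess \<open>elits\<close> is the only candidate.\<close>
    let ?\<Phi> = "(\<lambda>a. ENot (PosLit a)) ` (A - In)" and ?M = "{I. stable_model A R D I}"
    have "compatible elits ?\<Phi> ?M"
      using avoidable[OF D] w none by (auto simp: compatible_def elits_def lit_true_def)
    then have cwv: "cwv (add_facts prog1 D) ?\<Phi> ?M"
      using answer_sets_prog(1)[OF order_refl]
      by (auto simp: cwv_def add_facts_def prog1_def elits_def)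
    moreover have "\<not> (\<exists>\<Phi>' M'. ?\<Phi> \<subset> \<Phi>' \<and> cwv (add_facts prog1 D) \<Phi>' M')"
    proof (rule notI, elim exE conjE)
      fix \<Phi>' M' assume "?\<Phi> \<subset> \<Phi>'" and c: "cwv (add_facts prog1 D) \<Phi>' M'"
      then have "\<Phi>' = elits" using cwv_prog(3)[OF c] by (auto simp: elits_def)
      then show False using c cwv_elits_iff[OF D] none by blast
    qed
    ultimately have "?M \<in> world_views (add_facts prog1 D)"
      unfolding world_views_def by blast
    moreover have "D \<subseteq> elp_atoms prog1" using D In by (auto simp: prog1_def)
    ultimately have "?M \<in> world_views (add_facts prog2 D)"
      using eq unfolding uniformly_WV_equivalent_def by blast
    then obtain \<Phi> where c: "cwv (add_facts prog2 D) \<Phi> ?M" unfolding world_views_def by blast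
    then have "\<Phi> = elits" using cwv_prog(2) by blast
    then show False using c cwv_elits_iff[OF D] none by blast
  qed
next
  assume all: "\<forall>D \<subseteq> In. \<exists>I. stable_model A R D I \<and> w \<in> I"
  have "world_views (add_facts prog1 D) = world_views (add_facts prog2 D)" if "D \<subseteq> A" for D
  proof (cases "D \<subseteq> In")
    case False
    then have "\<not> cwv (add_facts prog1 D) \<Phi> M" "\<not> cwv (add_facts prog2 D) \<Phi> M" for \<Phi> M
      using that cwv_prog(5)[of _ \<Phi> M D] by blast+
    then show ?thesis by (simp add: world_views_def)
  next
    case True
    \<comment> \<open>The guess \<open>elits\<close> is compatible and has no proper extension;
      every other candidate has the same set of stable models.\<close>
    have "world_views P = {{I. stable_model A R D I}}" if P: "P = add_facts prog1 D \<or> P = add_facts prog2 D" for P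
    proof -
      have "\<exists>I. stable_model A R D I \<and> w \<in> I" using all True by simp
      then have c: "cwv P elits {I. stable_model A R D I}"
        by (simp add: cwv_elits_iff[OF True P])
      have max: "\<not> (\<exists>\<Phi>' M'. elits \<subset> \<Phi>' \<and> cwv P \<Phi>' M')"
      proof (rule notI, elim exE conjE)
        fix \<Phi>' M' assume "elits \<subset> \<Phi>'" "cwv P \<Phi>' M'"
        then show False using cwv_prog(3)[of P \<Phi>' M', OF _ P] by auto
      qed
      have mem: "{I. stable_model A R D I} \<in> world_views P"
        unfolding world_views_def mem_Collect_eq using c max by (intro exI conjI)
      have uniq: "M = {I. stable_model A R D I}" if M: "M \<in> world_views P" for M
      proof -
        obtain \<Phi> where "cwv P \<Phi> M" using M by (auto simp: world_views_def)
        then show ?thesis by (rule cwv_prog(4)[OF _ P])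
      qed
      show ?thesis
      proof (intro set_eqI iffI)
        fix M assume "M \<in> world_views P"
        then have "M = {I. stable_model A R D I}" by (rule uniq)
        then show "M \<in> {{I. stable_model A R D I}}" by (rule ssubst) (rule singletonI)
      next
        fix M assume "M \<in> {{I. stable_model A R D I}}"
        then have "M = {I. stable_model A R D I}" by (rule singletonD)
        then show "M \<in> world_views P" using mem by (rule ssubst)
      qed
    qed
    then show ?thesis by metis
  qed
  then show "uniformly_WV_equivalent prog1 prog2"
    by (simp add: uniformly_WV_equivalent_def prog1_def)
qed

end

section \<open>The program simulating a Turing machine\<close>

definition cst :: "nat \<Rightarrow> ix" where "cst n = (n, [])"
definition var :: "nat \<Rightarrow> ix" where "var v = (0, [v])"

lemma ix_val_simps [simp]: "ix_val e (cst n) = n" "ix_val e (var v) = e ! v"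
  "ix_val e (n, vs) = n + sum_list (map ((!) e) vs)"
  by (simp_all add: ix_val_def cst_def var_def)

text \<open>
  An atom is the list of its tag and its arguments; \<open>gX\<close> are ground atoms and \<open>sX\<close> the corresponding
  schematic ones.
  \<^item> \<open>gN j\<close>, \<open>gA j\<close>: position \<open>j\<close> of \<open>y1\<close> is not blank, holds \<open>True\<close>; these are the input atoms
  \<^item> \<open>gE\<close>: the simulation is run; \<open>gB1\<close>, \<open>gB2\<close>: it is not run; \<open>gW\<close>: it accepts
  \<^item> \<open>gPre k j\<close>, \<open>gY k j s\<close>: the string \<open>yk\<close> has length at least \<open>j\<close>, has symbol \<open>s\<close> at position \<open>j\<close>
  \<^item> \<open>gU k i s\<close>, \<open>gEnd k l\<close>: the string \<open>uk\<close> has symbol \<open>s\<close> at position \<open>i\<close>, has length \<open>l\<close>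
  \<^item> \<open>gSt t q\<close>, \<open>gMv t \<tau> m\<close>, \<open>gWr t \<tau> g\<close>: state at time \<open>t\<close>, move and written symbol on tape \<open>\<tau>\<close>
  \<^item> \<open>gC t \<tau> g\<close>, \<open>gSide d t \<tau> i g\<close>: symbol scanned on tape \<open>\<tau>\<close>, symbol \<open>i + 1\<close> cells to the right
    (\<open>d\<close>) or to the left (\<open>\<not> d\<close>) of the head
\<close>

definition gN :: "nat \<Rightarrow> nat list" where "gN j = [0, j]"
definition gA :: "nat \<Rightarrow> nat list" where "gA j = [1, j]"
definition gE :: "nat list" where "gE = [2]"
definition gB1 :: "nat list" where "gB1 = [3]"
definition gB2 :: "nat list" where "gB2 = [4]"
definition gW :: "nat list" where "gW = [5]"
definition gPre :: "nat \<Rightarrow> nat \<Rightarrow> nat list" where "gPre k j = [10 + k, j]"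
definition gY :: "nat \<Rightarrow> nat \<Rightarrow> nat \<Rightarrow> nat list" where "gY k j s = [20 + k, j, s]"
definition gU :: "nat \<Rightarrow> nat \<Rightarrow> nat \<Rightarrow> nat list" where "gU k i s = [30 + k, i, s]"
definition gEnd :: "nat \<Rightarrow> nat \<Rightarrow> nat list" where "gEnd k l = [40 + k, l]"
definition gSt :: "nat \<Rightarrow> nat \<Rightarrow> nat list" where "gSt t q = [50, t, q]"
definition gC :: "nat \<Rightarrow> nat \<Rightarrow> nat \<Rightarrow> nat list" where "gC t \<tau> g = [51, t, \<tau>, g]"
definition gSide :: "bool \<Rightarrow> nat \<Rightarrow> nat \<Rightarrow> nat \<Rightarrow> nat \<Rightarrow> nat list" where
  "gSide d t \<tau> i g = [if d then 52 else 53, t, \<tau>, i, g]"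
definition gMv :: "nat \<Rightarrow> nat \<Rightarrow> nat \<Rightarrow> nat list" where "gMv t \<tau> m = [54, t, \<tau>, m]"
definition gWr :: "nat \<Rightarrow> nat \<Rightarrow> nat \<Rightarrow> nat list" where "gWr t \<tau> g = [55, t, \<tau>, g]"

definition sN :: "ix \<Rightarrow> ix list" where "sN j = [cst 0, j]"
definition sA :: "ix \<Rightarrow> ix list" where "sA j = [cst 1, j]"
definition sE :: "ix list" where "sE = [cst 2]"
definition sB1 :: "ix list" where "sB1 = [cst 3]"
definition sB2 :: "ix list" where "sB2 = [cst 4]"
definition sW :: "ix list" where "sW = [cst 5]"
definition sPre :: "nat \<Rightarrow> ix \<Rightarrow> ix list" where "sPre k j = [cst (10 + k), j]"
definition sY :: "nat \<Rightarrow> ix \<Rightarrow> nat \<Rightarrow> ix list" where "sY k j s = [cst (20 + k), j, cst s]"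
definition sU :: "nat \<Rightarrow> ix \<Rightarrow> ix \<Rightarrow> ix list" where "sU k i s = [cst (30 + k), i, s]"
definition sEnd :: "nat \<Rightarrow> ix \<Rightarrow> ix list" where "sEnd k l = [cst (40 + k), l]"
definition sSt :: "ix \<Rightarrow> nat \<Rightarrow> ix list" where "sSt t q = [cst 50, t, cst q]"
definition sC :: "ix \<Rightarrow> nat \<Rightarrow> nat \<Rightarrow> ix list" where "sC t \<tau> g = [cst 51, t, cst \<tau>, cst g]"
definition sSide :: "bool \<Rightarrow> ix \<Rightarrow> nat \<Rightarrow> ix \<Rightarrow> nat \<Rightarrow> ix list" where
  "sSide d t \<tau> i g = [cst (if d then 52 else 53), t, cst \<tau>, i, cst g]"
definition sMv :: "ix \<Rightarrow> nat \<Rightarrow> nat \<Rightarrow> ix list" where "sMv t \<tau> m = [cst 54, t, cst \<tau>, cst m]"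
definition sWr :: "ix \<Rightarrow> nat \<Rightarrow> nat \<Rightarrow> ix list" where "sWr t \<tau> g = [cst 55, t, cst \<tau>, cst g]"

lemmas g_defs = gN_def gA_def gE_def gB1_def gB2_def gW_def gPre_def gY_def gU_def gEnd_def
  gSt_def gC_def gSide_def gMv_def gWr_def

lemmas s_defs = sN_def sA_def sE_def sB1_def sB2_def sW_def sPre_def sY_def sU_def sEnd_def
  sSt_def sC_def sSide_def sMv_def sWr_def

lemma atom_val_simps [simp]:
  "atom_val e (sN j) = gN (ix_val e j)" "atom_val e (sA j) = gA (ix_val e j)"
  "atom_val e sE = gE" "atom_val e sB1 = gB1" "atom_val e sB2 = gB2" "atom_val e sW = gW"
  "atom_val e (sPre k j) = gPre k (ix_val e j)" "atom_val e (sY k j s) = gY k (ix_val e j) s"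
  "atom_val e (sU k j i) = gU k (ix_val e j) (ix_val e i)"
  "atom_val e (sEnd k j) = gEnd k (ix_val e j)" "atom_val e (sSt j q) = gSt (ix_val e j) q"
  "atom_val e (sC j \<tau> g) = gC (ix_val e j) \<tau> g"
  "atom_val e (sSide d j \<tau> i g) = gSide d (ix_val e j) \<tau> (ix_val e i) g"
  "atom_val e (sMv j \<tau> g) = gMv (ix_val e j) \<tau> g" "atom_val e (sWr j \<tau> g) = gWr (ix_val e j) \<tau> g"
  by (simp_all add: atom_val_def s_defs g_defs)

definition horn :: "'a \<Rightarrow> 'a list \<Rightarrow> 'a erule" where
  "horn h as = ERule [h] (map PosLit as) [] []"

lemma map_erule_horn [simp]: "map_erule f (horn h as) = horn (f h) (map f as)"
  by (simp add: horn_def)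

lemma rule_sat_horn [simp]: "rule_sat I J (horn h as) \<longleftrightarrow> ((\<forall>a \<in> set as. a \<in> J) \<longrightarrow> h \<in> J)"
  by (simp add: rule_sat_def horn_def)

lemma rule_sat_ERule [simp]:
  "rule_sat I J (ERule hs ls ps ns) \<longleftrightarrow>
    ((\<forall>l \<in> set ls. lit_sat I J l) \<longrightarrow> (\<exists>h \<in> set hs. h \<in> J))"
  by (simp add: rule_sat_def)

lemma ball_ground:
  "(\<forall>r \<in> set (ground f x S). P r) \<longleftrightarrow>
    (\<forall>s \<in> set S. \<forall>e \<in> set (schema_envs x (fst s) (fst (snd s))). P (f e (snd (snd s))))"
  by (fastforce simp: ground_def)

lemma schema_envs_False: "schema_envs x False bs = envs bs [length x]"
  by (simp add: schema_envs_def start_envs_def)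

lemma set_schema_envs_True:
  "set (schema_envs x True []) = (\<lambda>i. [length x, i, bit_symbol (x ! i)]) ` {..<length x}"
  by (auto simp: schema_envs_def start_envs_def)

lemma ball_lessThan: "(\<forall>i \<in> {..<n :: nat}. P i) \<longleftrightarrow> (\<forall>i < n. P i)"
  by auto

lemmas ground_simps = ball_ground schema_envs_False set_schema_envs_True ball_lessThan
  atLeast0LessThan ball_Un

fun move_num :: "move \<Rightarrow> nat" where
  "move_num MoveLeft = 0" | "move_num Stay = 1" | "move_num MoveRight = 2"

text \<open>The halting state is made to loop, so that every configuration has a successor.\<close>

definition total_trans :: "tm \<Rightarrow> nat \<Rightarrow> nat list \<Rightarrow> nat \<times> (nat \<times> move) list" where
  "total_trans M q gs = (if q = 1 then (1, keep gs) else trans M q gs)"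

text \<open>
  \<open>size_poly\<close> bounds all index ranges in terms of the length of the input, and
  \<open>quant_poly k\<close> is the length bound of quantifier number \<open>k\<close>.
\<close>

locale tableau =
  fixes M :: tm and size_poly :: "nat poly" and quant_poly :: "nat \<Rightarrow> nat poly"
  assumes tm: "is_tm M"
begin

text \<open>Variable \<open>0\<close> is the input length, variable \<open>1\<close> is bound to the
  common range, and variables \<open>2\<close> and \<open>3\<close> run below it.\<close>

abbreviation "rng1 \<equiv> [BLet size_poly 0, BFor 1]"
abbreviation "rng2 \<equiv> [BLet size_poly 0, BFor 1, BFor 1]"

text \<open>
  Two atoms for the trivial mode are needed: then each of them, and every atom of the simulation, is
  false in some stable model.
\<close>

definition base_schemas :: "ix list erule schema list" where
  "base_schemas = [(False, [], ERule [sB1, sB2, sE] [] [] [])]"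

text \<open>
  The three quantified strings. The first is read off the added facts, the other two are guessed
  symbol by symbol.
\<close>

definition guess_schemas :: "ix list erule schema list" where
  "guess_schemas =
    [(False, [], horn (sPre k (cst 0)) [sE]). k \<leftarrow> [1, 2, 3]] @
    [(False, rng1, ERule [sY k (var 2) 0, sY k (var 2) 1, sY k (var 2) 2]
      [PosLit (sPre k (var 2))] [] []). k \<leftarrow> [2, 3]] @
    [(False, rng1, ERule [sY 1 (var 2) 0] [PosLit (sPre 1 (var 2)), NegLit (sN (var 2))] [] []),
     (False, rng1, ERule [sY 1 (var 2) 1]
       [PosLit (sPre 1 (var 2)), PosLit (sN (var 2)), NegLit (sA (var 2))] [] []),
     (False, rng1, ERule [sY 1 (var 2) 2]
       [PosLit (sPre 1 (var 2)), PosLit (sN (var 2)), PosLit (sA (var 2))] [] [])] @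
    concat [[(False, rng1, horn (sPre k (1, [2])) [sY k (var 2) 1]),
      (False, rng1, horn (sPre k (1, [2])) [sY k (var 2) 2]),
      (False, rng1, horn (sY k (1, [2]) 0) [sY k (var 2) 0])]. k \<leftarrow> [1, 2, 3]]"

text \<open>The strings \<open>u 0 = x\<close> and \<open>u (k + 1) = pair_bits (u k) (y k)\<close>, cell by cell.\<close>

definition input_schemas :: "ix list erule schema list" where
  "input_schemas =
    [(True, [], horn (sU 0 (var 1) (var 2)) [sE]), (False, [], horn (sEnd 0 (var 0)) [sE])] @
    concat [concat [[(False, rng1, horn (sU (Suc k) (0, [2, 2]) (cst 2)) [sU k (var 2) (cst s)]),
      (False, rng1, horn (sU (Suc k) (1, [2, 2]) (cst s)) [sU k (var 2) (cst s)]),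
      (False, rng1, horn (sEnd (Suc k) (1, [2])) [sU (Suc k) (var 2) (cst s), sU (Suc k) (1, [2]) (cst 0)])].
        s \<leftarrow> [1, 2]] @
      [(False, rng1, horn (sU (Suc k) (0, [2, 2]) (cst 1)) [sEnd k (var 2)])] @
      [(False, [BLet size_poly 0, BFor 1, BLet (quant_poly k) 2, BFor 3],
        horn (sU (Suc k) (1, [2, 2, 4]) (cst s)) [sEnd k (var 2), sY (Suc k) (var 4) s]). s \<leftarrow> [0, 1, 2]] @
      [(False, [BLet size_poly 0, BFor 1, BLet (quant_poly k) 2, BFor 1],
        horn (sU (Suc k) (1, [2, 2, 3, 4]) (cst 0)) [sEnd k (var 2)])]. k \<leftarrow> [0, 1, 2]]"

definition init_schemas :: "ix list erule schema list" where
  "init_schemas =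
    [(False, [], horn (sSt (cst 0) 0) [sE])] @
    [(False, [], horn (sC (cst 0) 0 s) [sU 3 (cst 0) (cst s)]). s \<leftarrow> [0, 1, 2]] @
    [(False, rng1, horn (sSide True (cst 0) 0 (var 2) s) [sU 3 (1, [2]) (cst s)]). s \<leftarrow> [0, 1, 2]] @
    [(False, rng1, horn (sSide False (cst 0) \<tau> (var 2) 0) [sE]). \<tau> \<leftarrow> [0..<num_tapes M]] @
    [(False, [], horn (sC (cst 0) \<tau> 0) [sE]). \<tau> \<leftarrow> [1..<num_tapes M]] @
    [(False, rng1, horn (sSide True (cst 0) \<tau> (var 2) 0) [sE]). \<tau> \<leftarrow> [1..<num_tapes M]]"

definition local_body :: "nat \<Rightarrow> nat list \<Rightarrow> ix list list" where
  "local_body q gs = sSt (var 2) q # map (\<lambda>\<tau>. sC (var 2) \<tau> (gs ! \<tau>)) [0..<num_tapes M]"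

definition scans :: "nat list list" where
  "scans = List.n_lists (num_tapes M) [0..<num_syms M]"

text \<open>The machine is fixed, so its transition table can be unfolded: a constant number of
  schemas, one group for each state and each tuple of scanned symbols.\<close>

definition step_schemas :: "ix list erule schema list" where
  "step_schemas = concat [concat [(False, rng1,
        horn (sSt (1, [2]) (fst (total_trans M q gs))) (local_body q gs)) #
      concat [[(False, rng1,
          horn (sMv (var 2) \<tau> (move_num (snd (snd (total_trans M q gs) ! \<tau>)))) (local_body q gs)),
        (False, rng1, horn (sWr (var 2) \<tau> (fst (snd (total_trans M q gs) ! \<tau>))) (local_body q gs))].
        \<tau> \<leftarrow> [0..<num_tapes M]].
      gs \<leftarrow> scans]. q \<leftarrow> [0..<num_states M]]"

text \<open>The head stays at the origin and the tape moves. A move in direction \<open>d\<close>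
  scans the nearest cell of side \<open>d\<close>, draws this side one cell nearer, pushes the other
  side away and puts the written symbol in front of it. Moves \<open>0\<close>, \<open>1\<close>,
  \<open>2\<close> are left, stay, right.\<close>

definition shift_schemas :: "ix list erule schema list" where
  "shift_schemas = concat [concat [
      [(False, rng1, horn (sC (1, [2]) \<tau> g) [sMv (var 2) \<tau> 1, sWr (var 2) \<tau> g])] @
      concat [[(False, rng2, horn (sSide d (1, [2]) \<tau> (var 3) g) [sMv (var 2) \<tau> 1, sSide d (var 2) \<tau> (var 3) g]),
        (False, rng1, horn (sC (1, [2]) \<tau> g) [sMv (var 2) \<tau> (if d then 2 else 0), sSide d (var 2) \<tau> (cst 0) g]),
        (False, rng2, horn (sSide d (1, [2]) \<tau> (var 3) g)
          [sMv (var 2) \<tau> (if d then 2 else 0), sSide d (var 2) \<tau> (1, [3]) g]),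
        (False, rng1, horn (sSide (\<not> d) (1, [2]) \<tau> (cst 0) g)
          [sMv (var 2) \<tau> (if d then 2 else 0), sWr (var 2) \<tau> g]),
        (False, rng2, horn (sSide (\<not> d) (1, [2]) \<tau> (1, [3]) g)
          [sMv (var 2) \<tau> (if d then 2 else 0), sSide (\<not> d) (var 2) \<tau> (var 3) g])]. d \<leftarrow> [True, False]].
      g \<leftarrow> [0..<num_syms M]]. \<tau> \<leftarrow> [0..<num_tapes M]]"

text \<open>The final contents of the output tape is one bit, so the symbol \<open>2\<close> occurs on it iff the bit is \<open>True\<close>.\<close>

definition accept_schemas :: "ix list erule schema list" where
  "accept_schemas = (False, rng1, horn sW [sSt (var 2) 1, sC (var 2) 1 2]) #
    [(False, rng2, horn sW [sSt (var 2) 1, sSide d (var 2) 1 (var 3) 2]). d \<leftarrow> [True, False]]"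

definition schemas :: "ix list erule schema list" where
  "schemas = base_schemas @ guess_schemas @ input_schemas @ init_schemas @ step_schemas @
    shift_schemas @ accept_schemas"

section \<open>Closure under the ground instances\<close>

abbreviation "ground_rules x S \<equiv> set (ground (\<lambda>e. map_erule (atom_val e)) x S)"

abbreviation "bnd x \<equiv> poly size_poly (length x)"

definition closed :: "bits \<Rightarrow> nat list set \<Rightarrow> nat list set \<Rightarrow> ix list erule schema list \<Rightarrow> bool" where
  "closed x I J S \<longleftrightarrow> (\<forall>r \<in> ground_rules x S. rule_sat I J r)"

lemma closed_append [simp]: "closed x I J (S @ S') \<longleftrightarrow> closed x I J S \<and> closed x I J S'"
  by (simp add: closed_def ball_ground ball_Un)

lemma closed_base: "closed x I J base_schemas \<longleftrightarrow> gB1 \<in> J \<or> gB2 \<in> J \<or> gE \<in> J"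
  by (simp add: closed_def ground_simps base_schemas_def)

lemma closed_guess: "closed x I J guess_schemas \<longleftrightarrow>
    (\<forall>k \<in> {1, 2, 3}. gE \<in> J \<longrightarrow> gPre k 0 \<in> J) \<and>
    (\<forall>k \<in> {2, 3}. \<forall>j < bnd x. gPre k j \<in> J \<longrightarrow> gY k j 0 \<in> J \<or> gY k j 1 \<in> J \<or> gY k j 2 \<in> J) \<and>
    (\<forall>j < bnd x. gPre 1 j \<in> J \<and> gN j \<notin> I \<longrightarrow> gY 1 j 0 \<in> J) \<and>
    (\<forall>j < bnd x. gPre 1 j \<in> J \<and> gN j \<in> J \<and> gA j \<notin> I \<longrightarrow> gY 1 j 1 \<in> J) \<and>
    (\<forall>j < bnd x. gPre 1 j \<in> J \<and> gN j \<in> J \<and> gA j \<in> J \<longrightarrow> gY 1 j 2 \<in> J) \<and>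
    (\<forall>k \<in> {1, 2, 3}. \<forall>j < bnd x. (gY k j 1 \<in> J \<longrightarrow> gPre k (Suc j) \<in> J) \<and>
      (gY k j 2 \<in> J \<longrightarrow> gPre k (Suc j) \<in> J) \<and> (gY k j 0 \<in> J \<longrightarrow> gY k (Suc j) 0 \<in> J))"
  unfolding closed_def guess_schemas_def
  by (simp add: ground_simps all_conj_distrib imp_conjR)

lemma closed_input: "closed x I J input_schemas \<longleftrightarrow>
    (gE \<in> J \<longrightarrow> (\<forall>i < length x. gU 0 i (bit_symbol (x ! i)) \<in> J)) \<and>
    (gE \<in> J \<longrightarrow> gEnd 0 (length x) \<in> J) \<and>
    (\<forall>k \<in> {0, 1, 2}. (\<forall>s \<in> {1, 2}. \<forall>i < bnd x.
        (gU k i s \<in> J \<longrightarrow> gU (Suc k) (i + i) 2 \<in> J)) \<and>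
      (\<forall>s \<in> {1, 2}. \<forall>i < bnd x. gU k i s \<in> J \<longrightarrow> gU (Suc k) (Suc (i + i)) s \<in> J) \<and>
      (\<forall>s \<in> {1, 2}. \<forall>i < bnd x. gU (Suc k) i s \<in> J \<and> gU (Suc k) (Suc i) 0 \<in> J \<longrightarrow>
        gEnd (Suc k) (Suc i) \<in> J) \<and>
      (\<forall>l < bnd x. gEnd k l \<in> J \<longrightarrow> gU (Suc k) (l + l) 1 \<in> J) \<and>
      (\<forall>s \<in> {0, 1, 2}. \<forall>l < bnd x. \<forall>j < poly (quant_poly k) l. gEnd k l \<in> J \<and> gY (Suc k) j s \<in> J \<longrightarrow>
        gU (Suc k) (Suc (l + (l + j))) s \<in> J) \<and>
      (\<forall>l < bnd x. gEnd k l \<in> J \<longrightarrow>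
        (\<forall>i < bnd x. gU (Suc k) (Suc (l + (l + (poly (quant_poly k) l + i)))) 0 \<in> J)))"
  unfolding closed_def input_schemas_def
  by (simp add: ground_simps all_conj_distrib imp_conjR)
    (rule iffI; elim conjE; intro conjI; assumption)

lemma closed_init: "closed x I J init_schemas \<longleftrightarrow>
    (gE \<in> J \<longrightarrow> gSt 0 0 \<in> J) \<and>
    (\<forall>s \<in> {0, 1, 2}. gU 3 0 s \<in> J \<longrightarrow> gC 0 0 s \<in> J) \<and>
    (\<forall>s \<in> {0, 1, 2}. \<forall>i < bnd x. gU 3 (Suc i) s \<in> J \<longrightarrow> gSide True 0 0 i s \<in> J) \<and>
    (gE \<in> J \<longrightarrow> (\<forall>\<tau> < num_tapes M. \<forall>i < bnd x. gSide False 0 \<tau> i 0 \<in> J)) \<and>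
    (gE \<in> J \<longrightarrow> (\<forall>\<tau> \<in> {1..<num_tapes M}. gC 0 \<tau> 0 \<in> J)) \<and>
    (gE \<in> J \<longrightarrow> (\<forall>\<tau> \<in> {1..<num_tapes M}. \<forall>i < bnd x. gSide True 0 \<tau> i 0 \<in> J))"
  unfolding closed_def init_schemas_def
  by (simp add: ground_simps all_conj_distrib imp_conjR)

lemma closed_step: "closed x I J step_schemas \<longleftrightarrow>
    (\<forall>q < num_states M. \<forall>gs. length gs = num_tapes M \<and> set gs \<subseteq> {..<num_syms M} \<longrightarrow>
      (\<forall>t < bnd x. gSt t q \<in> J \<and> (\<forall>\<tau> < num_tapes M. gC t \<tau> (gs ! \<tau>) \<in> J) \<longrightarrow>
        gSt (Suc t) (fst (total_trans M q gs)) \<in> J \<and>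
        (\<forall>\<tau> < num_tapes M. gMv t \<tau> (move_num (snd (snd (total_trans M q gs) ! \<tau>))) \<in> J \<and>
          gWr t \<tau> (fst (snd (total_trans M q gs) ! \<tau>)) \<in> J)))"
proof -
  have "(\<forall>gs \<in> set scans. P gs) \<longleftrightarrow>
      (\<forall>gs. length gs = num_tapes M \<and> set gs \<subseteq> {..<num_syms M} \<longrightarrow> P gs)" for P
    by (auto simp: scans_def set_n_lists atLeast0LessThan)
  then show ?thesis
    unfolding closed_def step_schemas_def
    by (simp add: ground_simps local_body_def) blast
qed

lemma closed_shift: "closed x I J shift_schemas \<longleftrightarrow>
    (\<forall>\<tau> < num_tapes M. \<forall>g < num_syms M.
      (\<forall>t < bnd x. gMv t \<tau> 1 \<in> J \<and> gWr t \<tau> g \<in> J \<longrightarrow> gC (Suc t) \<tau> g \<in> J) \<and>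
      (\<forall>d. (\<forall>t < bnd x. \<forall>i < bnd x. gMv t \<tau> 1 \<in> J \<and> gSide d t \<tau> i g \<in> J \<longrightarrow> gSide d (Suc t) \<tau> i g \<in> J) \<and>
        (\<forall>t < bnd x. gMv t \<tau> (if d then 2 else 0) \<in> J \<and> gSide d t \<tau> 0 g \<in> J \<longrightarrow> gC (Suc t) \<tau> g \<in> J) \<and>
        (\<forall>t < bnd x. \<forall>i < bnd x. gMv t \<tau> (if d then 2 else 0) \<in> J \<and> gSide d t \<tau> (Suc i) g \<in> J \<longrightarrow>
          gSide d (Suc t) \<tau> i g \<in> J) \<and>
        (\<forall>t < bnd x. gMv t \<tau> (if d then 2 else 0) \<in> J \<and> gWr t \<tau> g \<in> J \<longrightarrow> gSide (\<not> d) (Suc t) \<tau> 0 g \<in> J) \<and>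
        (\<forall>t < bnd x. \<forall>i < bnd x. gMv t \<tau> (if d then 2 else 0) \<in> J \<and> gSide (\<not> d) t \<tau> i g \<in> J \<longrightarrow>
          gSide (\<not> d) (Suc t) \<tau> (Suc i) g \<in> J)))"
  unfolding closed_def shift_schemas_def
  by (simp add: ground_simps all_bool_eq)

lemma closed_accept: "closed x I J accept_schemas \<longleftrightarrow>
    (\<forall>t < bnd x. gSt t 1 \<in> J \<and> gC t 1 2 \<in> J \<longrightarrow> gW \<in> J) \<and>
    (\<forall>d. \<forall>t < bnd x. \<forall>i < bnd x. gSt t 1 \<in> J \<and> gSide d t 1 i 2 \<in> J \<longrightarrow> gW \<in> J)"
  unfolding closed_def accept_schemas_def
  by (simp add: ground_simps all_bool_eq) auto

text \<open>Collects what is used of the rules apart from their meaning. Heads have no input tag, so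
  input atoms come from facts only. Every rule except the base rule has a positive body atom with
  tag outside \<open>{0, 1, 3, 4}\<close>, so it is satisfied by any set of input atoms,
  \<open>gB1\<close> and \<open>gB2\<close>. Tags are constants, which permits selecting atoms by
  tag before grounding.\<close>

definition schema_shape :: "ix list erule schema \<Rightarrow> bool" where
  "schema_shape s \<longleftrightarrow> schema_ok erule_atoms s \<and>
    erule_epos (snd (snd s)) = [] \<and> erule_eneg (snd (snd s)) = [] \<and>
    (\<forall>a \<in> set (erule_atoms (snd (snd s))). a \<noteq> [] \<and> snd (hd a) = []) \<and>
    (\<forall>a \<in> set (erule_head (snd (snd s))). fst (hd a) \<ge> 2) \<and>
    (s \<in> set base_schemas \<or>
      (\<exists>a. PosLit a \<in> set (erule_lits (snd (snd s))) \<and> fst (hd a) \<notin> {0, 1, 3, 4}))"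

lemma schema_shape_iff:
  "schema_shape (inp, bs, r) \<longleftrightarrow> binders_ok (start_depth inp) bs \<and>
    erule_epos r = [] \<and> erule_eneg r = [] \<and>
    (\<forall>a \<in> set (erule_atoms r). atom_vars a \<subseteq> {..<start_depth inp + length bs} \<and> a \<noteq> [] \<and> snd (hd a) = []) \<and>
    (\<forall>a \<in> set (erule_head r). fst (hd a) \<ge> 2) \<and>
    ((inp, bs, r) \<in> set base_schemas \<or>
      (\<exists>a. PosLit a \<in> set (erule_lits r) \<and> fst (hd a) \<notin> {0, 1, 3, 4}))"
  by (auto simp: schema_shape_def)

lemma atom_vars_simps:
  "atom_vars [] = {}" "atom_vars (i # a) = set (snd i) \<union> atom_vars a"
  by (auto simp: atom_vars_def)

lemma schema_shape_schemas: "\<forall>s \<in> set schemas. schema_shape s"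
proof -
  note shape = schema_shape_iff erule_atoms_def horn_def s_defs cst_def var_def atom_vars_simps
    start_depth_def ball_Un ex_disj_distrib conj_disj_distribR
  have "\<forall>s \<in> set base_schemas. schema_shape s"
    by (simp add: base_schemas_def shape)
  moreover have "\<forall>s \<in> set guess_schemas. schema_shape s"
    unfolding guess_schemas_def by (simp add: shape)
  moreover have "\<forall>s \<in> set input_schemas. schema_shape s"
    unfolding input_schemas_def by (simp add: shape)
  moreover have "\<forall>s \<in> set init_schemas. schema_shape s"
    unfolding init_schemas_def by (simp add: shape)
  moreover have "\<forall>s \<in> set step_schemas. schema_shape s"
    unfolding step_schemas_def local_body_def by (simp add: shape)
  moreover have "\<forall>s \<in> set shift_schemas. schema_shape s"
    unfolding shift_schemas_def by (simp add: shape)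
  moreover have "\<forall>s \<in> set accept_schemas. schema_shape s"
    unfolding accept_schemas_def by (simp add: shape)
  ultimately show ?thesis by (simp only: schemas_def set_append ball_Un)
qed

end

section \<open>Correctness of the simulation\<close>

definition sym_at :: "bits \<Rightarrow> nat \<Rightarrow> nat" where
  "sym_at w i = bits_tape w (int i)"

lemma sym_eq: "sym_at w i = (if i < length w then bit_symbol (w ! i) else 0)"
  by (simp add: sym_at_def bits_tape_def bit_symbol_def)

lemma sym_cases: "sym_at w i = 0 \<or> sym_at w i = 1 \<or> sym_at w i = 2"
  by (auto simp: sym_eq bit_symbol_def)

lemma sym_eq_0_iff: "sym_at w i = 0 \<longleftrightarrow> length w \<le> i"
  by (auto simp: sym_eq bit_symbol_def)

lemma sym_append: "sym_at (u @ w) (length u + j) = sym_at w j"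
  by (auto simp: sym_eq nth_append)

lemma sym_take: "j < p \<Longrightarrow> sym_at (take p w) j = sym_at w j"
  by (auto simp: sym_eq)

lemma length_enc_bits: "length (enc_bits w) = Suc (length w + length w)"
  by (induction w) (auto simp: enc_bits_double double_def)

lemma nth_double:
  "i < length w \<Longrightarrow> double w ! (i + i) = True \<and> double w ! Suc (i + i) = w ! i"
proof (induction w arbitrary: i)
  case (Cons b w)
  then show ?case by (cases i) (auto simp: double_def)
qed simp

lemma length_double: "length (double w) = length w + length w"
  by (induction w) (auto simp: double_def)

lemma length_pair_bits: "length (pair_bits w z) = Suc (length w + length w + length z)"
  by (simp add: pair_bits_def length_enc_bits)

text \<open>Immediate from \<open>enc_bits w = double w @ [False]\<close>; each equation corresponds
  to one kind of rule in \<open>input_schemas\<close>. The last one holds for every \<open>j\<close>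
  and so covers the blanks behind \<open>z\<close>.\<close>

lemma sym_pair_bits:
  "i < length w \<Longrightarrow> sym_at (pair_bits w z) (i + i) = 2"
  "i < length w \<Longrightarrow> sym_at (pair_bits w z) (Suc (i + i)) = sym_at w i"
  "sym_at (pair_bits w z) (length w + length w) = 1"
  "sym_at (pair_bits w z) (Suc (length w + (length w + j))) = sym_at z j"
proof -
  show "sym_at (pair_bits w z) (i + i) = 2" if "i < length w"
    using that nth_double[OF that]
    by (simp add: sym_eq pair_bits_def enc_bits_double nth_append length_double bit_symbol_def)
  show "sym_at (pair_bits w z) (Suc (i + i)) = sym_at w i" if "i < length w"
    using that nth_double[OF that]
    by (simp add: sym_eq pair_bits_def enc_bits_double nth_append length_double bit_symbol_def)
  show "sym_at (pair_bits w z) (length w + length w) = 1"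
    by (simp add: sym_eq pair_bits_def enc_bits_double nth_append length_double bit_symbol_def)
  show "sym_at (pair_bits w z) (Suc (length w + (length w + j))) = sym_at z j"
    using sym_append[of "enc_bits w" z j] by (simp add: pair_bits_def length_enc_bits add.assoc)
qed

fun move_int :: "move \<Rightarrow> int" where
  "move_int MoveLeft = - 1" | "move_int Stay = 0" | "move_int MoveRight = 1"

lemma move_head_eq: "move_head m i = i + move_int m"
  by (cases m) auto

text \<open>The tags \<open>12\<close> and \<open>22\<close> of \<open>gPre 2\<close> and \<open>gY 2\<close> are excluded: the guess of \<open>y2\<close> is not saturated.\<close>

definition sat_tag :: "nat \<Rightarrow> bool" where
  "sat_tag c \<longleftrightarrow> c \<notin> {0, 1, 2, 3, 4, 5, 12, 22}"

text \<open>Each finite set of facts denotes a string, since reading stops at the first missing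
  \<open>gN j\<close>. No set of input facts has to be excluded.\<close>

definition decode :: "nat list set \<Rightarrow> bits" where
  "decode D = map (\<lambda>j. gA j \<in> D) [0..<LEAST j. gN j \<notin> D]"

lemma finite_ex_gN_notin: "finite D \<Longrightarrow> \<exists>j. gN j \<notin> D"
proof (rule ccontr)
  assume "finite D" "\<nexists>j. gN j \<notin> D"
  then have "finite (range gN)" by (auto intro: finite_subset)
  moreover have "inj gN" by (auto simp: inj_def gN_def)
  ultimately show False using range_inj_infinite by blast
qed

lemma length_decode: "length (decode D) = (LEAST j. gN j \<notin> D)"
  by (simp add: decode_def)

lemma decode_props:
  assumes "finite D"
  shows "gN (length (decode D)) \<notin> D" "j < length (decode D) \<Longrightarrow> gN j \<in> D"
    "j < length (decode D) \<Longrightarrow> decode D ! j \<longleftrightarrow> gA j \<in> D"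
proof -
  show "gN (length (decode D)) \<notin> D"
    unfolding length_decode using LeastI_ex[OF finite_ex_gN_notin[OF assms]] .
  show "j < length (decode D) \<Longrightarrow> gN j \<in> D"
    unfolding length_decode using not_less_Least by blast
  show "j < length (decode D) \<Longrightarrow> decode D ! j \<longleftrightarrow> gA j \<in> D"
    by (simp add: decode_def)
qed

definition off :: "bool \<Rightarrow> nat \<Rightarrow> int" where
  "off d i = (if d then 1 + int i else - 1 - int i)"

section \<open>The run in coordinates relative to the head\<close>

context tableau
begin

text \<open>Truncating makes every assignment of strings admissible, so quantifiers over these
  strings need no length bound. The rules do the same by writing blanks behind the allowed
  positions.\<close>

fun ustr :: "bits \<Rightarrow> (nat \<Rightarrow> bits) \<Rightarrow> nat \<Rightarrow> bits" where
  "ustr x v 0 = x"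
| "ustr x v (Suc k) = pair_bits (ustr x v k) (take (poly (quant_poly k) (length (ustr x v k))) (v (Suc k)))"

definition cfg :: "bits \<Rightarrow> nat \<Rightarrow> config" where
  "cfg w t = (tm_step M ^^ t) (tm_init M w)"

definition act :: "bits \<Rightarrow> nat \<Rightarrow> (nat \<times> move) list" where
  "act w t = snd (total_trans M (fst (cfg w t)) (map tape_read (snd (cfg w t))))"

definition cell :: "bits \<Rightarrow> nat \<Rightarrow> nat \<Rightarrow> int \<Rightarrow> nat" where
  "cell w t \<tau> z = fst (snd (cfg w t) ! \<tau>) (snd (snd (cfg w t) ! \<tau>) + z)"

lemma cfg_Suc:
  "cfg w (Suc t) = (fst (total_trans M (fst (cfg w t)) (map tape_read (snd (cfg w t)))),
    map2 tape_act (act w t) (snd (cfg w t)))"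
  by (cases "cfg w t")
    (auto simp: cfg_def act_def total_trans_def split: prod.splits)

text \<open>Legal symbols make the transition schemas applicable; the bound on the head position
  later locates the output bit within the derived part of the tableau.\<close>

definition cfg_ok :: "nat \<Rightarrow> config \<Rightarrow> bool" where
  "cfg_ok t c \<longleftrightarrow> fst c < num_states M \<and> length (snd c) = num_tapes M \<and>
    (\<forall>\<tau> < num_tapes M. (\<forall>z. fst (snd c ! \<tau>) z < num_syms M) \<and> \<bar>snd (snd c ! \<tau>)\<bar> \<le> int t)"

lemma tape_read_eq: "tape_read T = fst T (snd T)"
  by (cases T) simp

lemma cfg_ok_reads:
  assumes "cfg_ok t c"
  shows "length (map tape_read (snd c)) = num_tapes M" "set (map tape_read (snd c)) \<subseteq> {..<num_syms M}"
proof -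
  show "length (map tape_read (snd c)) = num_tapes M" using assms by (simp add: cfg_ok_def)
  have "tape_read (snd c ! \<tau>) < num_syms M" if "\<tau> < num_tapes M" for \<tau>
    using assms that by (simp add: cfg_ok_def tape_read_eq)
  then show "set (map tape_read (snd c)) \<subseteq> {..<num_syms M}"
    using assms by (fastforce simp: cfg_ok_def in_set_conv_nth simp del: tape_read.simps)
qed

lemma total_trans_ok:
  assumes "q < num_states M" "length gs = num_tapes M" "set gs \<subseteq> {..<num_syms M}"
  shows "fst (total_trans M q gs) < num_states M" "length (snd (total_trans M q gs)) = num_tapes M"
    "fst ` set (snd (total_trans M q gs)) \<subseteq> {..<num_syms M}"
  using tm assms by (auto simp: is_tm_def total_trans_def keep_def)

lemma tape_act_eq:
  "fst (tape_act a T) = (fst T)(snd T := fst a)" "snd (tape_act a T) = snd T + move_int (snd a)"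
  by (cases a; cases T; simp add: move_head_eq)+

lemma cfg_ok: "cfg_ok t (cfg w t)"
proof (induction t)
  case 0
  have "num_tapes M \<ge> 2" "num_syms M \<ge> 3" "num_states M \<ge> 2" using tm by (auto simp: is_tm_def)
  then show ?case
    by (auto simp: cfg_ok_def cfg_def tm_init_def nth_Cons bits_tape_def split: nat.splits)
next
  case (Suc t)
  let ?tt = "total_trans M (fst (cfg w t)) (map tape_read (snd (cfg w t)))"
  have q: "fst (cfg w t) < num_states M" using Suc by (simp add: cfg_ok_def)
  note tt = total_trans_ok[OF q cfg_ok_reads[OF Suc]]
  have len: "length (act w t) = num_tapes M" using tt(2) by (simp add: act_def)
  have len': "length (snd (cfg w t)) = num_tapes M" using Suc by (simp add: cfg_ok_def)
  have "(\<forall>z. fst (map2 tape_act (act w t) (snd (cfg w t)) ! \<tau>) z < num_syms M) \<and>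
      \<bar>snd (map2 tape_act (act w t) (snd (cfg w t)) ! \<tau>)\<bar> \<le> int (Suc t)" if \<tau>: "\<tau> < num_tapes M" for \<tau>
  proof -
    have "fst (act w t ! \<tau>) \<in> fst ` set (act w t)" using \<tau> len by auto
    then have "fst (act w t ! \<tau>) < num_syms M" using tt(3) by (auto simp: act_def)
    moreover have "\<bar>snd (snd (cfg w t) ! \<tau>) + move_int (snd (act w t ! \<tau>))\<bar> \<le> int (Suc t)"
    proof -
      have "\<bar>move_int (snd (act w t ! \<tau>))\<bar> \<le> 1" by (cases "snd (act w t ! \<tau>)") auto
      moreover have "\<bar>snd (snd (cfg w t) ! \<tau>)\<bar> \<le> int t" using Suc \<tau> by (simp add: cfg_ok_def)
      ultimately show ?thesis
        using abs_triangle_ineq[of "snd (snd (cfg w t) ! \<tau>)" "move_int (snd (act w t ! \<tau>))"]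
        unfolding of_nat_Suc by linarith
    qed
    ultimately show ?thesis using Suc \<tau> len len' by (simp add: cfg_ok_def tape_act_eq)
  qed
  then show ?case using tt(1) len len' by (simp add: cfg_ok_def cfg_Suc)
qed

lemma length_act: "length (act w t) = num_tapes M"
  using total_trans_ok(2)[OF _ cfg_ok_reads[OF cfg_ok]] cfg_ok[of t w]
  by (simp add: act_def cfg_ok_def)

text \<open>Distances are measured from the new head position, so the old distance is larger by the
  move; old distance \<open>0\<close> is the cell just written.\<close>

lemma cell_Suc:
  assumes "\<tau> < num_tapes M"
  shows "cell w (Suc t) \<tau> z = (if z + move_int (snd (act w t ! \<tau>)) = 0 then fst (act w t ! \<tau>)
    else cell w t \<tau> (z + move_int (snd (act w t ! \<tau>))))"
  using assms length_act[of w t] cfg_ok[of t w]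
  by (auto simp: cell_def cfg_Suc cfg_ok_def tape_act_eq algebra_simps)

lemma cell_Stay:
  assumes "\<tau> < num_tapes M" "snd (act w t ! \<tau>) = Stay"
  shows "cell w (Suc t) \<tau> 0 = fst (act w t ! \<tau>)"
    "cell w (Suc t) \<tau> (off d i) = cell w t \<tau> (off d i)"
  using assms by (auto simp: cell_Suc off_def)

lemma cell_shift:
  assumes "\<tau> < num_tapes M" "snd (act w t ! \<tau>) = (if d then MoveRight else MoveLeft)"
  shows "cell w (Suc t) \<tau> 0 = cell w t \<tau> (off d 0)"
    "cell w (Suc t) \<tau> (off d i) = cell w t \<tau> (off d (Suc i))"
    "cell w (Suc t) \<tau> (off (\<not> d) 0) = fst (act w t ! \<tau>)"
    "cell w (Suc t) \<tau> (off (\<not> d) (Suc i)) = cell w t \<tau> (off (\<not> d) i)"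
proof -
  define m where "m = move_int (snd (act w t ! \<tau>))"
  have m: "m = (if d then 1 else - 1)" using assms(2) by (simp add: m_def)
  note step = cell_Suc[OF assms(1), of w t, folded m_def]
  have "off d 0 = m" "off d i + m = off d (Suc i)" "off (\<not> d) 0 + m = 0"
    "off (\<not> d) (Suc i) + m = off (\<not> d) i" "m \<noteq> 0"
    by (auto simp: off_def m)
  moreover have "off d' i' \<noteq> 0" for d' i' by (auto simp: off_def)
  ultimately show "cell w (Suc t) \<tau> 0 = cell w t \<tau> (off d 0)"
    "cell w (Suc t) \<tau> (off d i) = cell w t \<tau> (off d (Suc i))"
    "cell w (Suc t) \<tau> (off (\<not> d) 0) = fst (act w t ! \<tau>)"
    "cell w (Suc t) \<tau> (off (\<not> d) (Suc i)) = cell w t \<tau> (off (\<not> d) i)"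
    by (simp_all only: step add_0 if_True if_False simp_thms)
qed

lemma cell_less: "\<tau> < num_tapes M \<Longrightarrow> cell w t \<tau> z < num_syms M"
  using cfg_ok[of t w] by (simp add: cell_def cfg_ok_def)

lemma reads_eq_iff:
  assumes "length gs = num_tapes M"
  shows "map tape_read (snd (cfg w t)) = gs \<longleftrightarrow> (\<forall>\<tau> < num_tapes M. cell w t \<tau> 0 = gs ! \<tau>)"
  using assms cfg_ok[of t w] by (auto simp: list_eq_iff_nth_eq cell_def cfg_ok_def tape_read_eq)

lemma cell_0:
  assumes "\<tau> < num_tapes M"
  shows "cell w 0 \<tau> z = (if \<tau> = 0 then bits_tape w z else 0)"
  using assms by (cases \<tau>) (auto simp: cell_def cfg_def tm_init_def bits_tape_def)

lemma halted: "fst (cfg w t) = 1 \<Longrightarrow> cfg w (t + n) = cfg w t"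
proof (induction n)
  case (Suc n)
  have "cfg w (Suc (t + n)) = tm_step M (cfg w (t + n))" by (simp add: cfg_def)
  then show ?case using Suc by (cases "cfg w t") simp
qed simp

lemma halted_unique: "fst (cfg w t) = 1 \<Longrightarrow> fst (cfg w t') = 1 \<Longrightarrow> cfg w t = cfg w t'"
  using halted[of w t "t' - t"] halted[of w t' "t - t'"] by (cases "t \<le> t'") auto

text \<open>The atoms describing the run on the strings \<open>v\<close>, without \<open>gW\<close>.
  Position \<open>bnd x\<close> of a string is special: the rules reach it only by propagating a
  blank from the position before, hence the condition that the string is shorter than
  \<open>bnd x\<close>.\<close>

definition tru :: "bits \<Rightarrow> (nat \<Rightarrow> bits) \<Rightarrow> nat list \<Rightarrow> bool" where
  "tru x v a \<longleftrightarrow> a = gE \<or>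
    (\<exists>k j. k \<in> {1, 2, 3} \<and> a = gPre k j \<and> j \<le> length (v k) \<and> j \<le> bnd x) \<or>
    (\<exists>k j. k \<in> {1, 2, 3} \<and> a = gY k j (sym_at (v k) j) \<and> (j < bnd x \<or> j = bnd x \<and> length (v k) < bnd x)) \<or>
    (\<exists>k i. k \<le> 3 \<and> a = gU k i (sym_at (ustr x v k) i)) \<or>
    (\<exists>k. k \<le> 3 \<and> a = gEnd k (length (ustr x v k))) \<or>
    (\<exists>t. a = gSt t (fst (cfg (ustr x v 3) t))) \<or>
    (\<exists>t \<tau>. \<tau> < num_tapes M \<and> a = gC t \<tau> (cell (ustr x v 3) t \<tau> 0)) \<or>
    (\<exists>d t \<tau> i. \<tau> < num_tapes M \<and>
      a = gSide d t \<tau> i (cell (ustr x v 3) t \<tau> (off d i))) \<or>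
    (\<exists>t \<tau>. \<tau> < num_tapes M \<and> a = gMv t \<tau> (move_num (snd (act (ustr x v 3) t ! \<tau>)))) \<or>
    (\<exists>t \<tau>. \<tau> < num_tapes M \<and> a = gWr t \<tau> (fst (act (ustr x v 3) t ! \<tau>)))"

lemma tru_simps:
  "\<not> tru x v (gN j)" "\<not> tru x v (gA j)" "tru x v gE" "\<not> tru x v gB1" "\<not> tru x v gB2" "\<not> tru x v gW"
  "k \<in> {1, 2, 3} \<Longrightarrow> tru x v (gPre k j) \<longleftrightarrow> j \<le> length (v k) \<and> j \<le> bnd x"
  "k \<in> {1, 2, 3} \<Longrightarrow> tru x v (gY k j s) \<longleftrightarrow>
    s = sym_at (v k) j \<and> (j < bnd x \<or> j = bnd x \<and> length (v k) < bnd x)"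
  "k \<le> 3 \<Longrightarrow> tru x v (gU k i s) \<longleftrightarrow> s = sym_at (ustr x v k) i"
  "k \<le> 3 \<Longrightarrow> tru x v (gEnd k l) \<longleftrightarrow> l = length (ustr x v k)"
  "tru x v (gSt t q) \<longleftrightarrow> q = fst (cfg (ustr x v 3) t)"
  "tru x v (gC t \<tau> g) \<longleftrightarrow> \<tau> < num_tapes M \<and> g = cell (ustr x v 3) t \<tau> 0"
  "tru x v (gSide d t \<tau> i g) \<longleftrightarrow> \<tau> < num_tapes M \<and>
    g = cell (ustr x v 3) t \<tau> (off d i)"
  "tru x v (gMv t \<tau> m) \<longleftrightarrow> \<tau> < num_tapes M \<and> m = move_num (snd (act (ustr x v 3) t ! \<tau>))"
  "tru x v (gWr t \<tau> g) \<longleftrightarrow> \<tau> < num_tapes M \<and> g = fst (act (ustr x v 3) t ! \<tau>)"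
  unfolding tru_def g_defs by (auto simp del: ustr.simps)

end

section \<open>Closed sets and the run of the machine\<close>

context tableau
begin

definition rules0 :: "bits \<Rightarrow> nat list erule set" where
  "rules0 x = ground_rules x schemas"

definition atoms :: "bits \<Rightarrow> nat list set" where
  "atoms x = (\<Union>r \<in> rules0 x. set (erule_atoms r))"

definition inputs :: "bits \<Rightarrow> nat list set" where
  "inputs x = {a \<in> atoms x. hd a < 2}"

lemma hd_atom_val: "a \<noteq> [] \<Longrightarrow> snd (hd a) = [] \<Longrightarrow> hd (atom_val e a) = fst (hd a)"
  by (cases a) (auto simp: atom_val_def ix_val_def)

lemma lit_atom_map_lit: "lit_atom (map_lit f l) = f (lit_atom l)"
  by (cases l) auto

lemma elit_atom_map_elit: "lit_atom (elit_lit (map_elit f l)) = f (lit_atom (elit_lit l))"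
  by (cases l) (auto simp: lit_atom_map_lit)

lemma erule_atoms_map_erule: "erule_atoms (map_erule f r) = map f (erule_atoms r)"
  by (cases r) (auto simp: erule_atoms_def lit_atom_map_lit elit_atom_map_elit)

lemma rules0_shape:
  assumes "r \<in> rules0 x"
  shows "erule_epos r = []" "erule_eneg r = []" "\<forall>a \<in> set (erule_head r). hd a \<ge> 2"
    "r = ERule [gB1, gB2, gE] [] [] [] \<or> (\<exists>a. PosLit a \<in> set (erule_lits r) \<and> hd a \<notin> {0, 1, 3, 4})"
proof -
  obtain s e where s: "s \<in> set schemas" and r: "r = map_erule (atom_val e) (snd (snd s))"
    using assms by (auto simp: rules0_def ground_def)
  let ?r = "snd (snd s)"
  have shape: "schema_shape s" using s schema_shape_schemas by blast
  show "erule_epos r = []" "erule_eneg r = []"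
    using shape by (auto simp: r schema_shape_def erule.map_sel)
  have hd: "hd (atom_val e a) = fst (hd a)" if "a \<in> set (erule_atoms ?r)" for a
    using that shape by (intro hd_atom_val) (auto simp: schema_shape_def)
  show "\<forall>a \<in> set (erule_head r). hd a \<ge> 2"
    using shape hd by (auto simp: r schema_shape_def erule.map_sel erule_atoms_def)
  show "r = ERule [gB1, gB2, gE] [] [] [] \<or> (\<exists>a. PosLit a \<in> set (erule_lits r) \<and> hd a \<notin> {0, 1, 3, 4})"
  proof (cases "s \<in> set base_schemas")
    case True
    then show ?thesis by (simp add: base_schemas_def r)
  next
    case False
    then obtain a where a: "PosLit a \<in> set (erule_lits ?r)" "fst (hd a) \<notin> {0, 1, 3, 4}"
      using shape unfolding schema_shape_def by blast
    then have "a \<in> set (erule_atoms ?r)" by (force simp: erule_atoms_def)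
    then have "hd (atom_val e a) \<notin> {0, 1, 3, 4}" using a(2) hd by metis
    moreover have "PosLit (atom_val e a) \<in> set (erule_lits r)"
      using a(1) by (force simp: r erule.map_sel)
    ultimately show ?thesis by blast
  qed
qed

lemma closed_Int_atoms:
  assumes "closed x I K schemas"
  shows "closed x I (K \<inter> atoms x) schemas"
  unfolding closed_def
proof
  fix r assume r: "r \<in> ground_rules x schemas"
  have "set (erule_head r) \<subseteq> atoms x"
    using r by (auto simp: atoms_def rules0_def erule_atoms_def)
  moreover have "lit_sat I (K \<inter> atoms x) l \<Longrightarrow> lit_sat I K l" for l
    by (cases l) auto
  ultimately show "rule_sat I (K \<inter> atoms x) r"
    using assms r unfolding closed_def rule_sat_def by blast
qed

lemma hd_g [simp]:
  "hd (gN j) = 0" "hd (gA j) = 1" "hd gE = 2" "hd gB1 = 3" "hd gB2 = 4" "hd gW = 5"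
  "hd (gPre k j) = 10 + k" "hd (gY k j s) = 20 + k" "hd (gU k i s) = 30 + k" "hd (gEnd k l) = 40 + k"
  "hd (gSt t q) = 50" "hd (gC t \<tau> g) = 51" "hd (gSide d t \<tau> i g) = (if d then 52 else 53)"
  "hd (gMv t \<tau> m) = 54" "hd (gWr t \<tau> g) = 55"
  by (simp_all add: g_defs)

text \<open>For a run that does not accept, this provides a model without \<open>gW\<close>: each
  rule describes a true step of the run, and the acceptance rules never fire.\<close>

lemma closed_tru:
  assumes D: "\<forall>a \<in> D. hd a < 2" "finite D" "v 1 = decode D"
    and I: "\<And>j. gN j \<in> I \<longleftrightarrow> gN j \<in> D" "\<And>j. gA j \<in> I \<longleftrightarrow> gA j \<in> D"
    and reject: "\<And>t z. fst (cfg (ustr x v 3) t) = 1 \<Longrightarrow> cell (ustr x v 3) t 1 z \<noteq> 2"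
  shows "closed x I (D \<union> Collect (tru x v)) schemas"
proof -
  define K where "K = D \<union> Collect (tru x v)"
  have mem: "a \<in> K \<longleftrightarrow> tru x v a" if "hd a \<ge> 2" for a
    using D(1) that by (auto simp: K_def)
  have memD: "gN j \<in> K \<longleftrightarrow> gN j \<in> D" "gA j \<in> K \<longleftrightarrow> gA j \<in> D" for j
    by (auto simp: K_def tru_simps)
  have base: "closed x I K base_schemas"
    by (simp add: closed_base mem tru_simps)
  \<comment> \<open>Position \<open>length (v 1)\<close> is included: there \<open>gN j\<close> is
    missing, which creates the first blank. Later blanks are only propagated.\<close>
  have level1: "sym_at (v 1) j = 0 \<longleftrightarrow> gN j \<notin> D" "gN j \<in> D \<Longrightarrow> sym_at (v 1) j = (if gA j \<in> D then 2 else 1)"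
    if "j \<le> length (v 1)" for j
  proof -
    show 1: "sym_at (v 1) j = 0 \<longleftrightarrow> gN j \<notin> D"
      using that decode_props(1,2)[OF D(2)] D(3) by (auto simp: sym_eq_0_iff le_less)
    assume "gN j \<in> D"
    then have "j < length (v 1)" using 1 that by (simp add: sym_eq_0_iff)
    then show "sym_at (v 1) j = (if gA j \<in> D then 2 else 1)"
      using decode_props(3)[OF D(2)] D(3) by (simp add: sym_eq bit_symbol_def)
  qed
  have guess: "closed x I K guess_schemas"
    unfolding closed_guess
  proof (intro conjI)
    show "\<forall>k\<in>{1, 2, 3}. gE \<in> K \<longrightarrow> gPre k 0 \<in> K"
      by (simp add: mem tru_simps)
    show "\<forall>k\<in>{2, 3}. \<forall>j<bnd x. gPre k j \<in> K \<longrightarrow> gY k j 0 \<in> K \<or> gY k j 1 \<in> K \<or> gY k j 2 \<in> K"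
    proof (intro ballI allI impI)
      fix k j :: nat assume "k \<in> {2, 3}" "j < bnd x"
      then show "gY k j 0 \<in> K \<or> gY k j 1 \<in> K \<or> gY k j 2 \<in> K"
        using sym_cases[of "v k" j] by (auto simp: mem tru_simps)
    qed
    show "\<forall>j<bnd x. gPre 1 j \<in> K \<and> gN j \<notin> I \<longrightarrow> gY 1 j 0 \<in> K"
      using level1(1) by (auto simp: mem tru_simps I)
    show "\<forall>j<bnd x. gPre 1 j \<in> K \<and> gN j \<in> K \<and> gA j \<notin> I \<longrightarrow> gY 1 j 1 \<in> K"
      using level1(2) by (auto simp: mem memD tru_simps I)
    show "\<forall>j<bnd x. gPre 1 j \<in> K \<and> gN j \<in> K \<and> gA j \<in> K \<longrightarrow> gY 1 j 2 \<in> K"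
      using level1(2) by (auto simp: mem memD tru_simps)
    show "\<forall>k\<in>{1, 2, 3}. \<forall>j<bnd x. (gY k j 1 \<in> K \<longrightarrow> gPre k (Suc j) \<in> K) \<and>
      (gY k j 2 \<in> K \<longrightarrow> gPre k (Suc j) \<in> K) \<and> (gY k j 0 \<in> K \<longrightarrow> gY k (Suc j) 0 \<in> K)"
    proof (intro ballI allI impI)
      fix k j :: nat assume k: "k \<in> {1, 2, 3}" and j: "j < bnd x"
      have "sym_at (v k) j \<noteq> 0 \<longleftrightarrow> Suc j \<le> length (v k)"
        by (auto simp: sym_eq_0_iff)
      moreover have "sym_at (v k) j = 0 \<Longrightarrow> sym_at (v k) (Suc j) = 0" "sym_at (v k) j = 0 \<Longrightarrow> length (v k) < bnd x"
        using j by (auto simp: sym_eq_0_iff)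
      ultimately show "(gY k j 1 \<in> K \<longrightarrow> gPre k (Suc j) \<in> K) \<and>
        (gY k j 2 \<in> K \<longrightarrow> gPre k (Suc j) \<in> K) \<and> (gY k j 0 \<in> K \<longrightarrow> gY k (Suc j) 0 \<in> K)"
        using j by (simp add: mem tru_simps(7,8)[OF k]) linarith
    qed
  qed
  have input: "closed x I K input_schemas"
    unfolding closed_input
  proof (intro conjI ballI)
    show "gE \<in> K \<longrightarrow> (\<forall>i<length x. gU 0 i (bit_symbol (x ! i)) \<in> K)"
      by (simp add: mem tru_simps sym_eq)
    show "gE \<in> K \<longrightarrow> gEnd 0 (length x) \<in> K"
      by (simp add: mem tru_simps)
    fix k :: nat assume "k \<in> {0, 1, 2}"
    then have k: "k \<le> 3" "Suc k \<le> 3" "Suc k \<in> {1, 2, 3}" by auto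
    note tru = mem tru_simps(8)[OF k(3)] tru_simps(9,10)[OF k(1)] tru_simps(9,10)[OF k(2)]
    define w where "w = ustr x v k"
    define z where "z = take (poly (quant_poly k) (length w)) (v (Suc k))"
    have u: "ustr x v (Suc k) = pair_bits w z" by (simp add: w_def z_def)
    have less: "i < length w" if "s \<in> {1, 2}" "s = sym_at w i" for i s
      using that sym_eq_0_iff[of w i] by (cases "i < length w") auto
    show "\<forall>l<bnd x. gEnd k l \<in> K \<longrightarrow> gU (Suc k) (l + l) 1 \<in> K"
      by (simp add: tru u w_def[symmetric] sym_pair_bits del: ustr.simps)
    show "\<forall>l<bnd x. gEnd k l \<in> K \<longrightarrow>
        (\<forall>i<bnd x. gU (Suc k) (Suc (l + (l + (poly (quant_poly k) l + i)))) 0 \<in> K)"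
      by (simp add: tru u w_def[symmetric] sym_pair_bits del: ustr.simps) (simp add: sym_eq z_def)
    fix s :: nat
    show "\<forall>l<bnd x. \<forall>j<poly (quant_poly k) l. gEnd k l \<in> K \<and> gY (Suc k) j s \<in> K \<longrightarrow>
        gU (Suc k) (Suc (l + (l + j))) s \<in> K"
      by (simp add: tru u w_def[symmetric] sym_pair_bits del: ustr.simps) (auto simp: sym_take z_def)
    assume s: "s \<in> {1, 2}"
    show "\<forall>i<bnd x. gU k i s \<in> K \<longrightarrow> gU (Suc k) (i + i) 2 \<in> K"
      using less[OF s] by (simp add: tru u w_def[symmetric] sym_pair_bits del: ustr.simps)
    show "\<forall>i<bnd x. gU k i s \<in> K \<longrightarrow> gU (Suc k) (Suc (i + i)) s \<in> K"
      using less[OF s] by (simp add: tru u w_def[symmetric] sym_pair_bits del: ustr.simps)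
    show "\<forall>i<bnd x. gU (Suc k) i s \<in> K \<and> gU (Suc k) (Suc i) 0 \<in> K \<longrightarrow> gEnd (Suc k) (Suc i) \<in> K"
    proof (intro allI impI)
      fix i assume "gU (Suc k) i s \<in> K \<and> gU (Suc k) (Suc i) 0 \<in> K"
      then have "s = sym_at (ustr x v (Suc k)) i" "sym_at (ustr x v (Suc k)) (Suc i) = 0"
        by (simp_all add: tru del: ustr.simps)
      then have "length (ustr x v (Suc k)) = Suc i"
        using s sym_eq_0_iff[of "ustr x v (Suc k)" i] sym_eq_0_iff[of "ustr x v (Suc k)" "Suc i"]
        by (auto simp del: ustr.simps)
      then show "gEnd (Suc k) (Suc i) \<in> K" by (simp add: tru del: ustr.simps)
    qed
  qed
  let ?u = "ustr x v 3"
  have tapes: "0 < num_tapes M" "Suc 0 < num_tapes M" using tm by (auto simp: is_tm_def)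
  have init: "closed x I K init_schemas"
    unfolding closed_init
    using tapes by (auto simp: mem tru_simps cell_0 sym_at_def cfg_def tm_init_def bits_tape_def off_def
        simp del: ustr.simps)
  have step: "closed x I K step_schemas"
    unfolding closed_step
  proof (intro allI impI)
    fix q gs t
    assume "length gs = num_tapes M \<and> set gs \<subseteq> {..<num_syms M}"
      and "gSt t q \<in> K \<and> (\<forall>\<tau><num_tapes M. gC t \<tau> (gs ! \<tau>) \<in> K)"
    then have "q = fst (cfg ?u t)" "gs = map tape_read (snd (cfg ?u t))"
      using reads_eq_iff[of gs ?u t] by (auto simp: mem tru_simps simp del: ustr.simps)
    then show "gSt (Suc t) (fst (total_trans M q gs)) \<in> K \<and>
        (\<forall>\<tau><num_tapes M. gMv t \<tau> (move_num (snd (snd (total_trans M q gs) ! \<tau>))) \<in> K \<and>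
          gWr t \<tau> (fst (snd (total_trans M q gs) ! \<tau>)) \<in> K)"
      by (simp add: mem tru_simps cfg_Suc act_def del: ustr.simps)
  qed
  have dir: "(if d then 2 else 0) = move_num m \<longleftrightarrow> m = (if d then MoveRight else MoveLeft)" for d m
    by (cases m) auto
  have stay: "1 = move_num m \<longleftrightarrow> m = Stay" for m
    by (cases m) auto
  have shift: "closed x I K shift_schemas"
    unfolding closed_shift
  proof (intro allI impI)
    fix \<tau> g
    assume \<tau>: "\<tau> < num_tapes M"
    note simps = mem tru_simps dir stay
    show "(\<forall>t<bnd x. gMv t \<tau> 1 \<in> K \<and> gWr t \<tau> g \<in> K \<longrightarrow> gC (Suc t) \<tau> g \<in> K) \<and>
      (\<forall>d. (\<forall>t<bnd x. \<forall>i<bnd x. gMv t \<tau> 1 \<in> K \<and> gSide d t \<tau> i g \<in> K \<longrightarrow> gSide d (Suc t) \<tau> i g \<in> K) \<and>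
        (\<forall>t<bnd x. gMv t \<tau> (if d then 2 else 0) \<in> K \<and> gSide d t \<tau> 0 g \<in> K \<longrightarrow> gC (Suc t) \<tau> g \<in> K) \<and>
        (\<forall>t<bnd x. \<forall>i<bnd x. gMv t \<tau> (if d then 2 else 0) \<in> K \<and> gSide d t \<tau> (Suc i) g \<in> K \<longrightarrow>
          gSide d (Suc t) \<tau> i g \<in> K) \<and>
        (\<forall>t<bnd x. gMv t \<tau> (if d then 2 else 0) \<in> K \<and> gWr t \<tau> g \<in> K \<longrightarrow> gSide (\<not> d) (Suc t) \<tau> 0 g \<in> K) \<and>
        (\<forall>t<bnd x. \<forall>i<bnd x. gMv t \<tau> (if d then 2 else 0) \<in> K \<and> gSide (\<not> d) t \<tau> i g \<in> K \<longrightarrow>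
          gSide (\<not> d) (Suc t) \<tau> (Suc i) g \<in> K))"
      apply (intro conjI allI impI)
      subgoal by (simp add: simps cell_Stay[OF \<tau>] del: ustr.simps One_nat_def)
      subgoal by (simp add: simps cell_Stay[OF \<tau>] del: ustr.simps One_nat_def)
      subgoal for d t using cell_shift[OF \<tau>, of ?u t d] by (simp add: simps del: ustr.simps)
      subgoal for d t i using cell_shift[OF \<tau>, of ?u t d] by (simp add: simps del: ustr.simps)
      subgoal for d t using cell_shift[OF \<tau>, of ?u t d] by (simp add: simps del: ustr.simps)
      subgoal for d t i using cell_shift[OF \<tau>, of ?u t d] by (simp add: simps del: ustr.simps)
      done
  qed
  have accept: "closed x I K accept_schemas"
    unfolding closed_accept using reject
    by (auto simp: mem tru_simps simp del: ustr.simps One_nat_def)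
  show ?thesis
    using base guess input init step shift accept by (simp add: schemas_def K_def)
qed

text \<open>For \<open>ustr x v 0\<close> only the bits and the end are given. From then on blanks
  are derived too, up to \<open>bnd x\<close>: they mark the end of the string and become the blank
  part of the input tape.\<close>

lemma strings_derived:
  assumes "closed x I J schemas" "gE \<in> J"
    and Y: "\<And>k j. k \<in> {1, 2, 3} \<Longrightarrow> j < bnd x \<Longrightarrow> gY k j (sym_at (v k) j) \<in> J"
    and len: "\<And>k. k \<le> 3 \<Longrightarrow> length (ustr x v k) < bnd x"
    and quant: "\<And>k. k < 3 \<Longrightarrow> poly (quant_poly k) (length (ustr x v k)) \<le> bnd x"
    and "k \<le> 3"
  shows "gEnd k (length (ustr x v k)) \<in> J \<and>
    (\<forall>i < length (ustr x v k). gU k i (sym_at (ustr x v k) i) \<in> J) \<and>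
    (k > 0 \<longrightarrow> (\<forall>i \<le> bnd x. gU k i (sym_at (ustr x v k) i) \<in> J))"
proof -
  have closed: "closed x I J input_schemas" using assms(1) by (simp add: schemas_def)
  note input = closed[unfolded closed_input]
  show ?thesis using \<open>k \<le> 3\<close>
  proof (induction k)
    case 0
    then show ?case using input assms(2) by (simp add: sym_eq)
  next
    case (Suc k)
    define w where "w = ustr x v k"
    define l where "l = length w"
    define p where "p = poly (quant_poly k) l"
    define z where "z = take p (v (Suc k))"
    have u: "ustr x v (Suc k) = pair_bits w z" by (simp add: w_def z_def p_def l_def)
    have k: "k \<in> {0, 1, 2}" "Suc k \<in> {1, 2, 3}" "k < 3" using Suc.prems by auto
    have lN: "l < bnd x" and pN: "p \<le> bnd x"
      using len[of k] quant[of k] k by (auto simp: l_def w_def p_def)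
    have IH: "gEnd k l \<in> J" "\<And>i. i < l \<Longrightarrow> gU k i (sym_at w i) \<in> J"
      using Suc by (auto simp: l_def w_def)
    have sym12: "sym_at w i \<in> {1, 2}" if "i < l" for i
      using that by (auto simp: sym_eq bit_symbol_def l_def)
    have r1: "gU (Suc k) (i + i) 2 \<in> J" if "i < l" for i
    proof -
      have "\<forall>s \<in> {1, 2}. \<forall>i < bnd x. gU k i s \<in> J \<longrightarrow> gU (Suc k) (i + i) 2 \<in> J"
        using input k(1) by blast
      then show ?thesis using IH(2)[OF that] sym12[OF that] that lN by auto
    qed
    have r2: "gU (Suc k) (Suc (i + i)) (sym_at w i) \<in> J" if "i < l" for i
    proof -
      have "\<forall>s \<in> {1, 2}. \<forall>i < bnd x. gU k i s \<in> J \<longrightarrow> gU (Suc k) (Suc (i + i)) s \<in> J"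
        using input k(1) by blast
      then show ?thesis using IH(2)[OF that] sym12[OF that] that lN by auto
    qed
    have r3: "gU (Suc k) (l + l) 1 \<in> J" using input k(1) IH(1) lN by blast
    have r4: "gU (Suc k) (Suc (l + (l + j))) (sym_at z j) \<in> J" if "j < p" for j
    proof -
      have "\<forall>s \<in> {0, 1, 2}. \<forall>l < bnd x. \<forall>j < poly (quant_poly k) l. gEnd k l \<in> J \<and> gY (Suc k) j s \<in> J \<longrightarrow>
        gU (Suc k) (Suc (l + (l + j))) s \<in> J"
        using input k(1) by blast
      moreover have "gY (Suc k) j (sym_at z j) \<in> J"
        using Y[OF k(2), of j] that pN by (simp add: z_def sym_take)
      moreover have "sym_at z j \<in> {0, 1, 2}" using sym_cases[of z j] by auto
      ultimately show ?thesis using IH(1) lN that by (auto simp: p_def)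
    qed
    have r5: "gU (Suc k) (Suc (l + (l + (p + i)))) 0 \<in> J" if "i < bnd x" for i
    proof -
      have "\<forall>l < bnd x. gEnd k l \<in> J \<longrightarrow>
        (\<forall>i < bnd x. gU (Suc k) (Suc (l + (l + (poly (quant_poly k) l + i)))) 0 \<in> J)"
        using input k(1) by blast
      then show ?thesis using IH(1) lN that by (simp add: p_def)
    qed
    have all: "gU (Suc k) i (sym_at (pair_bits w z) i) \<in> J" if "i \<le> bnd x" for i
    proof -
      \<comment> \<open>The regions of \<open>pair_bits w z\<close>: the two interleaved halves of
        the encoded \<open>w\<close>, the separator, the \<open>p\<close> positions open to the
        quantified string, and the blanks behind them.\<close>
      consider h where "h < l" "i = h + h" | h where "h < l" "i = Suc (h + h)" | "i = l + l"
        | j where "j < p" "i = Suc (l + (l + j))" | j where "i = Suc (l + (l + (p + j)))"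
      proof (cases "i < l + l")
        case True
        then have "i div 2 < l" "i = i div 2 + i div 2 \<or> i = Suc (i div 2 + i div 2)" by presburger+
        then show ?thesis using that(1,2) by blast
      next
        case False
        then consider "i = l + l" | "i - Suc (l + l) < p" "i = Suc (l + (l + (i - Suc (l + l))))"
          | "i = Suc (l + (l + (p + (i - Suc (l + (l + p))))))" by linarith
        then show ?thesis using that(3,4,5) by cases blast+
      qed
      then show ?thesis
      proof cases
        case 1
        then show ?thesis using r1 by (simp add: sym_pair_bits l_def)
      next
        case 2
        then show ?thesis using r2 by (simp add: sym_pair_bits l_def)
      next
        case 3
        then show ?thesis using r3 by (simp add: sym_pair_bits l_def)
      next
        case 4
        then show ?thesis using r4 by (simp add: sym_pair_bits l_def)
      next
        case (5 j)
        then have "j < bnd x" using that by simp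
        moreover have "sym_at (pair_bits w z) i = sym_at z (p + j)"
          using 5 by (simp add: sym_pair_bits l_def)
        moreover have "sym_at z (p + j) = 0" by (simp add: sym_eq z_def)
        ultimately show ?thesis using r5 5 by simp
      qed
    qed
    \<comment> \<open>The last position of the pair, which is never empty. Its symbol is a bit and
      is followed by a blank, which triggers the rule for \<open>gEnd\<close>.\<close>
    define m where "m = length w + length w + length z"
    have m: "length (pair_bits w z) = Suc m" by (simp add: m_def length_pair_bits)
    have mN: "Suc m < bnd x" using len[of "Suc k"] Suc.prems unfolding u m by simp
    have "gU (Suc k) m (sym_at (pair_bits w z) m) \<in> J" "gU (Suc k) (Suc m) 0 \<in> J"
      using all[of m] all[of "Suc m"] mN sym_eq_0_iff[of "pair_bits w z" "Suc m"] m by auto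
    moreover have "sym_at (pair_bits w z) m \<in> {1, 2}"
      by (auto simp: sym_eq m bit_symbol_def)
    moreover have "\<forall>s \<in> {1, 2}. \<forall>i < bnd x. gU (Suc k) i s \<in> J \<and> gU (Suc k) (Suc i) 0 \<in> J \<longrightarrow>
        gEnd (Suc k) (Suc i) \<in> J"
      using input k(1) by blast
    ultimately have "gEnd (Suc k) (Suc m) \<in> J" using mN by auto
    then show ?case unfolding u m using all mN m by auto
  qed
qed

text \<open>A move needs a cell one further out than the cell it produces, so the derived window
  loses one cell on each side per step; hence \<open>i + t < bnd x\<close>.\<close>

lemma tableau_derived:
  assumes "closed x I J schemas" "gE \<in> J"
    and U: "\<And>i. i \<le> bnd x \<Longrightarrow> gU 3 i (sym_at w i) \<in> J"
    and "t \<le> bnd x"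
  shows "gSt t (fst (cfg w t)) \<in> J \<and> (\<forall>\<tau> < num_tapes M. gC t \<tau> (cell w t \<tau> 0) \<in> J \<and>
    (\<forall>d i. i + t < bnd x \<longrightarrow> gSide d t \<tau> i (cell w t \<tau> (off d i)) \<in> J))"
proof -
  have init: "closed x I J init_schemas" and step: "closed x I J step_schemas"
    and shift: "closed x I J shift_schemas"
    using assms(1) by (auto simp: schemas_def)
  show ?thesis using \<open>t \<le> bnd x\<close>
  proof (induction t)
    case 0
    note init = init[unfolded closed_init]
    have st: "gSt 0 0 \<in> J" using init assms(2) by blast
    have U0: "sym_at w i \<in> {0, 1, 2}" for i using sym_cases[of w i] by auto
    have c0: "gC 0 0 (sym_at w 0) \<in> J" using init U[of 0] U0[of 0] by blast
    have r0: "gSide True 0 0 i (sym_at w (Suc i)) \<in> J" if "i < bnd x" for i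
    proof -
      have "\<forall>s \<in> {0, 1, 2}. \<forall>i < bnd x. gU 3 (Suc i) s \<in> J \<longrightarrow> gSide True 0 0 i s \<in> J"
        using init by blast
      then show ?thesis using U[of "Suc i"] U0[of "Suc i"] that by auto
    qed
    have l: "gSide False 0 \<tau> i 0 \<in> J" if "\<tau> < num_tapes M" "i < bnd x" for \<tau> i
      using init assms(2) that by blast
    have cr: "gC 0 \<tau> 0 \<in> J" "i < bnd x \<Longrightarrow> gSide True 0 \<tau> i 0 \<in> J" if "\<tau> < num_tapes M" "\<tau> \<noteq> 0" for \<tau> i
    proof -
      have "\<tau> \<in> {1..<num_tapes M}" using that by auto
      then show "gC 0 \<tau> 0 \<in> J" "i < bnd x \<Longrightarrow> gSide True 0 \<tau> i 0 \<in> J"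
        using init assms(2) by blast+
    qed
    have "gC 0 \<tau> (cell w 0 \<tau> 0) \<in> J \<and>
        (\<forall>d i. i + 0 < bnd x \<longrightarrow> gSide d 0 \<tau> i (cell w 0 \<tau> (off d i)) \<in> J)" if \<tau>: "\<tau> < num_tapes M" for \<tau>
    proof (intro conjI allI impI)
      show "gC 0 \<tau> (cell w 0 \<tau> 0) \<in> J"
        using c0 cr(1)[OF \<tau>] cell_0[OF \<tau>, of w 0] by (cases "\<tau> = 0") (auto simp: sym_at_def)
      fix d i assume i: "i + 0 < bnd x"
      show "gSide d 0 \<tau> i (cell w 0 \<tau> (off d i)) \<in> J"
      proof (cases d)
        case True
        have "1 + int i = int (Suc i)" by simp
        then show ?thesis
          using r0[of i] cr(2)[OF \<tau>, of i] cell_0[OF \<tau>, of w "off d i"] i True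
          by (cases "\<tau> = 0") (auto simp: sym_at_def off_def)
      next
        case False
        then have "cell w 0 \<tau> (off d i) = 0"
          using cell_0[OF \<tau>, of w "off d i"] by (simp add: off_def bits_tape_def)
        then show ?thesis using l[OF \<tau>, of i] i False by simp
      qed
    qed
    moreover have "fst (cfg w 0) = 0" by (simp add: cfg_def tm_init_def)
    ultimately show ?case using st by simp
  next
    case (Suc t)
    then have t: "t < bnd x" by simp
    have IH: "gSt t (fst (cfg w t)) \<in> J" "\<And>\<tau>. \<tau> < num_tapes M \<Longrightarrow> gC t \<tau> (cell w t \<tau> 0) \<in> J"
      "\<And>\<tau> d i. \<tau> < num_tapes M \<Longrightarrow> i + t < bnd x \<Longrightarrow> gSide d t \<tau> i (cell w t \<tau> (off d i)) \<in> J"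
      using Suc by auto
    let ?gs = "map tape_read (snd (cfg w t))" and ?q = "fst (cfg w t)"
    note ok = cfg_ok_reads[OF cfg_ok, of w t]
    have q: "?q < num_states M" using cfg_ok[of t w] by (simp add: cfg_ok_def)
    have gs: "\<forall>\<tau> < num_tapes M. gC t \<tau> (?gs ! \<tau>) \<in> J"
      using IH(2) reads_eq_iff[OF ok(1), of w t] by metis
    have "gSt (Suc t) (fst (total_trans M ?q ?gs)) \<in> J \<and>
        (\<forall>\<tau> < num_tapes M. gMv t \<tau> (move_num (snd (snd (total_trans M ?q ?gs) ! \<tau>))) \<in> J \<and>
          gWr t \<tau> (fst (snd (total_trans M ?q ?gs) ! \<tau>)) \<in> J)"
      using step[unfolded closed_step, rule_format, OF q _ t] ok gs IH(1) by blast
    then have st: "gSt (Suc t) (fst (cfg w (Suc t))) \<in> J"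
      and mv: "\<And>\<tau>. \<tau> < num_tapes M \<Longrightarrow> gMv t \<tau> (move_num (snd (act w t ! \<tau>))) \<in> J"
      and wr: "\<And>\<tau>. \<tau> < num_tapes M \<Longrightarrow> gWr t \<tau> (fst (act w t ! \<tau>)) \<in> J"
      by (auto simp: cfg_Suc act_def)
    have "gC (Suc t) \<tau> (cell w (Suc t) \<tau> 0) \<in> J \<and>
        (\<forall>d i. i + Suc t < bnd x \<longrightarrow> gSide d (Suc t) \<tau> i (cell w (Suc t) \<tau> (off d i)) \<in> J)"
      if \<tau>: "\<tau> < num_tapes M" for \<tau>
    proof -
      have sh: "(\<forall>t < bnd x. gMv t \<tau> 1 \<in> J \<and> gWr t \<tau> g \<in> J \<longrightarrow> gC (Suc t) \<tau> g \<in> J)"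
        "(\<forall>t < bnd x. \<forall>i < bnd x. gMv t \<tau> 1 \<in> J \<and> gSide d t \<tau> i g \<in> J \<longrightarrow> gSide d (Suc t) \<tau> i g \<in> J)"
        "(\<forall>t < bnd x. gMv t \<tau> (if d then 2 else 0) \<in> J \<and> gSide d t \<tau> 0 g \<in> J \<longrightarrow> gC (Suc t) \<tau> g \<in> J)"
        "(\<forall>t < bnd x. \<forall>i < bnd x. gMv t \<tau> (if d then 2 else 0) \<in> J \<and> gSide d t \<tau> (Suc i) g \<in> J \<longrightarrow>
          gSide d (Suc t) \<tau> i g \<in> J)"
        "(\<forall>t < bnd x. gMv t \<tau> (if d then 2 else 0) \<in> J \<and> gWr t \<tau> g \<in> J \<longrightarrow> gSide (\<not> d) (Suc t) \<tau> 0 g \<in> J)"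
        "(\<forall>t < bnd x. \<forall>i < bnd x. gMv t \<tau> (if d then 2 else 0) \<in> J \<and> gSide (\<not> d) t \<tau> i g \<in> J \<longrightarrow>
          gSide (\<not> d) (Suc t) \<tau> (Suc i) g \<in> J)" if "g < num_syms M" for g d
        using shift[unfolded closed_shift, rule_format, OF \<tau> that] by auto
      have wsym: "fst (act w t ! \<tau>) < num_syms M"
        using total_trans_ok(3)[OF q ok] length_act[of w t] \<tau> by (force simp: act_def)
      show ?thesis
      proof (cases "snd (act w t ! \<tau>) = Stay")
        case True
        then have m: "gMv t \<tau> 1 \<in> J" using mv[OF \<tau>] by simp
        have "gSide d (Suc t) \<tau> i (cell w t \<tau> (off d i)) \<in> J" if "i + Suc t < bnd x" for d i
          using sh(2)[OF cell_less[OF \<tau>, of w t "off d i"], of d] m t IH(3)[OF \<tau>, of i d] that by simp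
        then show ?thesis
          unfolding cell_Stay[OF \<tau> True] using sh(1)[OF wsym] m wr[OF \<tau>] t by auto
      next
        case False
        then obtain d where d: "snd (act w t ! \<tau>) = (if d then MoveRight else MoveLeft)"
          by (cases "snd (act w t ! \<tau>)") (auto intro: that[of True] that[of False])
        then have m: "gMv t \<tau> (if d then 2 else 0) \<in> J" using mv[OF \<tau>] by (cases d) auto
        note cs = cell_shift[OF \<tau> d]
        have "gC (Suc t) \<tau> (cell w (Suc t) \<tau> 0) \<in> J"
          unfolding cs(1) using sh(3)[OF cell_less[OF \<tau>, of w t "off d 0"], of d] m IH(3)[OF \<tau>, of 0 d] t by simp
        moreover have "gSide d (Suc t) \<tau> i (cell w (Suc t) \<tau> (off d i)) \<in> J" if "i + Suc t < bnd x" for i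
          unfolding cs(2) using sh(4)[OF cell_less[OF \<tau>, of w t "off d (Suc i)"], of d] m IH(3)[OF \<tau>, of "Suc i" d] t that by simp
        moreover have "gSide (\<not> d) (Suc t) \<tau> i (cell w (Suc t) \<tau> (off (\<not> d) i)) \<in> J"
          if "i + Suc t < bnd x" for i
        proof (cases i)
          case 0
          then show ?thesis using cs(3) sh(5)[OF wsym, of d] m wr[OF \<tau>] t by simp
        next
          case (Suc i')
          then show ?thesis
            using cs(4)[of i'] sh(6)[OF cell_less[OF \<tau>, of w t "off (\<not> d) i'"], of d] m IH(3)[OF \<tau>, of i' "\<not> d"] t that by simp
        qed
        ultimately show ?thesis by (cases d) (auto simp: all_bool_eq)
      qed
    qed
    then show ?case using st by simp
  qed
qed

text \<open>At time \<open>T\<close> the output bit is at most \<open>T\<close> cells from the head,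
  while the window still covers the sides up to \<open>bnd x - T\<close>. This is where
  \<open>2 * T < bnd x\<close> comes from.\<close>

lemma accept_derived:
  assumes "closed x I J schemas" "gE \<in> J"
    and U: "\<And>i. i \<le> bnd x \<Longrightarrow> gU 3 i (sym_at w i) \<in> J"
    and T: "cfg w T = (1, ts)" "fst (ts ! 1) = bits_tape [True]" "2 * T < bnd x"
  shows "gW \<in> J"
proof -
  have tapes: "1 < num_tapes M" using tm by (auto simp: is_tm_def)
  have accept: "closed x I J accept_schemas" using assms(1) by (simp add: schemas_def)
  note tab = tableau_derived[OF assms(1,2) U, of T]
  have st: "gSt T 1 \<in> J" using tab T by simp
  define h where "h = snd (ts ! 1)"
  have h: "\<bar>h\<bar> \<le> int T" using cfg_ok[of T w] tapes T(1) by (simp add: cfg_ok_def h_def)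
  \<comment> \<open>The output bit is in the absolute cell \<open>0\<close>, at distance
    \<open>- h\<close> from the head.\<close>
  have c: "cell w T 1 (- h) = 2" using T(1,2) by (simp add: cell_def h_def bits_tape_def)
  have T': "T < bnd x" using T(3) by simp
  consider "h = 0" | d i where "- h = off d i" "i < T"
  proof (cases "h = 0")
    case False
    have "- h = off (h < 0) (nat (\<bar>h\<bar> - 1))" "nat (\<bar>h\<bar> - 1) < T"
      using False h by (auto simp: off_def)
    then show ?thesis using that(2) by blast
  qed (use that in blast)
  then show ?thesis
  proof cases
    case 1
    then have "gC T 1 2 \<in> J" using tab tapes c T' by auto
    then show ?thesis using accept[unfolded closed_accept] st T' by blast
  next
    case (2 d i)
    have "gSide d T 1 i (cell w T 1 (off d i)) \<in> J" using tab tapes T(3) T' 2(2) by simp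
    then have "gSide d T 1 i 2 \<in> J" using c 2(1) by simp
    then show ?thesis using accept[unfolded closed_accept] st T' 2 by (metis less_trans)
  qed
qed

end

section \<open>Stable models of the simulation\<close>

definition assignment :: "nat list set \<Rightarrow> bits \<Rightarrow> bits \<Rightarrow> nat \<Rightarrow> bits" where
  "assignment D y2 y3 k = (if k = 1 then decode D else if k = 2 then y2 else y3)"

locale reduction = tableau +
  fixes L :: "bits set" and time_poly :: "nat poly"
  assumes computes: "tm_computes_in_time M (\<lambda>w. [w \<in> L]) (poly time_poly)"
    and ustr_bound: "\<And>x v k. k \<le> 3 \<Longrightarrow> length (ustr x v k) < bnd x"
    and quant_bound: "\<And>x v k. k < 3 \<Longrightarrow> poly (quant_poly k) (length (ustr x v k)) < bnd x"
    and time_bound: "\<And>x v. 2 * poly time_poly (length (ustr x v 3)) < bnd x"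
begin

definition sim_rules :: "bits \<Rightarrow> nat list erule set" where
  "sim_rules x = rules0 x \<union> (\<lambda>a. horn a [gW]) ` {a \<in> atoms x. sat_tag (hd a)}"

lemma sim_rules_sat:
  "(\<forall>r \<in> sim_rules x. rule_sat I J r) \<longleftrightarrow>
    closed x I J schemas \<and> (gW \<in> J \<longrightarrow> (\<forall>a \<in> atoms x. sat_tag (hd a) \<longrightarrow> a \<in> J))"
  unfolding sim_rules_def ball_Un closed_def rules0_def[symmetric] by auto

lemma base_rule: "ERule [gB1, gB2, gE] [] [] [] \<in> rules0 x"
  by (force simp: rules0_def ground_def schemas_def base_schemas_def schema_envs_False)

lemma gB_in_atoms: "gB1 \<in> atoms x" "gB2 \<in> atoms x"
  using base_rule[of x] by (force simp: atoms_def erule_atoms_def)+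

lemma in_ground:
  "s \<in> set S \<Longrightarrow> e \<in> set (schema_envs x (fst s) (fst (snd s))) \<Longrightarrow> f e (snd (snd s)) \<in> set (ground f x S)"
  by (force simp: ground_def)

lemma finite_atoms: "finite (atoms x)"
  by (simp add: atoms_def rules0_def)

lemma gW_in_atoms: "gW \<in> atoms x"
proof -
  let ?s = "(False, rng1, horn sW [sSt (var 2) 1, sC (var 2) 1 2])"
  have N: "0 < bnd x" using ustr_bound[of 0 x] by simp
  have s: "?s \<in> set schemas" by (simp add: schemas_def accept_schemas_def)
  have e: "[length x, bnd x, 0] \<in> set (schema_envs x (fst ?s) (fst (snd ?s)))"
    using N by (simp add: schema_envs_False)
  have "horn gW [gSt 0 1, gC 0 1 2] \<in> rules0 x"
    using in_ground[OF s e, of "\<lambda>e. map_erule (atom_val e)"] by (simp add: rules0_def)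
  then show ?thesis by (force simp: atoms_def erule_atoms_def horn_def)
qed

lemma input_atoms: "j < bnd x \<Longrightarrow> gN j \<in> inputs x" "j < bnd x \<Longrightarrow> gA j \<in> inputs x"
proof -
  let ?s = "(False, rng1, ERule [sY 1 (var 2) 2]
       [PosLit (sPre 1 (var 2)), PosLit (sN (var 2)), PosLit (sA (var 2))] [] [])"
  assume j: "j < bnd x"
  have s: "?s \<in> set schemas" by (simp add: schemas_def guess_schemas_def)
  have e: "[length x, bnd x, j] \<in> set (schema_envs x (fst ?s) (fst (snd ?s)))"
    using j by (simp add: schema_envs_False)
  have "ERule [gY 1 j 2] [PosLit (gPre 1 j), PosLit (gN j), PosLit (gA j)] [] [] \<in> rules0 x"
    using in_ground[OF s e, of "\<lambda>e. map_erule (atom_val e)"] by (simp add: rules0_def)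
  then have "gN j \<in> atoms x" "gA j \<in> atoms x" by (force simp: atoms_def erule_atoms_def)+
  then show "gN j \<in> inputs x" "gA j \<in> inputs x" by (auto simp: inputs_def)
qed

section \<open>Stable models without the simulation, and support of atoms\<close>

lemma guarded_not_sat:
  assumes "r \<in> rules0 x" "r \<noteq> ERule [gB1, gB2, gE] [] [] []" "\<forall>a \<in> J. hd a \<in> {0, 1, 3, 4}"
  shows "rule_sat I J r"
proof -
  obtain a where "PosLit a \<in> set (erule_lits r)" "hd a \<notin> {0, 1, 3, 4}"
    using rules0_shape(4)[OF assms(1)] assms(2) by blast
  then show ?thesis using assms(3) by (force simp: rule_sat_def)
qed

text \<open>Every other rule is satisfied because its guarding body atom is absent, and dropping
  \<open>b\<close> would violate the base rule.\<close>

lemma stable_model_trivial: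
  assumes D: "D \<subseteq> inputs x" and b: "b \<in> {gB1, gB2}"
  shows "stable_model (atoms x) (sim_rules x) D (insert b D)"
  unfolding stable_model_def
proof (intro conjI)
  have tags: "\<forall>a \<in> D. hd a \<in> {0, 1}" using D by (auto simp: inputs_def)
  then have tags': "\<forall>a \<in> insert b D. hd a \<in> {0, 1, 3, 4}" using b by auto
  show "insert b D \<subseteq> atoms x" using D b gB_in_atoms by (auto simp: inputs_def)
  show "D \<subseteq> insert b D" by blast
  have "rule_sat I (insert b D) r" if "r \<in> rules0 x" for I r
  proof (cases "r = ERule [gB1, gB2, gE] [] [] []")
    case True
    then show ?thesis using b by auto
  next
    case False
    then show ?thesis using guarded_not_sat[OF that _ tags'] by blast
  qed
  moreover have "gW \<notin> insert b D" using tags' by force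
  ultimately show "\<forall>r \<in> sim_rules x. rule_sat (insert b D) (insert b D) r"
    by (auto simp: sim_rules_def)
  show "\<not> (\<exists>J. J \<subset> insert b D \<and> D \<subseteq> J \<and> (\<forall>r \<in> sim_rules x. rule_sat (insert b D) J r))"
  proof (rule notI, elim exE conjE)
    fix J assume "J \<subset> insert b D" "D \<subseteq> J" and sat: "\<forall>r \<in> sim_rules x. rule_sat (insert b D) J r"
    then have "J = D" by blast
    moreover have "rule_sat (insert b D) J (ERule [gB1, gB2, gE] [] [] [])"
      using sat base_rule[of x] unfolding sim_rules_def by blast
    ultimately show False by (auto dest: bspec[OF tags])
  qed
qed

lemma avoidable:
  assumes "D \<subseteq> inputs x" "a \<in> atoms x - inputs x"
  shows "\<exists>I. stable_model (atoms x) (sim_rules x) D I \<and> a \<notin> I"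
proof -
  have "a \<notin> D" using assms by blast
  moreover have "gB1 \<noteq> gB2" by (simp add: g_defs)
  ultimately show ?thesis
    using stable_model_trivial[OF assms(1), of gB1] stable_model_trivial[OF assms(1), of gB2]
    by (cases "a = gB1") auto
qed

text \<open>Without \<open>gE\<close>, restricting \<open>I\<close> to the facts, \<open>gB1\<close>
  and \<open>gB2\<close> leaves a model of the reduct, and it is smaller because it lacks
  \<open>gW\<close>.\<close>

lemma stable_model_gE:
  assumes "stable_model (atoms x) (sim_rules x) D I" "D \<subseteq> inputs x" "gW \<in> I"
  shows "gE \<in> I"
proof (rule ccontr)
  assume E: "gE \<notin> I"
  let ?J = "I \<inter> (D \<union> {gB1, gB2})"
  have tags: "\<forall>a \<in> ?J. hd a \<in> {0, 1, 3, 4}" using assms(2) by (auto simp: inputs_def)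
  have "rule_sat I I (ERule [gB1, gB2, gE] [] [] [])"
    using assms(1) base_rule[of x] unfolding stable_model_def sim_rules_def by blast
  then have base: "rule_sat I ?J (ERule [gB1, gB2, gE] [] [] [])" using E by auto
  have "rule_sat I ?J r" if "r \<in> rules0 x" for r
    using guarded_not_sat[OF that _ tags] base by blast
  moreover have W: "gW \<notin> ?J" using bspec[OF tags, of gW] by auto
  ultimately have "\<forall>r \<in> sim_rules x. rule_sat I ?J r" by (auto simp: sim_rules_def)
  moreover have "?J \<subset> I" using W assms(3) by blast
  moreover have "D \<subseteq> ?J" using assms(1) by (auto simp: stable_model_def)
  ultimately show False using assms(1) unfolding stable_model_def by blast
qed

text \<open>No head has an input tag, so further input atoms could be removed. Consequently the
  negated atoms are decided by \<open>D\<close>.\<close>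

lemma stable_model_inputs:
  assumes "stable_model (atoms x) (sim_rules x) D I" "a \<in> I" "hd a < 2"
  shows "a \<in> D"
proof (rule ccontr)
  assume a: "a \<notin> D"
  let ?J = "I - {a. hd a < 2 \<and> a \<notin> D}"
  have "rule_sat I ?J r" if r: "r \<in> sim_rules x" for r
  proof -
    have "\<forall>h \<in> set (erule_head r). hd h \<ge> 2"
      using r rules0_shape(3) by (auto simp: sim_rules_def horn_def sat_tag_def)
    moreover have "rule_sat I I r" using assms(1) r by (simp add: stable_model_def)
    moreover have "lit_sat I ?J l \<Longrightarrow> lit_sat I I l" for l by (cases l) auto
    ultimately show ?thesis unfolding rule_sat_def by fastforce
  qed
  moreover have "?J \<subset> I" using assms(2,3) a by blast
  moreover have "D \<subseteq> ?J" using assms(1) by (auto simp: stable_model_def)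
  ultimately show False using assms(1) unfolding stable_model_def by blast
qed

text \<open>\<open>J\<close> may contain several symbols for one position. A string is selected cell
  by cell: the prefix grows until a blank is available or the range is exhausted, and a blank, once
  chosen, is propagated.\<close>

lemma guess_extract:
  assumes "closed x I J schemas" "gE \<in> J" "k \<in> {2, 3}"
  shows "\<exists>v. (\<forall>j. j < bnd x \<or> j = bnd x \<and> length v < bnd x \<longrightarrow> gY k j (sym_at v j) \<in> J) \<and>
    (\<forall>j \<le> bnd x. j \<le> length v \<longrightarrow> gPre k j \<in> J)"
proof -
  have "closed x I J guess_schemas" using assms(1) by (simp add: schemas_def)
  note guess = this[unfolded closed_guess]
  have k: "k \<in> {1, 2, 3}" using assms(3) by blast
  have choose: "gY k j 0 \<in> J \<or> gY k j 1 \<in> J \<or> gY k j 2 \<in> J" if "j < bnd x" "gPre k j \<in> J" for j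
    using guess assms(3) that by blast
  have chain: "gY k j 1 \<in> J \<Longrightarrow> gPre k (Suc j) \<in> J" "gY k j 2 \<in> J \<Longrightarrow> gPre k (Suc j) \<in> J"
    "gY k j 0 \<in> J \<Longrightarrow> gY k (Suc j) 0 \<in> J" if "j < bnd x" for j
    using guess k that by blast+
  have "\<exists>v. length v \<le> m \<and> (\<forall>j. j < m \<or> j = m \<and> length v < m \<longrightarrow> gY k j (sym_at v j) \<in> J) \<and>
    (\<forall>j \<le> m. j \<le> length v \<longrightarrow> gPre k j \<in> J)" if "m \<le> bnd x" for m
    using that
  proof (induction m)
    case 0
    have "gPre k 0 \<in> J" using bspec[OF conjunct1[OF guess] k] assms(2) by simp
    then show ?case by (intro exI[of _ "[]"]) auto
  next
    case (Suc m)
    then have m: "m < bnd x" by simp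
    from Suc.IH[OF less_imp_le[OF m]] obtain v where "length v \<le> m \<and>
      (\<forall>j. j < m \<or> j = m \<and> length v < m \<longrightarrow> gY k j (sym_at v j) \<in> J) \<and>
      (\<forall>j \<le> m. j \<le> length v \<longrightarrow> gPre k j \<in> J)" by (elim exE)
    then have v: "length v \<le> m" "\<And>j. j < m \<or> j = m \<and> length v < m \<Longrightarrow> gY k j (sym_at v j) \<in> J"
      "\<And>j. j \<le> m \<Longrightarrow> j \<le> length v \<Longrightarrow> gPre k j \<in> J" by blast+
    show ?case
    proof (cases "length v < m \<or> gY k m 0 \<in> J")
      case True
      have 0: "sym_at v m = 0" "sym_at v (Suc m) = 0" using v(1) by (auto simp: sym_eq_0_iff)
      have "gY k m 0 \<in> J" using True v(2)[of m] 0 by auto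
      moreover from this have "gY k (Suc m) 0 \<in> J" using chain(3)[OF m] by blast
      ultimately have "gY k j (sym_at v j) \<in> J" if "j < Suc m \<or> j = Suc m" for j
        using that v(2)[of j] 0 by (auto simp: less_Suc_eq)
      then show ?thesis using v(1,3) by (intro exI[of _ v]) (auto simp: le_Suc_eq)
    next
      case False
      then have lv: "length v = m" using v(1) by simp
      then have "gPre k m \<in> J" using v(3) by simp
      then obtain b where b: "gY k m (bit_symbol b) \<in> J"
        using choose[OF m] False by (auto simp: bit_symbol_def intro: that[of True] that[of False])
      have "gPre k (Suc m) \<in> J" using b chain(1,2)[OF m] by (cases b) (auto simp: bit_symbol_def)
      moreover have "gY k j (sym_at (v @ [b]) j) \<in> J" if "j < Suc m" for j
      proof (cases "j = m")
        case True
        then show ?thesis using b lv by (simp add: sym_eq nth_append)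
      next
        case False
        then show ?thesis using that v(2)[of j] lv by (simp add: sym_eq nth_append)
      qed
      ultimately show ?thesis using v(3) lv
        by (intro exI[of _ "v @ [b]"]) (auto simp: le_Suc_eq)
    qed
  qed
  from this[OF order_refl] show ?thesis by blast
qed

text \<open>Here nothing is guessed: the facts decide which of the three rules applies at each
  position.\<close>

lemma decode_derived:
  assumes "closed x I J schemas" "gE \<in> J" "D \<subseteq> J" "finite D"
    and I: "\<And>j. gN j \<in> I \<longleftrightarrow> gN j \<in> D" "\<And>j. gA j \<in> I \<longleftrightarrow> gA j \<in> D"
    and "j < bnd x"
  shows "gY 1 j (sym_at (decode D) j) \<in> J"
proof -
  have "closed x I J guess_schemas" using assms(1) by (simp add: schemas_def)
  note guess = this[unfolded closed_guess]
  have l1: "gPre 1 j \<in> J \<Longrightarrow> gN j \<notin> D \<Longrightarrow> gY 1 j 0 \<in> J"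
    "gPre 1 j \<in> J \<Longrightarrow> gN j \<in> D \<Longrightarrow> gA j \<notin> D \<Longrightarrow> gY 1 j 1 \<in> J"
    "gPre 1 j \<in> J \<Longrightarrow> gN j \<in> D \<Longrightarrow> gA j \<in> D \<Longrightarrow> gY 1 j 2 \<in> J" if "j < bnd x" for j
    using guess I assms(3) that by blast+
  have chain: "gY 1 j 1 \<in> J \<Longrightarrow> gPre 1 (Suc j) \<in> J" "gY 1 j 2 \<in> J \<Longrightarrow> gPre 1 (Suc j) \<in> J"
    "gY 1 j 0 \<in> J \<Longrightarrow> gY 1 (Suc j) 0 \<in> J" if "j < bnd x" for j
    using guess that by blast+
  note dec = decode_props[OF assms(4)]
  have here: "gY 1 j (sym_at (decode D) j) \<in> J" if "j < bnd x" "j \<le> length (decode D)" "gPre 1 j \<in> J" for j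
  proof (cases "j < length (decode D)")
    case True
    then show ?thesis using l1(2,3)[OF that(1,3)] dec(2,3)[OF True] by (auto simp: sym_eq bit_symbol_def)
  next
    case False
    then show ?thesis using l1(1)[OF that(1,3)] dec(1) that(2) by (simp add: sym_eq)
  qed
  have "(j \<le> length (decode D) \<longrightarrow> gPre 1 j \<in> J) \<and> gY 1 j (sym_at (decode D) j) \<in> J"
    using \<open>j < bnd x\<close>
  proof (induction j)
    case 0
    have "gPre 1 0 \<in> J" using bspec[OF conjunct1[OF guess], of 1] assms(2) by simp
    then show ?case using here[of 0] 0 by simp
  next
    case (Suc j)
    then have j: "j < bnd x" by simp
    show ?case
    proof (cases "Suc j \<le> length (decode D)")
      case True
      then have "sym_at (decode D) j \<in> {1, 2}" by (auto simp: sym_eq bit_symbol_def)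
      then have "gPre 1 (Suc j) \<in> J" using Suc.IH[OF j] chain(1,2)[OF j] by auto
      then show ?thesis using here[OF Suc.prems True] by blast
    next
      case False
      then have "sym_at (decode D) j = 0" "sym_at (decode D) (Suc j) = 0" by (auto simp: sym_eq_0_iff)
      then show ?thesis using Suc.IH[OF j] chain(3)[OF j] False by simp
    qed
  qed
  then show ?thesis by blast
qed

lemma tru_not_sat_tag:
  assumes "tru x v a" "\<not> sat_tag (hd a)"
  shows "a = gE \<or> (\<exists>j. a = gPre 2 j \<and> j \<le> length (v 2) \<and> j \<le> bnd x) \<or>
    (\<exists>j. a = gY 2 j (sym_at (v 2) j) \<and> (j < bnd x \<or> j = bnd x \<and> length (v 2) < bnd x))"
  using assms unfolding tru_def sat_tag_def by (auto split: if_splits)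

text \<open>With \<open>gW\<close> and all atoms of saturated tag present, only the base rule and
  the guessing rules of \<open>y2\<close> have heads that still need to be checked.\<close>

lemma closed_saturated:
  assumes D: "\<forall>a \<in> D. hd a < 2"
  shows "closed x I (D \<union> {gW} \<union> {a. sat_tag (hd a) \<or> tru x v a}) schemas"
proof -
  define K where "K = D \<union> {gW} \<union> {a. sat_tag (hd a) \<or> tru x v a}"
  have sat: "a \<in> K" if "sat_tag (hd a)" for a using that by (simp add: K_def)
  have W: "gW \<in> K" and E: "gE \<in> K" by (auto simp: K_def tru_simps)
  have mem: "gPre 2 j \<in> K \<longleftrightarrow> tru x v (gPre 2 j)" "gY 2 j s \<in> K \<longleftrightarrow> tru x v (gY 2 j s)" for j s
    using bspec[OF D, of "gPre 2 j"] bspec[OF D, of "gY 2 j s"]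
    by (auto simp: K_def sat_tag_def) (auto simp: g_defs)
  have base: "closed x I K base_schemas" using E by (simp add: closed_base)
  have guess: "closed x I K guess_schemas"
  proof -
    have "gY 2 j 0 \<in> K \<or> gY 2 j 1 \<in> K \<or> gY 2 j 2 \<in> K" if "j < bnd x" for j
      using sym_cases[of "v 2" j] that by (auto simp: mem tru_simps)
    moreover have "(gY 2 j 1 \<in> K \<longrightarrow> gPre 2 (Suc j) \<in> K) \<and>
      (gY 2 j 2 \<in> K \<longrightarrow> gPre 2 (Suc j) \<in> K) \<and> (gY 2 j 0 \<in> K \<longrightarrow> gY 2 (Suc j) 0 \<in> K)" if "j < bnd x" for j
    proof -
      have "sym_at (v 2) j \<noteq> 0 \<longleftrightarrow> Suc j \<le> length (v 2)" by (auto simp: sym_eq_0_iff)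
      moreover have "sym_at (v 2) j = 0 \<Longrightarrow> sym_at (v 2) (Suc j) = 0"
        "sym_at (v 2) j = 0 \<Longrightarrow> length (v 2) < bnd x"
        using that by (auto simp: sym_eq_0_iff)
      ultimately show ?thesis using that by (simp add: mem tru_simps) linarith
    qed
    moreover have "gPre 2 0 \<in> K" by (simp add: mem tru_simps)
    moreover have "gPre 1 j \<in> K" "gPre 3 j \<in> K" "gY 1 j s \<in> K" "gY 3 j s \<in> K" for j s
      by (auto intro!: sat simp: sat_tag_def)
    ultimately show ?thesis unfolding closed_guess by simp
  qed
  have heads: "gU k i s \<in> K" "gEnd k i \<in> K" "gSt t q \<in> K" "gC t \<tau> g \<in> K" "gSide d t \<tau> i g \<in> K"
    "gMv t \<tau> g \<in> K" "gWr t \<tau> g \<in> K" for k i s t q \<tau> g d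
    by (auto intro!: sat simp: sat_tag_def)
  have "closed x I K schemas"
    using base guess W
    by (simp add: schemas_def closed_input closed_init closed_step closed_shift closed_accept heads)
  then show ?thesis unfolding K_def .
qed

lemma computation:
  obtains T ts where "T \<le> poly time_poly (length w)" "cfg w T = (1, ts)"
    "fst (ts ! 1) = bits_tape [w \<in> L]"
  using computes[unfolded tm_computes_in_time_def, rule_format, of w] unfolding cfg_def by blast

text \<open>The halting configuration is unique and its output is \<open>[False]\<close>, so the
  symbol \<open>2\<close> occurs nowhere on the output tape.\<close>

lemma not_accepting:
  assumes "w \<notin> L" "fst (cfg w t) = 1"
  shows "cell w t 1 z \<noteq> 2"
proof -
  obtain T ts where T: "cfg w T = (1, ts)" "fst (ts ! 1) = bits_tape [w \<in> L]"
    by (rule computation)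
  then have "cfg w t = (1, ts)" using halted_unique[OF assms(2), of T] by simp
  then show ?thesis using T(2) assms(1) by (simp add: cell_def bits_tape_def)
qed

lemma accepting_derived:
  assumes "closed x I J schemas" "gE \<in> J" "ustr x v 3 \<in> L"
    and Y: "\<And>k j. k \<in> {1, 2, 3} \<Longrightarrow> j < bnd x \<Longrightarrow> gY k j (sym_at (v k) j) \<in> J"
  shows "gW \<in> J"
proof -
  let ?w = "ustr x v 3"
  have U: "gU 3 i (sym_at ?w i) \<in> J" if "i \<le> bnd x" for i
    using strings_derived[OF assms(1,2) Y ustr_bound less_imp_le[OF quant_bound], of 3] that by auto
  obtain T ts where T: "T \<le> poly time_poly (length ?w)" "cfg ?w T = (1, ts)" "fst (ts ! 1) = bits_tape [?w \<in> L]"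
    by (rule computation)
  have T3: "fst (ts ! 1) = bits_tape [True]" using T(3) assms(3) by simp
  have "2 * T < bnd x" using T(1) time_bound[of x v] by linarith
  from accept_derived[OF assms(1,2) U T(2) T3 this] show ?thesis by simp
qed

theorem stable_model_iff:
  assumes D: "D \<subseteq> inputs x"
  shows "(\<exists>I. stable_model (atoms x) (sim_rules x) D I \<and> gW \<in> I) \<longleftrightarrow>
    (\<exists>y2. \<forall>y3. ustr x (assignment D y2 y3) 3 \<in> L)"
proof
  have tags: "\<forall>a \<in> D. hd a < 2" and DA: "D \<subseteq> atoms x" using D by (auto simp: inputs_def)
  have fin: "finite D" using DA finite_atoms finite_subset by blast
  {
    assume "\<exists>I. stable_model (atoms x) (sim_rules x) D I \<and> gW \<in> I"
    then obtain I where I: "stable_model (atoms x) (sim_rules x) D I" "gW \<in> I" by blast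
    have E: "gE \<in> I" by (rule stable_model_gE[OF I(1) D I(2)])
    have sat: "closed x I I schemas" "\<forall>a \<in> atoms x. sat_tag (hd a) \<longrightarrow> a \<in> I"
      using I by (auto simp: stable_model_def sim_rules_sat)
    have DI: "D \<subseteq> I" using I(1) by (simp add: stable_model_def)
    have NA: "gN j \<in> I \<longleftrightarrow> gN j \<in> D" "gA j \<in> I \<longleftrightarrow> gA j \<in> D" for j
      using stable_model_inputs[OF I(1)] DI by auto
    have "\<exists>v. (\<forall>j. j < bnd x \<or> j = bnd x \<and> length v < bnd x \<longrightarrow> gY 2 j (sym_at v j) \<in> I) \<and>
      (\<forall>j \<le> bnd x. j \<le> length v \<longrightarrow> gPre 2 j \<in> I)" by (rule guess_extract[OF sat(1) E]) simp
    then obtain y2 where "(\<forall>j. j < bnd x \<or> j = bnd x \<and> length y2 < bnd x \<longrightarrow> gY 2 j (sym_at y2 j) \<in> I) \<and>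
      (\<forall>j \<le> bnd x. j \<le> length y2 \<longrightarrow> gPre 2 j \<in> I)" by (elim exE)
    then have y2: "\<And>j. j < bnd x \<or> j = bnd x \<and> length y2 < bnd x \<Longrightarrow> gY 2 j (sym_at y2 j) \<in> I"
      "\<And>j. j \<le> bnd x \<Longrightarrow> j \<le> length y2 \<Longrightarrow> gPre 2 j \<in> I" by blast+
    have "ustr x (assignment D y2 y3) 3 \<in> L" for y3
    proof (rule ccontr)
      assume no: "ustr x (assignment D y2 y3) 3 \<notin> L"
      let ?v = "assignment D y2 y3"
      \<comment> \<open>A rejecting \<open>y3\<close> gives a model of the reduct without
        \<open>gW\<close>. It lies inside \<open>I\<close>, which contains all saturated atoms as
        well as \<open>gE\<close> and the atoms of \<open>y2\<close>.\<close>
      let ?J = "(D \<union> Collect (tru x ?v)) \<inter> atoms x"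
      have v: "?v 1 = decode D" "?v 2 = y2" by (auto simp: assignment_def)
      have W: "gW \<notin> ?J" using bspec[OF tags, of gW] by (auto simp: tru_simps)
      have "closed x I ?J schemas"
        using closed_Int_atoms[OF closed_tru[OF tags fin v(1) NA not_accepting[OF no]]] by simp
      then have "\<forall>r \<in> sim_rules x. rule_sat I ?J r" using W unfolding sim_rules_sat by blast
      moreover have "D \<subseteq> ?J" using DA by blast
      moreover have "?J \<subseteq> I"
      proof
        fix a assume a: "a \<in> ?J"
        show "a \<in> I"
        proof (cases "a \<in> D \<or> sat_tag (hd a)")
          case True
          then show ?thesis using DI sat(2) a by blast
        next
          case False
          then have "tru x ?v a" using a by blast
          from tru_not_sat_tag[OF this] False show ?thesis
            using E y2 unfolding v by blast
        qed
      qed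
      ultimately show False using I W unfolding stable_model_def by blast
    qed
    then show "\<exists>y2. \<forall>y3. ustr x (assignment D y2 y3) 3 \<in> L" by blast
  }
  {
    assume "\<exists>y2. \<forall>y3. ustr x (assignment D y2 y3) 3 \<in> L"
    then obtain y2 where acc: "\<And>y3. ustr x (assignment D y2 y3) 3 \<in> L" by blast
    \<comment> \<open>Any third string would do, since the atoms depending on it are
      saturated.\<close>
    let ?v = "assignment D y2 []"
    define I where "I = (D \<union> {gW} \<union> {a. sat_tag (hd a) \<or> tru x ?v a}) \<inter> atoms x"
    have v: "?v 2 = y2" by (simp add: assignment_def)
    have W: "gW \<in> I" using gW_in_atoms by (simp add: I_def)
    have DI: "D \<subseteq> I" using DA by (auto simp: I_def)
    have NA: "gN j \<in> I \<longleftrightarrow> gN j \<in> D" "gA j \<in> I \<longleftrightarrow> gA j \<in> D" for j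
      using DA by (auto simp: I_def sat_tag_def tru_simps) (auto simp: g_defs)
    have B: "gB1 \<notin> I" "gB2 \<notin> I"
      using bspec[OF tags, of gB1] bspec[OF tags, of gB2]
      by (auto simp: I_def sat_tag_def tru_simps) (auto simp: g_defs)
    have mem2: "gY 2 j s \<in> I \<Longrightarrow> tru x ?v (gY 2 j s)" for j s
      using bspec[OF tags, of "gY 2 j s"] by (auto simp: I_def sat_tag_def) (auto simp: g_defs)
    have "closed x I I schemas"
      unfolding I_def by (rule closed_Int_atoms[OF closed_saturated[OF tags]])
    then have model: "\<forall>r \<in> sim_rules x. rule_sat I I r" by (auto simp: sim_rules_sat I_def)
    \<comment> \<open>A model \<open>J\<close> of the reduct inside \<open>I\<close> must contain
      \<open>gE\<close>, repeat \<open>y2\<close> and choose some \<open>y3\<close>. The machine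
      accepts this choice, so \<open>J\<close> contains \<open>gW\<close> and thereby all of
      \<open>I\<close>.\<close>
    have minimal: "J = I" if J: "J \<subseteq> I" "D \<subseteq> J" "\<forall>r \<in> sim_rules x. rule_sat I J r" for J
    proof -
      have cl: "closed x I J schemas"
        and satur: "gW \<in> J \<Longrightarrow> a \<in> atoms x \<Longrightarrow> sat_tag (hd a) \<Longrightarrow> a \<in> J" for a
        using J(3) by (auto simp: sim_rules_sat)
      have "closed x I J base_schemas" using cl by (simp add: schemas_def)
      then have E: "gE \<in> J" using B J(1) by (auto simp: closed_base)
      have "\<exists>v. (\<forall>j. j < bnd x \<or> j = bnd x \<and> length v < bnd x \<longrightarrow> gY 2 j (sym_at v j) \<in> J) \<and>
        (\<forall>j \<le> bnd x. j \<le> length v \<longrightarrow> gPre 2 j \<in> J)" by (rule guess_extract[OF cl E]) simp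
      then obtain z2 where "(\<forall>j. j < bnd x \<or> j = bnd x \<and> length z2 < bnd x \<longrightarrow> gY 2 j (sym_at z2 j) \<in> J) \<and>
        (\<forall>j \<le> bnd x. j \<le> length z2 \<longrightarrow> gPre 2 j \<in> J)" by (elim exE)
      then have z2: "\<And>j. j < bnd x \<or> j = bnd x \<and> length z2 < bnd x \<Longrightarrow> gY 2 j (sym_at z2 j) \<in> J"
        "\<And>j. j \<le> bnd x \<Longrightarrow> j \<le> length z2 \<Longrightarrow> gPre 2 j \<in> J" by blast+
      have "\<exists>v. (\<forall>j. j < bnd x \<or> j = bnd x \<and> length v < bnd x \<longrightarrow> gY 3 j (sym_at v j) \<in> J) \<and>
        (\<forall>j \<le> bnd x. j \<le> length v \<longrightarrow> gPre 3 j \<in> J)" by (rule guess_extract[OF cl E]) simp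
      then obtain y3 where y3: "\<And>j. j < bnd x \<Longrightarrow> gY 3 j (sym_at y3 j) \<in> J"
        by (elim exE conjE) blast
      \<comment> \<open>\<open>I\<close> has a single symbol at each position of the second string,
        so \<open>J\<close> cannot deviate from \<open>y2\<close> within the range.\<close>
      have same: "sym_at z2 j = sym_at y2 j" if "j < bnd x" for j
        using mem2[of j "sym_at z2 j"] z2(1)[of j] J(1) that v by (auto simp: tru_simps)
      have "gY k j (sym_at (assignment D y2 y3 k) j) \<in> J" if "k \<in> {1, 2, 3}" "j < bnd x" for k j
        using that decode_derived[OF cl E J(2) fin NA that(2)] z2(1)[of j] same y3[of j]
        by (auto simp: assignment_def)
      from accepting_derived[OF cl E acc this] have W': "gW \<in> J" .
      have "I \<subseteq> J"
      proof
        fix a assume a: "a \<in> I"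
        show "a \<in> J"
        proof (cases "a \<in> D \<or> a = gW \<or> sat_tag (hd a)")
          case True
          then show ?thesis using a J(2) W' satur by (auto simp: I_def)
        next
          case False
          then have "tru x ?v a" using a by (auto simp: I_def)
          from tru_not_sat_tag[OF this] False consider "a = gE"
            | j where "a = gPre 2 j" "j \<le> length y2" "j \<le> bnd x"
            | j where "a = gY 2 j (sym_at y2 j)" "j < bnd x \<or> j = bnd x \<and> length y2 < bnd x"
            unfolding v by blast
          then show ?thesis
          proof cases
            case 1
            then show ?thesis using E by simp
          next
            case (2 j)
            have "j \<le> length z2"
            proof (cases j)
              case (Suc i)
              then show ?thesis using 2 same[of i] sym_eq_0_iff[of y2 i] sym_eq_0_iff[of z2 i] by simp
            qed simp
            then show ?thesis using z2(2) 2 by simp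
          next
            case (3 j)
            show ?thesis
            proof (cases "j < bnd x")
              case True
              then show ?thesis using z2(1)[of j] same[of j] 3 by simp
            next
              case False
              \<comment> \<open>A blank at \<open>bnd x\<close> means that \<open>y2\<close> ended
                earlier; then \<open>z2\<close> ends earlier as well, and its blank has been
                propagated to this position.\<close>
              then have j: "j = bnd x" "length y2 < bnd x" using 3 by auto
              then have "sym_at z2 (length y2) = 0"
                using same[of "length y2"] sym_eq_0_iff[of y2 "length y2"] by simp
              then have "length z2 < bnd x" using j(2) by (simp add: sym_eq_0_iff)
              moreover from this have "sym_at z2 j = 0" "sym_at y2 j = 0"
                using j by (auto simp: sym_eq_0_iff)
              ultimately show ?thesis using z2(1)[of j] 3 j by simp
            qed
          qed
        qed
      qed
      then show ?thesis using J(1) by blast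
    qed
    have "stable_model (atoms x) (sim_rules x) D I"
      unfolding stable_model_def
    proof (intro conjI)
      show "I \<subseteq> atoms x" by (simp add: I_def)
      show "\<not> (\<exists>J. J \<subset> I \<and> D \<subseteq> J \<and> (\<forall>r \<in> sim_rules x. rule_sat I J r))"
      proof (rule notI, elim exE conjE)
        fix J assume J: "J \<subset> I" "D \<subseteq> J" "\<forall>r \<in> sim_rules x. rule_sat I J r"
        from minimal[OF psubset_imp_subset[OF J(1)] J(2,3)] J(1) show False by simp
      qed
    qed (fact DI, fact model)
    then show "\<exists>I. stable_model (atoms x) (sim_rules x) D I \<and> gW \<in> I" using W by blast
  }
qed

end

section \<open>The reduction\<close>

context uniform_gadget
begin

lemma is_elp_progs:
  assumes "finite A" "finite R" "\<forall>r \<in> R. set (erule_atoms r) \<subseteq> A"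
  shows "is_elp prog1" "is_elp prog2"
proof -
  have elits: "finite elits" "\<forall>\<xi> \<in> elits. lit_atom (elit_lit \<xi>) \<in> A"
    using assms(1) w by (auto simp: elits_def)
  have R: "erule_over A elits r" if "r \<in> R" for r
  proof -
    have "erule_epos r = []" "erule_eneg r = []" "set (erule_atoms r) \<subseteq> A"
      using that no_epistemic assms(3) by auto
    then show ?thesis by (auto simp: erule_over_def erule_atoms_def)
  qed
  have forced: "erule_over A elits (forced l)" if "ENot l \<in> elits" for l
    using that by (simp add: erule_over_def forced_def)
  have rules: "\<forall>r \<in> insert (forced (NegLit w)) (R \<union> (\<lambda>a. forced (PosLit a)) ` (A - In)). erule_over A elits r"
    using R forced by (auto simp: elits_def)
  show "is_elp prog1" "is_elp prog2"
    using assms(1,2) elits rules by (auto simp: is_elp_def prog1_def prog2_def)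
qed

end

lemma in_concat_schemas:
  "(inp, bs, a) \<in> set (concat (map (\<lambda>(inp, bs, r). map (\<lambda>a. (inp, bs, a)) (g r)) S)) \<longleftrightarrow>
    (\<exists>r. (inp, bs, r) \<in> set S \<and> a \<in> set (g r))"
  by (induction S) auto

lemma in_map_filter_schemas:
  "(inp, bs, b) \<in> set (map (\<lambda>(inp, bs, a). (inp, bs, h a)) (filter (\<lambda>(inp, bs, a). P a) S)) \<longleftrightarrow>
    (\<exists>a. (inp, bs, a) \<in> set S \<and> P a \<and> b = h a)"
  by (induction S) auto

lemma in_ground_iff:
  "b \<in> set (ground f x S) \<longleftrightarrow>
    (\<exists>inp bs r e. (inp, bs, r) \<in> set S \<and> e \<in> set (schema_envs x inp bs) \<and> b = f e r)"
proof (induction S)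
  case Nil
  then show ?case by (simp add: ground_def)
next
  case (Cons s S)
  obtain inp0 bs0 r0 where s: "s = (inp0, bs0, r0)" by (cases s)
  have "b \<in> set (ground f x (s # S)) \<longleftrightarrow>
      (\<exists>e \<in> set (schema_envs x inp0 bs0). b = f e r0) \<or> b \<in> set (ground f x S)"
    by (auto simp: ground_def s)
  then show ?case unfolding Cons.IH s list.set insert_iff prod.inject by blast
qed

section \<open>Schemas for atoms, epistemic literals and constraints\<close>

context tableau
begin

definition atom_schemas :: "ix list schema list" where
  "atom_schemas = concat (map (\<lambda>(inp, bs, r). map (\<lambda>a. (inp, bs, a)) (erule_atoms r)) schemas)"

text \<open>Each selected atom keeps the binders of the rule schema it occurs in. Atoms are listed
  once per occurrence; repetitions vanish in the sets of \<open>elp_of\<close>.\<close>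

definition select :: "(nat \<Rightarrow> bool) \<Rightarrow> (ix list \<Rightarrow> 'b) \<Rightarrow> 'b schema list" where
  "select P h = map (\<lambda>(inp, bs, a). (inp, bs, h a)) (filter (\<lambda>(inp, bs, a). P (fst (hd a))) atom_schemas)"

lemma in_atom_schemas:
  "(inp, bs, a) \<in> set atom_schemas \<longleftrightarrow> (\<exists>r. (inp, bs, r) \<in> set schemas \<and> a \<in> set (erule_atoms r))"
  unfolding atom_schemas_def by (rule in_concat_schemas)

lemma in_select:
  "(inp, bs, b) \<in> set (select P h) \<longleftrightarrow>
    (\<exists>a. (inp, bs, a) \<in> set atom_schemas \<and> P (fst (hd a)) \<and> b = h a)"
  unfolding select_def by (rule in_map_filter_schemas)

lemma in_atoms_iff:
  "b \<in> atoms x \<longleftrightarrow>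
    (\<exists>inp bs a e. (inp, bs, a) \<in> set atom_schemas \<and> e \<in> set (schema_envs x inp bs) \<and> b = atom_val e a)"
proof
  assume "b \<in> atoms x"
  then obtain r' where "r' \<in> rules0 x" and b: "b \<in> set (erule_atoms r')" by (auto simp: atoms_def)
  then obtain inp bs r e where "(inp, bs, r) \<in> set schemas" "e \<in> set (schema_envs x inp bs)"
    and r': "r' = map_erule (atom_val e) r" unfolding rules0_def in_ground_iff by blast
  moreover obtain a where "a \<in> set (erule_atoms r)" "b = atom_val e a"
    using b by (auto simp: r' erule_atoms_map_erule)
  ultimately show "\<exists>inp bs a e. (inp, bs, a) \<in> set atom_schemas \<and>
      e \<in> set (schema_envs x inp bs) \<and> b = atom_val e a"
    unfolding in_atom_schemas by blast
next
  assume "\<exists>inp bs a e. (inp, bs, a) \<in> set atom_schemas \<and>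
      e \<in> set (schema_envs x inp bs) \<and> b = atom_val e a"
  then obtain inp bs a e r where "(inp, bs, r) \<in> set schemas" "e \<in> set (schema_envs x inp bs)"
    and a: "a \<in> set (erule_atoms r)" "b = atom_val e a"
    unfolding in_atom_schemas by blast
  then have "map_erule (atom_val e) r \<in> rules0 x" unfolding rules0_def in_ground_iff by blast
  moreover have "b \<in> set (erule_atoms (map_erule (atom_val e) r))"
    using a by (simp add: erule_atoms_map_erule)
  ultimately show "b \<in> atoms x" by (auto simp: atoms_def)
qed

lemma hd_atom_schemas:
  assumes "(inp, bs, a) \<in> set atom_schemas"
  shows "hd (atom_val e a) = fst (hd a)"
proof -
  obtain r where r: "(inp, bs, r) \<in> set schemas" "a \<in> set (erule_atoms r)"
    using assms in_atom_schemas by blast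
  then have "schema_shape (inp, bs, r)" using schema_shape_schemas by blast
  then show ?thesis using r(2) by (intro hd_atom_val) (auto simp: schema_shape_def)
qed

lemma set_ground_select:
  assumes "\<And>e a. f e (h a) = g (atom_val e a)"
  shows "set (ground f x (select P h)) = g ` {a \<in> atoms x. P (hd a)}"
proof (intro set_eqI iffI)
  fix b assume "b \<in> set (ground f x (select P h))"
  then obtain inp bs a e where a: "(inp, bs, a) \<in> set atom_schemas" "P (fst (hd a))"
    "e \<in> set (schema_envs x inp bs)" "b = f e (h a)"
    unfolding in_ground_iff in_select by blast
  then have "atom_val e a \<in> atoms x" "P (hd (atom_val e a))"
    using in_atoms_iff hd_atom_schemas by auto
  then show "b \<in> g ` {a \<in> atoms x. P (hd a)}" using a(4) assms by auto
next
  fix b assume "b \<in> g ` {a \<in> atoms x. P (hd a)}"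
  then obtain inp bs a e where a: "(inp, bs, a) \<in> set atom_schemas" "P (hd (atom_val e a))"
    "e \<in> set (schema_envs x inp bs)" "b = g (atom_val e a)"
    using in_atoms_iff by auto
  then have "(inp, bs, h a) \<in> set (select P h)" using hd_atom_schemas in_select by metis
  then show "b \<in> set (ground f x (select P h))"
    unfolding in_ground_iff using a(3,4) assms by metis
qed

lemma schemas_ok: "\<forall>s \<in> set schemas. schema_ok erule_atoms s"
  using schema_shape_schemas unfolding schema_shape_def by blast

lemma schema_ok_select:
  assumes "\<And>a. set (ats (h a)) \<subseteq> {a, sW}"
  shows "\<forall>s \<in> set (select P h). schema_ok ats s"
proof
  fix s assume "s \<in> set (select P h)"
  moreover obtain inp bs b where "s = (inp, bs, b)" by (cases s)
  ultimately obtain a where s: "s = (inp, bs, h a)" "(inp, bs, a) \<in> set atom_schemas"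
    by (auto simp: in_select)
  then obtain r where r: "(inp, bs, r) \<in> set schemas" "a \<in> set (erule_atoms r)"
    using in_atom_schemas by blast
  have "schema_ok erule_atoms (inp, bs, r)" by (rule bspec[OF schemas_ok r(1)])
  then have "binders_ok (start_depth inp) bs" "atom_vars a \<subseteq> {..<start_depth inp + length bs}"
    using r(2) by auto
  moreover have "atom_vars sW = {}" by (simp add: atom_vars_def sW_def cst_def)
  ultimately show "schema_ok ats s" using assms[of a] s(1) by auto
qed

definition rule_schemas1 :: "ix list erule schema list" where
  "rule_schemas1 = schemas @ select sat_tag (\<lambda>a. horn a [sW]) @
    select (\<lambda>c. c \<ge> 2) (\<lambda>a. forced (PosLit a))"

definition rule_schemas2 :: "ix list erule schema list" where
  "rule_schemas2 = (False, [], forced (NegLit sW)) # rule_schemas1"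

definition elit_schemas :: "ix list elit schema list" where
  "elit_schemas = (False, [], ENot (NegLit sW)) # select (\<lambda>c. c \<ge> 2) (\<lambda>a. ENot (PosLit a))"

definition instance_list ::
  "bits \<Rightarrow> bits list \<times> bits elit list \<times> bits erule list \<times> bits erule list" where
  "instance_list x =
    (map atom_name (ground atom_val x (select (\<lambda>_. True) (\<lambda>a. a))),
     map (map_elit atom_name) (ground (\<lambda>e. map_elit (atom_val e)) x elit_schemas),
     map (map_erule atom_name) (ground (\<lambda>e. map_erule (atom_val e)) x rule_schemas1),
     map (map_erule atom_name) (ground (\<lambda>e. map_erule (atom_val e)) x rule_schemas2))"

lemma polytime_instance:
  "polytime_computable (\<lambda>x. case instance_list x of (as, es, rs1, rs2) \<Rightarrow> enc_instance as es rs1 rs2)"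
proof -
  have sW: "atom_vars sW = {}" by (simp add: atom_vars_def sW_def cst_def)
  have 1: "\<forall>s \<in> set (select (\<lambda>_. True) (\<lambda>a. a)). schema_ok (\<lambda>a. [a]) s"
    by (rule schema_ok_select) simp
  have "\<forall>s \<in> set (select (\<lambda>c. c \<ge> 2) (\<lambda>a. ENot (PosLit a))). schema_ok (\<lambda>l. [lit_atom (elit_lit l)]) s"
    by (rule schema_ok_select) simp
  then have 2: "\<forall>s \<in> set elit_schemas. schema_ok (\<lambda>l. [lit_atom (elit_lit l)]) s"
    by (simp add: elit_schemas_def sW)
  have "\<forall>s \<in> set (select sat_tag (\<lambda>a. horn a [sW])). schema_ok erule_atoms s"
    "\<forall>s \<in> set (select (\<lambda>c. c \<ge> 2) (\<lambda>a. forced (PosLit a))). schema_ok erule_atoms s"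
    by (rule schema_ok_select; simp add: erule_atoms_def horn_def forced_def)+
  then have 3: "\<forall>s \<in> set rule_schemas1. schema_ok erule_atoms s"
    using schemas_ok unfolding rule_schemas1_def set_append ball_Un by blast
  then have 4: "\<forall>s \<in> set rule_schemas2. schema_ok erule_atoms s"
    by (simp add: rule_schemas2_def erule_atoms_def forced_def sW)
  from polytime_computable_enc_instance[OF 1 2 3 4] show ?thesis
    by (simp add: instance_list_def)
qed

end

section \<open>From uniform equivalence to the quantified statement\<close>

context reduction
begin

abbreviation "names_atoms x \<equiv> atom_name ` atoms x"
abbreviation "names_inputs x \<equiv> atom_name ` inputs x"
abbreviation "names_rules x \<equiv> map_erule atom_name ` sim_rules x"

lemma sim_rules_no_epistemic: "r \<in> sim_rules x \<Longrightarrow> erule_epos r = [] \<and> erule_eneg r = []"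
  using rules0_shape(1,2) by (auto simp: sim_rules_def horn_def)

lemma gadget: "uniform_gadget (names_atoms x) (names_inputs x) (names_rules x) (atom_name gW)"
proof
  show "\<forall>r \<in> names_rules x. erule_epos r = [] \<and> erule_eneg r = []"
    using sim_rules_no_epistemic by (auto simp: erule.map_sel)
  show "names_inputs x \<subseteq> names_atoms x" by (auto simp: inputs_def)
  show "atom_name gW \<in> names_atoms x - names_inputs x"
    using gW_in_atoms by (simp add: inj_image_mem_iff[OF inj_atom_name] inputs_def)
  fix D' a' assume D': "D' \<subseteq> names_inputs x" and a': "a' \<in> names_atoms x - names_inputs x"
  obtain D where D: "D \<subseteq> inputs x" "D' = atom_name ` D" using D' by (rule subset_imageE)
  obtain a where a: "a \<in> atoms x - inputs x" "a' = atom_name a" using a' by blast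
  obtain I where I: "stable_model (atoms x) (sim_rules x) D I" "a \<notin> I"
    using avoidable[OF D(1) a(1)] by blast
  have "stable_model (names_atoms x) (names_rules x) D' (atom_name ` I)"
    using I(1) unfolding D(2) stable_model_map_erule[OF inj_atom_name] .
  moreover have "a' \<notin> atom_name ` I" using I(2) a(2) inj_image_mem_iff[OF inj_atom_name] by blast
  ultimately show "\<exists>I. stable_model (names_atoms x) (names_rules x) D' I \<and> a' \<notin> I" by blast
qed

lemma stable_model_names:
  assumes "D \<subseteq> inputs x"
  shows "(\<exists>I. stable_model (names_atoms x) (names_rules x) (atom_name ` D) I \<and> atom_name gW \<in> I) \<longleftrightarrow>
    (\<exists>I. stable_model (atoms x) (sim_rules x) D I \<and> gW \<in> I)" (is "?l \<longleftrightarrow> ?r")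
proof
  assume ?l
  then obtain I' where I': "stable_model (names_atoms x) (names_rules x) (atom_name ` D) I'"
    "atom_name gW \<in> I'" by blast
  then have "I' \<subseteq> names_atoms x" by (simp add: stable_model_def)
  then obtain I where "I' = atom_name ` I" by (rule subset_imageE)
  then have "stable_model (atoms x) (sim_rules x) D I \<and> gW \<in> I"
    using I' by (simp add: stable_model_map_erule[OF inj_atom_name] inj_image_mem_iff[OF inj_atom_name])
  then show ?r by blast
next
  assume ?r
  then obtain I where "stable_model (atoms x) (sim_rules x) D I" "gW \<in> I" by blast
  then have "stable_model (names_atoms x) (names_rules x) (atom_name ` D) (atom_name ` I) \<and>
      atom_name gW \<in> atom_name ` I"
    by (simp add: stable_model_map_erule[OF inj_atom_name])
  then show ?l by blast
qed

text \<open>The truncation in \<open>ustr\<close> absorbs the length bounds of all three strings.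
  For the first one, every \<open>D\<close> decodes to some string, and every \<open>y1\<close>
  within its bound is the decoding of some \<open>D\<close>.\<close>

lemma quantifiers:
  "(\<forall>D \<subseteq> inputs x. \<exists>y2. \<forall>y3. ustr x (assignment D y2 y3) 3 \<in> L) \<longleftrightarrow>
    (\<forall>y1. length y1 \<le> poly (quant_poly 0) (length x) \<longrightarrow>
      (\<exists>y2. length y2 \<le> poly (quant_poly 1) (length (pair_bits x y1)) \<and>
        (\<forall>y3. length y3 \<le> poly (quant_poly 2) (length (pair_bits (pair_bits x y1) y2)) \<longrightarrow>
          pair_bits (pair_bits (pair_bits x y1) y2) y3 \<in> L)))" (is "?l \<longleftrightarrow> ?r")
proof -
  let ?t1 = "\<lambda>D. take (poly (quant_poly 0) (length x)) (decode D)"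
  let ?t2 = "\<lambda>y1 y2. take (poly (quant_poly 1) (length (pair_bits x y1))) y2"
  let ?t3 = "\<lambda>y1 y2 y3. take (poly (quant_poly 2) (length (pair_bits (pair_bits x y1) y2))) y3"
  have ustr: "ustr x (assignment D y2 y3) 3 =
      (let y1' = ?t1 D; y2' = ?t2 y1' y2; y3' = ?t3 y1' y2' y3
       in pair_bits (pair_bits (pair_bits x y1') y2') y3')" for D y2 y3
    by (simp add: numeral_3_eq_3 numeral_2_eq_2 assignment_def Let_def)
  show ?thesis
  proof
    assume l: ?l
    show ?r
    proof (intro allI impI)
      fix y1 :: bits assume y1: "length y1 \<le> poly (quant_poly 0) (length x)"
      then have len: "length y1 < bnd x" using quant_bound[of 0 x] by simp
      \<comment> \<open>\<open>gN\<close> marks the positions of \<open>y1\<close> and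
        \<open>gA\<close> its \<open>True\<close> bits; by \<open>len\<close> all these atoms occur
        in the program.\<close>
      define D where "D = gN ` {..<length y1} \<union> gA ` {j. j < length y1 \<and> y1 ! j}"
      have D: "D \<subseteq> inputs x" using input_atoms len by (auto simp: D_def)
      have N: "gN j \<in> D \<longleftrightarrow> j < length y1" and A: "gA j \<in> D \<longleftrightarrow> j < length y1 \<and> y1 ! j" for j
        by (auto simp: D_def gN_def gA_def)
      have "(LEAST j. gN j \<notin> D) = length y1"
        by (rule Least_equality) (auto simp: N)
      then have dec: "decode D = y1"
        by (auto simp: decode_def A intro!: nth_equalityI)
      obtain y2 where y2: "\<And>y3. ustr x (assignment D y2 y3) 3 \<in> L" using l D by blast
      have t1: "?t1 D = y1" using dec y1 by simp
      show "\<exists>y2. length y2 \<le> poly (quant_poly 1) (length (pair_bits x y1)) \<and>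
        (\<forall>y3. length y3 \<le> poly (quant_poly 2) (length (pair_bits (pair_bits x y1) y2)) \<longrightarrow>
          pair_bits (pair_bits (pair_bits x y1) y2) y3 \<in> L)"
      proof (intro exI[of _ "?t2 y1 y2"] conjI allI impI)
        fix y3 :: bits
        assume "length y3 \<le> poly (quant_poly 2) (length (pair_bits (pair_bits x y1) (?t2 y1 y2)))"
        then show "pair_bits (pair_bits (pair_bits x y1) (?t2 y1 y2)) y3 \<in> L"
          using y2[of y3] unfolding ustr Let_def t1 by simp
      qed simp
    qed
  next
    assume r: ?r
    show ?l
    proof (intro allI impI)
      fix D assume "D \<subseteq> inputs x"
      have "length (?t1 D) \<le> poly (quant_poly 0) (length x)" by simp
      with r obtain y2 where y2: "length y2 \<le> poly (quant_poly 1) (length (pair_bits x (?t1 D)))"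
        "\<And>y3. length y3 \<le> poly (quant_poly 2) (length (pair_bits (pair_bits x (?t1 D)) y2)) \<Longrightarrow>
          pair_bits (pair_bits (pair_bits x (?t1 D)) y2) y3 \<in> L" by blast
      have "?t2 (?t1 D) y2 = y2" using y2(1) by simp
      then have "ustr x (assignment D y2 y3) 3 \<in> L" for y3
        unfolding ustr Let_def using y2(2)[of "?t3 (?t1 D) y2 y3"] by simp
      then show "\<exists>y2. \<forall>y3. ustr x (assignment D y2 y3) 3 \<in> L" by blast
    qed
  qed
qed

theorem reduction_correct:
  "(case instance_list x of (as, es, rs1, rs2) \<Rightarrow> enc_instance as es rs1 rs2) \<in> UNIFORM_WV_EQUIVALENCE \<longleftrightarrow>
    (\<forall>y1. length y1 \<le> poly (quant_poly 0) (length x) \<longrightarrow>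
      (\<exists>y2. length y2 \<le> poly (quant_poly 1) (length (pair_bits x y1)) \<and>
        (\<forall>y3. length y3 \<le> poly (quant_poly 2) (length (pair_bits (pair_bits x y1) y2)) \<longrightarrow>
          pair_bits (pair_bits (pair_bits x y1) y2) y3 \<in> L)))"
proof -
  interpret g: uniform_gadget "names_atoms x" "names_inputs x" "names_rules x" "atom_name gW"
    by (rule gadget)
  obtain as es rs1 rs2 where inst: "instance_list x = (as, es, rs1, rs2)"
    by (cases "instance_list x")
  have int: "names_atoms x - names_inputs x = atom_name ` {a \<in> atoms x. hd a \<ge> 2}"
  proof -
    have "atoms x - inputs x = {a \<in> atoms x. hd a \<ge> 2}" by (auto simp: inputs_def)
    then show ?thesis using image_set_diff[OF inj_atom_name, of "atoms x" "inputs x"] by simp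
  qed
  have as: "set as = names_atoms x"
    using inst set_ground_select[where f = atom_val and h = "\<lambda>a. a" and g = "\<lambda>a. a" and P = "\<lambda>_. True"]
    by (auto simp: instance_list_def)
  have forced_map: "map_erule f (forced l) = forced (map_lit f l)" for f and l :: "'x lit"
    by (simp add: forced_def)
  have env0: "schema_envs x False [] = [[length x]]" by (simp add: schema_envs_False)
  have ground_Cons: "ground f x ((False, [], r) # S) = f [length x] r # ground f x S" for f :: "nat list \<Rightarrow> 'y \<Rightarrow> 'z" and r S
    by (simp add: ground_def env0)
  have "set (ground (\<lambda>e. map_elit (atom_val e)) x (select (\<lambda>c. c \<ge> 2) (\<lambda>a. ENot (PosLit a)))) =
      (\<lambda>a. ENot (PosLit a)) ` {a \<in> atoms x. hd a \<ge> 2}"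
    by (rule set_ground_select) simp
  then have es: "set es = g.elits"
    using inst by (auto simp: instance_list_def elit_schemas_def ground_Cons g.elits_def int image_image)
  have ground_append: "ground f x (S @ S') = ground f x S @ ground f x S'" for f :: "nat list \<Rightarrow> 'y \<Rightarrow> 'z" and S S'
    by (simp add: ground_def)
  have "set (ground (\<lambda>e. map_erule (atom_val e)) x (select (\<lambda>c. c \<ge> 2) (\<lambda>a. forced (PosLit a)))) =
      (\<lambda>a. forced (PosLit a)) ` {a \<in> atoms x. hd a \<ge> 2}"
    "set (ground (\<lambda>e. map_erule (atom_val e)) x (select sat_tag (\<lambda>a. horn a [sW]))) =
      (\<lambda>a. horn a [gW]) ` {a \<in> atoms x. sat_tag (hd a)}"
    by (rule set_ground_select; simp add: forced_def)+
  then have rules1: "set (ground (\<lambda>e. map_erule (atom_val e)) x rule_schemas1) =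
      sim_rules x \<union> (\<lambda>a. forced (PosLit a)) ` {a \<in> atoms x. hd a \<ge> 2}"
    by (simp add: rule_schemas1_def ground_append sim_rules_def rules0_def Un_assoc)
  have rs1: "set rs1 = names_rules x \<union> (\<lambda>a. forced (PosLit a)) ` (names_atoms x - names_inputs x)"
    using inst rules1 by (auto simp: instance_list_def int image_Un image_image forced_map)
  have rs2: "set rs2 = insert (forced (NegLit (atom_name gW))) (set rs1)"
    using inst by (auto simp: instance_list_def rule_schemas2_def ground_Cons forced_map)
  have progs: "elp_of as es rs1 = g.prog1" "elp_of as es rs2 = g.prog2"
    by (simp_all add: elp_of_def as es rs1 rs2 g.prog1_def g.prog2_def)
  have fin: "finite (names_atoms x)" "finite (names_rules x)"
    using finite_atoms by (auto simp: sim_rules_def rules0_def)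
  have "\<forall>r \<in> sim_rules x. set (erule_atoms r) \<subseteq> atoms x"
    using gW_in_atoms by (auto simp: sim_rules_def atoms_def erule_atoms_def horn_def)
  then have over: "\<forall>r \<in> names_rules x. set (erule_atoms r) \<subseteq> names_atoms x"
    by (auto simp: erule_atoms_map_erule)
  have "enc_instance as es rs1 rs2 \<in> UNIFORM_WV_EQUIVALENCE \<longleftrightarrow>
      is_elp (elp_of as es rs1) \<and> is_elp (elp_of as es rs2) \<and>
      uniformly_WV_equivalent (elp_of as es rs1) (elp_of as es rs2)"
    by (auto simp: UNIFORM_WV_EQUIVALENCE_def enc_instance_inject)
  also have "\<dots> \<longleftrightarrow> (\<forall>D' \<subseteq> names_inputs x. \<exists>I. stable_model (names_atoms x) (names_rules x) D' I \<and> atom_name gW \<in> I)"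
    unfolding progs g.uniformly_equivalent_iff using g.is_elp_progs[OF fin over] by blast
  also have "\<dots> \<longleftrightarrow> (\<forall>D \<subseteq> inputs x. \<exists>I. stable_model (atoms x) (sim_rules x) D I \<and> gW \<in> I)"
    unfolding all_subset_image by (simp add: stable_model_names)
  also have "\<dots> \<longleftrightarrow> (\<forall>D \<subseteq> inputs x. \<exists>y2. \<forall>y3. ustr x (assignment D y2 y3) 3 \<in> L)"
    by (simp add: stable_model_iff)
  finally show ?thesis unfolding quantifiers inst by simp
qed

end

theorem theorem5: "hard_for (Pi_P 3) UNIFORM_WV_EQUIVALENCE"
  unfolding hard_for_def
proof
  fix K assume "K \<in> Pi_P 3"
  then have "K \<in> Pi_P (Suc (Suc (Suc 0)))" by (simp only: numeral_3_eq_3)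
  then obtain L1 and p0 :: "nat poly" where "L1 \<in> Sigma_P (Suc (Suc 0))" and
    L1: "\<And>x. x \<in> K \<longleftrightarrow> (\<forall>y. length y \<le> poly p0 (length x) \<longrightarrow> pair_bits x y \<in> L1)"
    unfolding Pi_P.simps(2)[of "Suc (Suc 0)"] mem_Collect_eq by blast
  then obtain L2 and p1 :: "nat poly" where "L2 \<in> Pi_P (Suc 0)" and
    L2: "\<And>x. x \<in> L1 \<longleftrightarrow> (\<exists>y. length y \<le> poly p1 (length x) \<and> pair_bits x y \<in> L2)"
    unfolding Sigma_P.simps(2)[of "Suc 0"] mem_Collect_eq by blast
  then obtain L and p2 :: "nat poly" where "L \<in> PTIME" and
    L: "\<And>x. x \<in> L2 \<longleftrightarrow> (\<forall>y. length y \<le> poly p2 (length x) \<longrightarrow> pair_bits x y \<in> L)"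
    unfolding Pi_P.simps(2)[of 0] Sigma_P.simps(1) mem_Collect_eq by blast
  then obtain M tp where M: "is_tm M" "tm_computes_in_time M (\<lambda>w. [w \<in> L]) (poly tp)"
    by (auto simp: PTIME_def polytime_computable_def)
  define quant :: "nat \<Rightarrow> nat poly" where
    "quant k = (if k = 0 then p0 else if k = 1 then p1 else p2)" for k
  \<comment> \<open>\<open>[:1, 2:]\<close> comes from the length of \<open>pair_bits u y\<close>,
    which is one plus twice the length of \<open>u\<close> plus the length of \<open>y\<close>. Thus
    \<open>l1\<close>, \<open>l2\<close>, \<open>l3\<close> bound the lengths of the three nested
    pairs.\<close>
  define l1 where "l1 = [:1, 2:] + p0"
  define l2 where "l2 = pcompose ([:1, 2:] + p1) l1"
  define l3 where "l3 = pcompose ([:1, 2:] + p2) l2"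
  \<comment> \<open>One summand for each bound required by \<open>reduction\<close>, including the
    factor \<open>2\<close> of \<open>time_bound\<close>; the constant \<open>1\<close> makes the
    inequalities strict.\<close>
  define size where "size = [:1, 1:] + l1 + l2 + l3 + p0 + pcompose p1 l1 + pcompose p2 l2 +
    smult 2 (pcompose tp l3)"
  interpret T: tableau M size quant by standard (fact M(1))
  have len: "length (T.ustr x v 1) \<le> poly l1 (length x)" "length (T.ustr x v 2) \<le> poly l2 (length x)"
    "length (T.ustr x v 3) \<le> poly l3 (length x)" for x v
  proof -
    have Suc: "length (T.ustr x v (Suc k)) \<le> poly ([:1, 2:] + quant k) (length (T.ustr x v k))" for k
      by (simp add: length_pair_bits)
    show 1: "length (T.ustr x v 1) \<le> poly l1 (length x)"
      using Suc[of 0] by (simp add: l1_def quant_def)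
    have "length (T.ustr x v 2) \<le> poly ([:1, 2:] + p1) (length (T.ustr x v 1))"
      using Suc[of 1] by (simp add: quant_def numeral_2_eq_2)
    also have "\<dots> \<le> poly l2 (length x)"
      unfolding l2_def poly_pcompose by (rule poly_mono_nat[OF 1])
    finally show 2: "length (T.ustr x v 2) \<le> poly l2 (length x)" .
    have "length (T.ustr x v 3) \<le> poly ([:1, 2:] + p2) (length (T.ustr x v 2))"
      using Suc[of 2] by (simp add: quant_def numeral_3_eq_3 numeral_2_eq_2)
    also have "\<dots> \<le> poly l3 (length x)"
      unfolding l3_def poly_pcompose by (rule poly_mono_nat[OF 2])
    finally show "length (T.ustr x v 3) \<le> poly l3 (length x)" .
  qed
  have size: "poly size n = 1 + n + poly l1 n + poly l2 n + poly l3 n + poly p0 n +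
      poly p1 (poly l1 n) + poly p2 (poly l2 n) + 2 * poly tp (poly l3 n)" for n
    by (simp add: size_def poly_pcompose)
  interpret R: reduction M size quant L tp
  proof
    show "tm_computes_in_time M (\<lambda>w. [w \<in> L]) (poly tp)" by (fact M(2))
    fix x v
    show "length (T.ustr x v k) < poly size (length x)" if "k \<le> 3" for k
    proof -
      consider "k = 0" | "k = 1" | "k = 2" | "k = 3" using \<open>k \<le> 3\<close> by linarith
      then show ?thesis using len[of x v] by cases (simp_all add: size del: T.ustr.simps(2))
    qed
    show "poly (quant k) (length (T.ustr x v k)) < poly size (length x)" if "k < 3" for k
    proof -
      have mono: "poly p1 (length (T.ustr x v 1)) \<le> poly p1 (poly l1 (length x))"
        "poly p2 (length (T.ustr x v 2)) \<le> poly p2 (poly l2 (length x))"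
        by (intro poly_mono_nat len)+
      consider "k = 0" | "k = 1" | "k = 2" using \<open>k < 3\<close> by linarith
      then show ?thesis using mono by cases (simp_all add: size quant_def del: T.ustr.simps(2))
    qed
    have "poly tp (length (T.ustr x v 3)) \<le> poly tp (poly l3 (length x))"
      by (intro poly_mono_nat len)
    then show "2 * poly tp (length (T.ustr x v 3)) < poly size (length x)"
      by (simp add: size del: T.ustr.simps)
  qed
  let ?f = "\<lambda>x. case T.instance_list x of (as, es, rs1, rs2) \<Rightarrow> enc_instance as es rs1 rs2"
  have "x \<in> K \<longleftrightarrow> ?f x \<in> UNIFORM_WV_EQUIVALENCE" for x
    unfolding R.reduction_correct L1 L2 L by (simp add: quant_def)
  then show "polytime_reducible K UNIFORM_WV_EQUIVALENCE"
    unfolding polytime_reducible_def using T.polytime_instance by blast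
qed

end
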